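(* Let $\gamma>0$, let $\mathcal M=[-1,1]\times[0,1]$ or $\mathcal M=[-1,1]\times(\mathbb R/\mathbb Z)$, with coordinates $(x_1,x_2)$ and the Lebesgue measure, and let $\mathcal L_\gamma=-\big(\partial_{x_1}^2+|x_1|^{2\gamma}\partial_{x_2}^2\big)$ with Dirichlet conditions on $\partial\mathcal M$. Let $\omega\subset\mathcal M$ be an open set such that $\overline\omega\cap\{x_1=0\}=\emptyset$. Then there exist $C,c_0>0$ and a sequence $(\lambda_j,\varphi_j)$ of eigenvalues and associated eigenfunctions of $\mathcal L_\gamma$ with $\lambda_j\to+\infty$ such that $$\|\varphi_j\|_{L^2(\omega)}\le C e^{-c_0\lambda_j^{\frac{\gamma+1}{2}}}\|\varphi_j\|_{L^2(\mathcal M)} .$$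
   Context: $\mathcal L_\gamma$ is viewed as a nonnegative selfadjoint operator on $L^2(\mathcal M)$ (Friedrichs extension from $C^\infty_0(\mathrm{Int}(\mathcal M))$, i.e. Dirichlet boundary conditions on $\partial\mathcal M$; when $\mathcal M=[-1,1]\times(\mathbb R/\mathbb Z)$, $\partial\mathcal M=\{-1,1\}\times(\mathbb R/\mathbb Z)$). *)

theory Defs
  imports "HOL-Analysis.Analysis"
begin

section \<open>The circle \<open>\<real>/\<int>\<close>\<close>

quotient_type circle = real / "\<lambda>x y. x - y \<in> \<int>"
  morphisms rep_circle to_circle
proof (rule equivpI)
  show "reflp (\<lambda>x y :: real. x - y \<in> \<int>)"
    by (simp add: reflp_def)
  show "symp (\<lambda>x y :: real. x - y \<in> \<int>)"
  proof (rule sympI)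
    fix x y :: real assume "x - y \<in> \<int>"
    then have "- (x - y) \<in> \<int>" by (rule Ints_minus)
    then show "y - x \<in> \<int>" by simp
  qed
  show "transp (\<lambda>x y :: real. x - y \<in> \<int>)"
  proof (rule transpI)
    fix x y z :: real assume "x - y \<in> \<int>" "y - z \<in> \<int>"
    then have "(x - y) + (y - z) \<in> \<int>" by (rule Ints_add)
    then show "x - z \<in> \<int>" by simp
  qed
qed

instantiation circle :: ab_group_add
begin

lift_definition zero_circle :: circle is 0 .

lift_definition plus_circle :: "circle \<Rightarrow> circle \<Rightarrow> circle" is "(+)"
proof -
  fix a b c d :: real assume "a - b \<in> \<int>" "c - d \<in> \<int>"
  then have "(a - b) + (c - d) \<in> \<int>" by (rule Ints_add)
  then show "(a + c) - (b + d) \<in> \<int>" by (simp add: algebra_simps)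
qed

lift_definition uminus_circle :: "circle \<Rightarrow> circle" is uminus
proof -
  fix a b :: real assume "a - b \<in> \<int>"
  then have "- (a - b) \<in> \<int>" by (rule Ints_minus)
  then show "- a - - b \<in> \<int>" by simp
qed

definition minus_circle :: "circle \<Rightarrow> circle \<Rightarrow> circle"
  where "minus_circle a b = a + - b"

instance
proof
  fix a b c :: circle
  show "a + b + c = a + (b + c)"
    by transfer (simp add: add.assoc)
  show "a + b = b + a"
    by transfer (simp add: add.commute)
  show "0 + a = a"
    by transfer simp
  show "- a + a = 0"
    by transfer simp
  show "a - b = a + - b"
    by (rule minus_circle_def)
qed

end

text \<open>Quotient topology.\<close>

instantiation circle :: topological_space
begin

definition open_circle :: "circle set \<Rightarrow> bool"
  where "open_circle U \<longleftrightarrow> open (to_circle -` U)"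

instance
  by standard (simp_all add: open_circle_def vimage_Union open_Int open_UN)

end


section \<open>Square-integrable functions\<close>

definition L2 :: "'a measure \<Rightarrow> ('a \<Rightarrow> complex) set"
  where "L2 N = {f \<in> borel_measurable N. integrable N (\<lambda>x. (cmod (f x))\<^sup>2)}"

definition L2_inner :: "'a measure \<Rightarrow> ('a \<Rightarrow> complex) \<Rightarrow> ('a \<Rightarrow> complex) \<Rightarrow> complex"
  where "L2_inner N f g = (\<integral>x. f x * cnj (g x) \<partial>N)"

text \<open>The norm of \<open>L\<^sup>2(E)\<close>; meaningful for square-integrable functions only, since the integral of
  a non-integrable function is \<open>0\<close>.\<close>

definition L2_norm_on :: "'a measure \<Rightarrow> 'a set \<Rightarrow> ('a \<Rightarrow> complex) \<Rightarrow> real"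
  where "L2_norm_on N E f = sqrt (set_lebesgue_integral N E (\<lambda>x. (cmod (f x))\<^sup>2))"

abbreviation L2_norm :: "'a measure \<Rightarrow> ('a \<Rightarrow> complex) \<Rightarrow> real"
  where "L2_norm N f \<equiv> L2_norm_on N (space N) f"


section \<open>The Friedrichs extension\<close>

text \<open>Let \<open>S\<close> be a nonnegative symmetric operator on \<open>L\<^sup>2(N)\<close> with dense domain \<open>D\<close>, and
  \<open>q(u, v) = \<langle>S u, v\<rangle>\<close> its form. A function \<open>u\<close> lies in the domain of the closure of \<open>q\<close> iff
  \<open>form_approx N D S us u\<close> for some sequence \<open>us\<close>; the closure takes the value
  \<open>lim q(us n, vs n)\<close> at \<open>(u, v)\<close>, which does not depend on the approximating sequences.\<close>

definition form_approx ::
  "'a measure \<Rightarrow> ('a \<Rightarrow> complex) set \<Rightarrow> (('a \<Rightarrow> complex) \<Rightarrow> 'a \<Rightarrow> complex) \<Rightarrow>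
   (nat \<Rightarrow> 'a \<Rightarrow> complex) \<Rightarrow> ('a \<Rightarrow> complex) \<Rightarrow> bool"
  where "form_approx N D S us u \<longleftrightarrow>
    u \<in> L2 N \<and> (\<forall>n. us n \<in> D) \<and>
    (\<lambda>n. L2_norm N (\<lambda>x. us n x - u x)) \<longlonglongrightarrow> 0 \<and>
    (\<forall>e>0. \<exists>K. \<forall>m\<ge>K. \<forall>n\<ge>K.
       cmod (L2_inner N (S (\<lambda>x. us m x - us n x)) (\<lambda>x. us m x - us n x)) < e)"

text \<open>The graph of the selfadjoint operator \<open>A\<close> associated with the closed form: \<open>u\<close> is in the
  domain of \<open>A\<close> and \<open>A u = f\<close> almost everywhere.\<close>

definition friedrichs ::
  "'a measure \<Rightarrow> ('a \<Rightarrow> complex) set \<Rightarrow> (('a \<Rightarrow> complex) \<Rightarrow> 'a \<Rightarrow> complex) \<Rightarrow>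
   ('a \<Rightarrow> complex) \<Rightarrow> ('a \<Rightarrow> complex) \<Rightarrow> bool"
  where "friedrichs N D S u f \<longleftrightarrow>
    f \<in> L2 N \<and>
    (\<exists>us. form_approx N D S us u \<and>
       (\<forall>v vs. form_approx N D S vs v \<longrightarrow>
          (\<lambda>n. L2_inner N (S (us n)) (vs n)) \<longlonglongrightarrow> L2_inner N f v))"

definition eigenpair ::
  "'a measure \<Rightarrow> (('a \<Rightarrow> complex) \<Rightarrow> ('a \<Rightarrow> complex) \<Rightarrow> bool) \<Rightarrow> real \<Rightarrow> ('a \<Rightarrow> complex) \<Rightarrow> bool"
  where "eigenpair N A l u \<longleftrightarrow>
    u \<in> L2 N \<and> L2_norm N u \<noteq> 0 \<and> A u (\<lambda>x. of_real l * u x)"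


section \<open>The Grushin operator\<close>

text \<open>The rectangle and the cylinder are handled uniformly. The second coordinate ranges over a
  group \<open>'b\<close> and \<open>p :: real \<Rightarrow> 'b\<close> is a homomorphism: \<open>id\<close> for the rectangle, \<open>to_circle\<close> for the
  cylinder. Derivatives in the second coordinate are taken along \<open>t \<mapsto> y + p t\<close>.\<close>

definition partial1 :: "(real \<times> 'b \<Rightarrow> complex) \<Rightarrow> real \<times> 'b \<Rightarrow> complex"
  where "partial1 f z = vector_derivative (\<lambda>t. f (t, snd z)) (at (fst z))"

definition partial2 ::
  "(real \<Rightarrow> 'b) \<Rightarrow> (real \<times> 'b \<Rightarrow> complex) \<Rightarrow> real \<times> 'b::ab_group_add \<Rightarrow> complex"
  where "partial2 p f z = vector_derivative (\<lambda>t. f (fst z, snd z + p t)) (at 0)"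

primrec C_k ::
  "(real \<Rightarrow> 'b) \<Rightarrow> nat \<Rightarrow> (real \<times> 'b::{topological_space,ab_group_add} \<Rightarrow> complex) \<Rightarrow> bool"
  where
    "C_k p 0 f \<longleftrightarrow> continuous_on UNIV f"
  | "C_k p (Suc k) f \<longleftrightarrow>
      continuous_on UNIV f \<and>
      (\<forall>z. (\<lambda>t. f (t, snd z)) differentiable (at (fst z))) \<and>
      (\<forall>z. (\<lambda>t. f (fst z, snd z + p t)) differentiable (at 0)) \<and>
      C_k p k (partial1 f) \<and> C_k p k (partial2 p f)"

text \<open>\<open>C\<^sub>0\<^sup>\<infinity>(Int M)\<close>, its elements being extended by zero to \<open>\<real> \<times> 'b\<close>.\<close>

definition test_functions ::
  "(real \<Rightarrow> 'b) \<Rightarrow> (real \<times> 'b) set \<Rightarrow>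
   (real \<times> 'b::{topological_space,ab_group_add} \<Rightarrow> complex) set"
  where "test_functions p M =
    {f. (\<forall>k. C_k p k f) \<and> compact (closure {z. f z \<noteq> 0}) \<and> closure {z. f z \<noteq> 0} \<subseteq> interior M}"

text \<open>Lebesgue measure on \<open>M\<close>, as the image of Lebesgue measure on the fundamental domain
  \<open>[-1,1] \<times> [0,1]\<close>. It is a measure on all of \<open>\<real> \<times> 'b\<close>, carried by \<open>M\<close>.\<close>

definition vol :: "(real \<Rightarrow> 'b) \<Rightarrow> (real \<times> 'b::topological_space) measure"
  where "vol p = distr (restrict_space lborel ({-1..1} \<times> {0..1})) borel (map_prod id p)"

definition grushin_expr ::
  "real \<Rightarrow> (real \<Rightarrow> 'b) \<Rightarrow> (real \<times> 'b \<Rightarrow> complex) \<Rightarrow> real \<times> 'b::ab_group_add \<Rightarrow> complex"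
  where "grushin_expr \<gamma> p f z =
    - (partial1 (partial1 f) z
       + of_real (\<bar>fst z\<bar> powr (2 * \<gamma>)) * partial2 p (partial2 p f) z)"

definition grushin ::
  "real \<Rightarrow> (real \<Rightarrow> 'b) \<Rightarrow> (real \<times> 'b) set \<Rightarrow>
   (real \<times> 'b::{topological_space,ab_group_add} \<Rightarrow> complex) \<Rightarrow> (real \<times> 'b \<Rightarrow> complex) \<Rightarrow> bool"
  where "grushin \<gamma> p M = friedrichs (vol p) (test_functions p M) (grushin_expr \<gamma> p)"

abbreviation rectangle :: "(real \<times> real) set"
  where "rectangle \<equiv> {-1..1} \<times> {0..1}"

abbreviation cylinder :: "(real \<times> circle) set"
  where "cylinder \<equiv> {-1..1} \<times> UNIV"

end

theory Submission
  imports Defs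
begin

text \<open>Separate variables: on both domains \<open>\<phi>(x\<^sub>1, x\<^sub>2) = v(x\<^sub>1) sin(\<kappa> x\<^sub>2)\<close> with \<open>\<kappa> = 2 \<pi> k\<close> is an
  eigenfunction when \<open>v\<close> is the Dirichlet ground state of \<open>- v'' + \<kappa>\<^sup>2 \<bar>x\<bar>\<^bsup>2\<gamma>\<^esup> v = \<lambda> v\<close> on \<open>[-1, 1]\<close>, which
  is found by shooting. Comparison on \<open>[0, \<kappa>\<^bsup>-1/(\<gamma>+1)\<^esup>]\<close> gives \<open>\<lambda> = O(\<kappa>\<^bsup>2/(\<gamma>+1)\<^esup>)\<close>, so that away
  from \<open>x\<^sub>1 = 0\<close> the potential exceeds \<open>\<lambda>\<close> by a multiple of \<open>\<kappa>\<^sup>2\<close> and \<open>v\<close> decays there like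
  \<open>exp(- c \<kappa>)\<close>, where \<open>\<kappa>\<close> dominates \<open>\<lambda>\<^bsup>(\<gamma>+1)/2\<^esup>\<close>. Since \<open>\<phi>\<close> is a classical solution and a limit
  of test functions in the form norm, it is an eigenfunction of the Friedrichs extension.\<close>

section \<open>Second-order linear differential equations\<close>

text \<open>The exponent 2 / (\<gamma> + 1) comes from balancing the potential against the kinetic
  cost of localisation; it is below 2, which leaves the eigenvalue far under the potential at any
  fixed distance from the degenerate line. Shooting replaces spectral theory: a positive even
  solution vanishing at 1 is enough, since positivity yields the upper bound, the lower bound that
  sends the eigenvalues to infinity (by comparison with a Gaussian) and the decay. The frequencies 2
  pi k make the sine vanish at 0 and 1 and have period 1, so one function serves both domains. The
  obstacle is the form domain. The weight is in general not smooth, so v is only known to be C^2,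
  and the normal derivative of the eigenfunction does not vanish on the Dirichlet boundary; smooth
  compactly supported functions must still approximate it together with its first derivatives. They
  are products of polynomials with cutoffs whose steep derivatives are tamed by the linear vanishing
  of the function, and pointwise convergence under uniform bounds gives the convergence in the form
  norm.\<close>

lemma continuous_antiderivative:
  fixes f :: "real \<Rightarrow> real"
  assumes "continuous_on UNIV f"
  obtains F where "F 0 = 0" "\<And>x. (F has_real_derivative f x) (at x)"
proof -
  obtain F where F: "\<And>x. (F has_vector_derivative f x) (at x)"
    using einterval_antiderivative[of "-\<infinity>" "\<infinity>" f] assms
    by (auto simp: continuous_on_eq_continuous_at)
  show thesis
    by (rule that[of "\<lambda>x. F x - F 0"])
      (auto intro!: derivative_eq_intros F simp: has_real_derivative_iff_has_vector_derivative)
qed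

lemma antiderivative_exp_upper:
  fixes F :: "real \<Rightarrow> real"
  assumes F: "F 0 \<le> 0" "\<And>t. 0 \<le> t \<Longrightarrow> (F has_real_derivative f t) (at t)"
    and f: "\<And>t. 0 \<le> t \<Longrightarrow> f t \<le> A * exp (\<kappa> * t)" and "\<kappa> > 0" "A \<ge> 0" "x \<ge> 0"
  shows "F x \<le> A / \<kappa> * exp (\<kappa> * x)"
proof -
  have "A / \<kappa> * exp (\<kappa> * 0) - F 0 \<le> A / \<kappa> * exp (\<kappa> * x) - F x"
  proof (rule DERIV_nonneg_imp_nondecreasing[OF \<open>x \<ge> 0\<close>])
    fix t assume "0 \<le> t" "t \<le> x"
    then show "\<exists>y. ((\<lambda>x. A / \<kappa> * exp (\<kappa> * x) - F x) has_real_derivative y) (at t) \<and> 0 \<le> y"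
      using f[of t] \<open>\<kappa> > 0\<close>
      by (intro exI[of _ "A * exp (\<kappa> * t) - f t"]) (auto intro!: derivative_eq_intros F)
  qed
  moreover have "A / \<kappa> \<ge> 0" using assms by simp
  ultimately show ?thesis using F by simp
qed

text \<open>Each integration gains a factor \<open>1 / \<kappa>\<close> in the norm weighted by exp
  (- \<kappa> |x|); this gain is what makes the Picard iteration contract. Negative arguments are
  reduced to positive ones by reflection.\<close>

lemma antiderivative_exp_bound:
  fixes F :: "real \<Rightarrow> real"
  assumes F: "F 0 = 0" "\<And>t. (F has_real_derivative f t) (at t)"
    and f: "\<And>t. \<bar>f t\<bar> \<le> A * exp (\<kappa> * \<bar>t\<bar>)" and "\<kappa> > 0"
  shows "\<bar>F x\<bar> \<le> A / \<kappa> * exp (\<kappa> * \<bar>x\<bar>)"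
proof -
  have A: "A \<ge> 0" using f[of 0] by simp
  have le: "f t \<le> A * exp (\<kappa> * \<bar>t\<bar>)" "- f t \<le> A * exp (\<kappa> * \<bar>t\<bar>)" for t
    using f[of t] by linarith+
  have der: "((\<lambda>x. F (- x)) has_real_derivative - f (- t)) (at t)" for t
    using DERIV_chain[OF F(2), of uminus "-1" t] by (simp add: DERIV_minus o_def)
  show ?thesis
  proof (cases "x \<ge> 0")
    case True
    have "F x \<le> A / \<kappa> * exp (\<kappa> * x)"
      by (rule antiderivative_exp_upper[of F f]) (use F le(1) A \<open>\<kappa> > 0\<close> True in \<open>auto simp: \<open>F 0 = 0\<close>\<close>, metis abs_of_nonneg le(1))
    moreover have "- F x \<le> A / \<kappa> * exp (\<kappa> * x)"
      by (rule antiderivative_exp_upper[of "\<lambda>x. - F x" "\<lambda>x. - f x"])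
        (use F le(2) A \<open>\<kappa> > 0\<close> True in \<open>auto intro!: derivative_eq_intros\<close>, metis abs_of_nonneg le(2))
    ultimately show ?thesis using True by (simp add: abs_le_iff)
  next
    case False
    have "F (- (- x)) \<le> A / \<kappa> * exp (\<kappa> * (- x))"
      by (rule antiderivative_exp_upper[of "\<lambda>x. F (- x)" "\<lambda>t. - f (- t)"])
        (use F der le(2)[of "- _"] A \<open>\<kappa> > 0\<close> False in \<open>auto\<close>, metis abs_of_nonneg abs_minus_cancel le(2))
    moreover have "- F (- (- x)) \<le> A / \<kappa> * exp (\<kappa> * (- x))"
      by (rule antiderivative_exp_upper[of "\<lambda>x. - F (- x)" "\<lambda>t. f (- t)"])
        (use F der[THEN DERIV_minus] A \<open>\<kappa> > 0\<close> False in \<open>auto\<close>, metis abs_of_nonneg abs_minus_cancel le(1))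
    ultimately show ?thesis using False by (simp add: abs_le_iff)
  qed
qed

text \<open>Picard iteration is a contraction for the norm \<open>sup \<bar>u x\<bar> exp (- \<kappa> \<bar>x\<bar>)\<close> once \<open>\<kappa>\<close> is large.\<close>

lemma linear_ode_exists:
  fixes q :: "real \<Rightarrow> real"
  assumes q: "continuous_on UNIV q" and M: "\<And>x. \<bar>q x\<bar> \<le> M"
  obtains v v' where "v 0 = 1" "v' 0 = 0" "\<And>x. (v has_real_derivative v' x) (at x)"
    "\<And>x. (v' has_real_derivative q x * v x) (at x)"
proof -
  \<comment> \<open>An antiderivative chosen on the whole line treats both signs of x at
    once.\<close>
  define J where "J f = (SOME F. F 0 = 0 \<and> (\<forall>x. (F has_real_derivative f x) (at x)))"
    for f :: "real \<Rightarrow> real"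
  have "\<exists>F. F 0 = 0 \<and> (\<forall>x. (F has_real_derivative f x) (at x))"
    if "continuous_on UNIV f" for f :: "real \<Rightarrow> real"
    using continuous_antiderivative[OF that] by metis
  from someI_ex[OF this] have J: "J f 0 = 0 \<and> (\<forall>x. (J f has_real_derivative f x) (at x))"
    if "continuous_on UNIV f" for f :: "real \<Rightarrow> real"
    unfolding J_def using that by blast
  then have J0: "J f 0 = 0" and JD: "\<And>x. (J f has_real_derivative f x) (at x)"
    if "continuous_on UNIV f" for f :: "real \<Rightarrow> real"
    using that by auto
  have Jc: "continuous_on UNIV (J f)" if "continuous_on UNIV f" for f :: "real \<Rightarrow> real"
    using JD[OF that] by (meson DERIV_continuous_on has_field_derivative_at_within)
  define T where "T u = J (J (\<lambda>x. q x * u x))" for u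
  \<comment> \<open>Two integrations give the contraction factor M / \<kappa>^2, at most 1/2 because
    2 M \<le> (M + 1)^2.\<close>
  define \<kappa> where "\<kappa> = M + 1"
  have M0: "M \<ge> 0" using M[of 0] by linarith
  then have \<kappa>: "\<kappa> > 0" by (simp add: \<kappa>_def)
  have qc: "continuous_on UNIV (\<lambda>x. q x * u x)" if "continuous_on UNIV u" for u
    using q that by (intro continuous_intros)
  have Tc: "continuous_on UNIV (T u)" if "continuous_on UNIV u" for u
    unfolding T_def by (intro Jc qc that)
  have Tdiff: "\<bar>T u x - T w x\<bar> \<le> A / 2 * exp (\<kappa> * \<bar>x\<bar>)"
    if u: "continuous_on UNIV u" and w: "continuous_on UNIV w"
      and A: "\<And>x. \<bar>u x - w x\<bar> \<le> A * exp (\<kappa> * \<bar>x\<bar>)" for u w A x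
  proof -
    have 0: "A \<ge> 0" using A[of 0] by simp
    have "\<bar>q x * u x - q x * w x\<bar> \<le> (M * A) * exp (\<kappa> * \<bar>x\<bar>)" for x
    proof -
      have "\<bar>q x * u x - q x * w x\<bar> = \<bar>q x\<bar> * \<bar>u x - w x\<bar>"
        by (simp add: abs_mult[symmetric] right_diff_distrib)
      also have "\<dots> \<le> M * (A * exp (\<kappa> * \<bar>x\<bar>))"
        by (intro mult_mono M A M0) auto
      finally show ?thesis by simp
    qed
    then have J1: "\<bar>J (\<lambda>x. q x * u x) x - J (\<lambda>x. q x * w x) x\<bar> \<le> (M * A / \<kappa>) * exp (\<kappa> * \<bar>x\<bar>)" for x
      by (rule antiderivative_exp_bound[where f = "\<lambda>x. q x * u x - q x * w x", rotated 2, OF _ \<kappa>])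
        (auto intro!: derivative_intros JD qc u w simp: J0 qc u w)
    have "\<bar>T u x - T w x\<bar> \<le> (M * A / \<kappa> / \<kappa>) * exp (\<kappa> * \<bar>x\<bar>)"
      unfolding T_def
      by (rule antiderivative_exp_bound[where f = "\<lambda>x. J (\<lambda>x. q x * u x) x - J (\<lambda>x. q x * w x) x",
            rotated 2, OF J1 \<kappa>])
        (auto intro!: derivative_intros JD Jc qc u w simp: J0 Jc qc u w)
    also have "M * A / \<kappa> / \<kappa> \<le> A / 2"
    proof -
      have "2 * M \<le> \<kappa> * \<kappa>"
        using mult_nonneg_nonneg[OF M0 M0] by (simp add: \<kappa>_def algebra_simps)
      then have "M / \<kappa> / \<kappa> \<le> 1 / 2"
        using \<kappa> by (simp add: pos_divide_le_eq)
      from mult_left_mono[OF this 0] show ?thesis by (simp add: mult.commute)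
    qed
    finally show ?thesis by simp
  qed
  \<comment> \<open>Multiplication by the weight identifies the complete space of bounded continuous
    functions with the continuous functions of finite weighted norm. Banach's theorem is applied to
    \<open>P\<close>, the Picard map read in that space.\<close>
  define U where "U g x = exp (\<kappa> * \<bar>x\<bar>) * apply_bcontfun g x" for g :: "real \<Rightarrow>\<^sub>C real" and x
  have Uc: "continuous_on UNIV (U g)" for g
    unfolding U_def by (intro continuous_intros continuous_on_apply_bcontfun)
  have Udist: "\<bar>U g x - U h x\<bar> \<le> dist g h * exp (\<kappa> * \<bar>x\<bar>)" for g h x
  proof -
    have "\<bar>U g x - U h x\<bar> = exp (\<kappa> * \<bar>x\<bar>) * dist (apply_bcontfun g x) (apply_bcontfun h x)"
      by (simp add: U_def abs_mult dist_real_def flip: right_diff_distrib)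
    also have "\<dots> \<le> exp (\<kappa> * \<bar>x\<bar>) * dist g h"
      by (intro mult_left_mono dist_bounded) auto
    finally show ?thesis by (simp add: mult.commute)
  qed
  define P where "P g x = exp (- \<kappa> * \<bar>x\<bar>) * (1 + T (U g) x)" for g x
  have Pdist: "\<bar>P g x - P h x\<bar> \<le> 1 / 2 * dist g h" for g h x
  proof -
    have "\<bar>P g x - P h x\<bar> = exp (- \<kappa> * \<bar>x\<bar>) * \<bar>T (U g) x - T (U h) x\<bar>"
      by (simp add: P_def abs_mult flip: right_diff_distrib)
    also have "\<dots> \<le> exp (- \<kappa> * \<bar>x\<bar>) * (dist g h / 2 * exp (\<kappa> * \<bar>x\<bar>))"
      by (intro mult_left_mono Tdiff Uc Udist) auto
    also have "\<dots> = 1 / 2 * dist g h" by (simp add: exp_minus)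
    finally show ?thesis .
  qed
  have Pb: "P g \<in> bcontfun" for g
  proof (rule bcontfun_normI)
    show "continuous_on UNIV (P g)"
      unfolding P_def by (intro continuous_intros Tc Uc)
    fix x
    \<comment> \<open>\<open>P 0\<close> is explicit and bounded by 1, so the contraction estimate
      bounds every other \<open>P g\<close>.\<close>
    have "T (U 0) = (\<lambda>x. 0)"
    proof -
      have U0: "U 0 = (\<lambda>x. 0)" by (auto simp: U_def)
      have "\<bar>J (\<lambda>x. 0::real) x\<bar> \<le> 0 / \<kappa> * exp (\<kappa> * \<bar>x\<bar>)" for x
        by (rule antiderivative_exp_bound[where f = "\<lambda>x. 0"]) (auto intro!: JD \<kappa> simp: J0)
      then have "J (\<lambda>x. 0) = (\<lambda>x. 0)" by (intro ext) simp
      then show ?thesis unfolding T_def U0 by simp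
    qed
    then have "\<bar>P 0 x\<bar> \<le> 1" using \<kappa> by (simp add: P_def)
    then show "norm (P g x) \<le> 1 + 1 / 2 * dist g 0"
      using Pdist[of g x 0] unfolding real_norm_def by linarith
  qed
  define \<Phi> where "\<Phi> g = Bcontfun (P g)" for g
  have \<Phi>: "apply_bcontfun (\<Phi> g) = P g" for g
    unfolding \<Phi>_def using Pb by (rule Bcontfun_inverse)
  have "\<exists>!g. \<Phi> g = g"
  proof (rule banach_fix_type[where c = "1/2"])
    show "\<forall>x y. dist (\<Phi> x) (\<Phi> y) \<le> 1 / 2 * dist x y"
      by (intro allI dist_bound) (use Pdist in \<open>simp add: \<Phi> dist_real_def\<close>)
  qed auto
  then obtain g where g: "\<Phi> g = g" by blast
  define v where "v = U g"
  have vc: "continuous_on UNIV v" unfolding v_def by (rule Uc)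
  have v: "v x = 1 + T v x" for x
  proof -
    have "apply_bcontfun g x = P g x" using \<Phi>[of g] g by simp
    then have "v x = exp (\<kappa> * \<bar>x\<bar>) * P g x" by (simp add: v_def U_def)
    also have "\<dots> = 1 + T v x" unfolding P_def v_def by (simp add: exp_minus)
    finally show ?thesis .
  qed
  have vT: "v = (\<lambda>x. 1 + T v x)" using v by blast
  show thesis
  proof (rule that)
    show "v 0 = 1" using v[of 0] by (simp add: T_def J0 Jc qc vc)
    show "J (\<lambda>x. q x * v x) 0 = 0" by (simp add: J0 qc vc)
    show "(v has_real_derivative J (\<lambda>x. q x * v x) x) (at x)" for x
      by (subst vT, unfold T_def) (auto intro!: derivative_eq_intros JD Jc qc vc)
    show "(J (\<lambda>x. q x * v x) has_real_derivative q x * v x) (at x)" for x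
      by (intro JD qc vc)
  qed
qed

text \<open>The energy \<open>z\<^sup>2 + z'\<^sup>2\<close> of \<open>z = v - w\<close> satisfies a Gronwall inequality.\<close>

lemma linear_ode_perturbation:
  fixes v w :: "real \<Rightarrow> real"
  assumes v: "\<And>x. (v has_real_derivative v' x) (at x)" "\<And>x. (v' has_real_derivative q x * v x) (at x)"
    and w: "\<And>x. (w has_real_derivative w' x) (at x)" "\<And>x. (w' has_real_derivative r x * w x) (at x)"
    and init: "v 0 = w 0" "v' 0 = w' 0"
    and M: "\<And>x. 0 \<le> x \<Longrightarrow> x \<le> b \<Longrightarrow> \<bar>r x\<bar> \<le> M"
    and d: "\<And>x. 0 \<le> x \<Longrightarrow> x \<le> b \<Longrightarrow> \<bar>(q x - r x) * v x\<bar> \<le> d"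
    and x: "0 \<le> x" "x \<le> b"
  shows "(v x - w x)\<^sup>2 \<le> d\<^sup>2 * x * exp ((2 + M) * x)"
proof -
  define z where "z t = v t - w t" for t
  define z' where "z' t = v' t - w' t" for t
  define E where "E t = (z t)\<^sup>2 + (z' t)\<^sup>2" for t
  \<comment> \<open>One multiple of \<open>E\<close> pays for 2 z z', a second one together with d^2
    for z' times the forcing term (q - r) v, and \<open>M\<close> of them for z' times r z.\<close>
  define C where "C = 2 + M"
  define e where "e t = 2 * z t * z' t + 2 * z' t * (r t * z t + (q t - r t) * v t)" for t
  have z: "(z has_real_derivative z' t) (at t)" for t
    unfolding z_def z'_def by (intro derivative_intros v w)
  have z': "(z' has_real_derivative r t * z t + (q t - r t) * v t) (at t)" for t
    unfolding z'_def by (rule DERIV_cong[OF DERIV_diff[OF v(2) w(2)]]) (simp add: z_def algebra_simps)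
  have E: "(E has_real_derivative e t) (at t)" for t
    unfolding E_def e_def
    by (rule derivative_eq_intros z z' refl)+ (simp add: algebra_simps)
  have le: "e t \<le> C * E t + d\<^sup>2" if t: "0 \<le> t" "t \<le> b" for t
  proof -
    have M0: "M \<ge> 0" using M[OF t] by linarith
    have 1: "2 * z t * z' t \<le> E t" using sum_squares_bound[of "z t" "z' t"] by (simp add: E_def)
    have "2 * z' t * z t * r t \<le> \<bar>2 * z' t * z t\<bar> * \<bar>r t\<bar>" by (simp flip: abs_mult)
    also have "\<dots> \<le> E t * M"
      using sum_squares_bound[of "z t" "z' t"] sum_squares_bound[of "z t" "- z' t"]
      by (intro mult_mono M t) (auto simp: E_def abs_le_iff algebra_simps)
    finally have 2: "2 * z' t * z t * r t \<le> E t * M" .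
    have "((q t - r t) * v t)\<^sup>2 \<le> d\<^sup>2"
      using d[OF t] by (intro abs_le_square_iff[THEN iffD1]) auto
    then have 3: "2 * z' t * ((q t - r t) * v t) \<le> E t + d\<^sup>2"
      using sum_squares_bound[of "z' t" "(q t - r t) * v t"] zero_le_power2[of "z t"]
      unfolding E_def by linarith
    show ?thesis using 1 2 3 by (simp add: e_def C_def algebra_simps)
  qed
  \<comment> \<open>Because exp (- C t) \<le> 1, the linear term d^2 t already absorbs the
    forcing.\<close>
  have "(\<lambda>t. E t * exp (- C * t) - d\<^sup>2 * t) x \<le> (\<lambda>t. E t * exp (- C * t) - d\<^sup>2 * t) 0"
  proof (rule DERIV_nonpos_imp_nonincreasing[OF x(1)])
    fix t assume t: "0 \<le> t" "t \<le> x"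
    then have tb: "t \<le> b" using x by linarith
    have C0: "C \<ge> 0" using M[OF t(1) tb] by (simp add: C_def)
    have "((\<lambda>t. E t * exp (- C * t) - d\<^sup>2 * t) has_real_derivative
        (e t - C * E t) * exp (- C * t) - d\<^sup>2) (at t)"
      by (rule derivative_eq_intros E refl)+ (simp add: algebra_simps)
    moreover have "(e t - C * E t) * exp (- C * t) \<le> d\<^sup>2 * 1"
      using le[OF t(1) tb] C0 t by (intro mult_mono) (auto simp: algebra_simps)
    ultimately show "\<exists>y. ((\<lambda>t. E t * exp (- C * t) - d\<^sup>2 * t) has_real_derivative y) (at t) \<and> y \<le> 0"
      by (intro exI conjI) auto
  qed
  then have "E x * exp (- C * x) \<le> d\<^sup>2 * x" using init by (simp add: E_def z_def z'_def)
  then have "E x \<le> d\<^sup>2 * x * exp (C * x)" by (simp add: exp_minus field_simps)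
  then show ?thesis using zero_le_power2[of "z' x"] unfolding E_def C_def z_def by linarith
qed

text \<open>The perturbation estimate against the zero solution of the same equation, where the
  forcing d is 0.\<close>

lemma linear_ode_trivial:
  fixes w :: "real \<Rightarrow> real"
  assumes w: "\<And>x. (w has_real_derivative w' x) (at x)" "\<And>x. (w' has_real_derivative r x * w x) (at x)"
    and init: "w 0 = 0" "w' 0 = 0" and M: "\<And>x. \<bar>r x\<bar> \<le> M" and x: "0 \<le> x"
  shows "w x = 0"
proof -
  have "((\<lambda>x. 0) x - w x)\<^sup>2 \<le> 0\<^sup>2 * x * exp ((2 + M) * x)"
    by (rule linear_ode_perturbation[where v' = "\<lambda>_. 0" and q = r and b = x, OF _ _ w])
      (use init M x in auto)
  then show ?thesis by simp
qed

text \<open>The reflected function solves the same initial value problem, since \<open>q\<close> is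
  even and \<open>v' 0 = 0\<close>; uniqueness is applied to the difference. This carries what is
  proved on [0, 1] over to [-1, 1], in particular the zero at -1.\<close>

lemma linear_ode_even:
  fixes v :: "real \<Rightarrow> real"
  assumes v: "\<And>x. (v has_real_derivative v' x) (at x)" "\<And>x. (v' has_real_derivative q x * v x) (at x)"
    and v': "v' 0 = 0" and q: "\<And>x. q (- x) = q x" and M: "\<And>x. \<bar>q x\<bar> \<le> M"
  shows "v (- x) = v x"
proof -
  have dv: "((\<lambda>x. v (- x)) has_real_derivative - v' (- t)) (at t)" for t
    using DERIV_chain[OF v(1), of uminus "-1" t] by (simp add: DERIV_minus o_def)
  have dv': "((\<lambda>x. - v' (- x)) has_real_derivative q t * v (- t)) (at t)" for t
    using DERIV_minus[OF DERIV_chain[OF v(2), of uminus "-1" t]] by (simp add: DERIV_minus o_def q)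
  define w where "w x = v x - v (- x)" for x
  define w' where "w' x = v' x - - v' (- x)" for x
  have "w x = 0" if "x \<ge> 0" for x
  proof (rule linear_ode_trivial[of w w' q M x])
    show "(w has_real_derivative w' x) (at x)" for x
      unfolding w_def w'_def by (intro derivative_intros v dv)
    show "(w' has_real_derivative q x * w x) (at x)" for x
      unfolding w'_def
      by (rule DERIV_cong[OF DERIV_diff[OF v(2) dv']]) (simp add: w_def algebra_simps)
  qed (use M v' that in \<open>auto simp: w_def w'_def\<close>)
  from this[of "\<bar>x\<bar>"] show ?thesis by (cases "x \<ge> 0") (auto simp: w_def)
qed

text \<open>Uniqueness run backwards: x -> v (a - x) has zero initial data, so it vanishes at x = a.
  Read contrapositively, a solution with \<open>v 0 = 1\<close> cannot touch zero
  tangentially.\<close>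

lemma linear_ode_no_double_zero:
  fixes v :: "real \<Rightarrow> real"
  assumes v: "\<And>x. (v has_real_derivative v' x) (at x)" "\<And>x. (v' has_real_derivative q x * v x) (at x)"
    and x: "v a = 0" "v' a = 0" "a \<ge> 0" and M: "\<And>x. \<bar>q x\<bar> \<le> M"
  shows "v 0 = 0"
proof -
  have dv: "((\<lambda>x. v (a - x)) has_real_derivative - v' (a - t)) (at t)" for t
  proof -
    have "((\<lambda>x. a - x) has_real_derivative - 1) (at t)" by (auto intro!: derivative_eq_intros)
    from DERIV_chain[OF v(1) this] show ?thesis by (simp add: o_def)
  qed
  have dv': "((\<lambda>x. - v' (a - x)) has_real_derivative q (a - t) * v (a - t)) (at t)" for t
  proof -
    have "((\<lambda>x. a - x) has_real_derivative - 1) (at t)" by (auto intro!: derivative_eq_intros)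
    from DERIV_minus[OF DERIV_chain[OF v(2) this]] show ?thesis by (simp add: o_def)
  qed
  have "v (a - a) = 0"
    by (rule linear_ode_trivial[OF dv dv', of M]) (use x M in auto)
  then show ?thesis by simp
qed

section \<open>Bounds on the spectral parameter, existence and decay of the ground state\<close>

text \<open>Monotonicity of the Wronskian of the solution with \<open>cos\<close>.\<close>

lemma positive_solution_eigenvalue_upper:
  fixes v V :: "real \<Rightarrow> real"
  assumes v: "\<And>x. (v has_real_derivative v' x) (at x)"
      "\<And>x. (v' has_real_derivative (V x - l) * v x) (at x)"
    and v'0: "v' 0 = 0" and pos: "\<And>x. 0 \<le> x \<Longrightarrow> x < b \<Longrightarrow> 0 < v x"
    and b: "b > 0" and V: "\<And>x. 0 \<le> x \<Longrightarrow> x \<le> b \<Longrightarrow> V x \<le> m"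
  shows "l \<le> m + (pi / (2 * b))\<^sup>2"
proof (rule ccontr)
  assume "\<not> ?thesis"
  then have l: "l > m + (pi / (2 * b))\<^sup>2" by simp
  \<comment> \<open>cos (\<kappa> x) is the ground state of the second derivative on [0, b] with
    Neumann condition at 0 and Dirichlet condition at b, with energy \<kappa>^2.\<close>
  define \<kappa> where "\<kappa> = pi / (2 * b)"
  define W where "W x = v x * (- \<kappa> * sin (\<kappa> * x)) - v' x * cos (\<kappa> * x)" for x
  have W': "(W has_real_derivative v x * cos (\<kappa> * x) * (l - V x - \<kappa>\<^sup>2)) (at x)" for x
    unfolding W_def
    by (rule derivative_eq_intros v refl)+ (simp add: algebra_simps power2_eq_square)
  have "W 0 < W b"
  proof (rule DERIV_pos_imp_increasing_open[OF b, where f = W])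
    fix x assume x: "0 < x" "x < b"
    have "\<kappa> * x < pi / 2" using x b by (simp add: \<kappa>_def field_simps)
    moreover have "\<kappa> * x > 0" using x b by (simp add: \<kappa>_def)
    ultimately have "cos (\<kappa> * x) > 0" by (intro cos_gt_zero_pi) auto
    moreover have "l - V x - \<kappa>\<^sup>2 > 0" using V[of x] l x by (simp add: \<kappa>_def)
    ultimately show "\<exists>y. (W has_real_derivative y) (at x) \<and> 0 < y"
      using pos[of x] x by - (intro exI conjI, rule W', auto)
  next
    show "continuous_on {0..b} W"
      by (rule DERIV_continuous_on) (rule has_field_derivative_at_within[OF W'])
  qed
  moreover have "W 0 = 0" by (simp add: W_def v'0)
  moreover have "v b \<ge> 0"
  proof (rule tendsto_lowerbound)
    show "(v \<longlongrightarrow> v b) (at_left b)"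
      using DERIV_isCont[OF v(1)[of b]] by (simp add: isCont_def filterlim_at_split)
    show "\<forall>\<^sub>F x in at_left b. 0 \<le> v x"
      using eventually_at_left_real[OF b]
      by eventually_elim (use pos in \<open>auto intro: less_imp_le\<close>)
  qed auto
  \<comment> \<open>At b the cosine vanishes and \<open>W b\<close> reduces to - \<kappa> v(b) \<le>
    0, against W b > W 0 = 0.\<close>
  moreover have "\<kappa> > 0" "\<kappa> * b = pi / 2" using b by (auto simp: \<kappa>_def)
  ultimately show False by (simp add: W_def zero_less_mult_iff mult_less_0_iff)
qed

text \<open>Barta's method with the positive function \<open>exp (- A x\<^sup>2)\<close>.\<close>

lemma positive_solution_eigenvalue_lower:
  fixes v V :: "real \<Rightarrow> real"
  assumes v: "\<And>x. (v has_real_derivative v' x) (at x)"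
      "\<And>x. (v' has_real_derivative (V x - l) * v x) (at x)"
    and v'0: "v' 0 = 0" and pos: "\<And>x. 0 \<le> x \<Longrightarrow> x < 1 \<Longrightarrow> 0 < v x" and v1: "v 1 = 0"
    and V: "\<And>x. 0 \<le> x \<Longrightarrow> x \<le> 1 \<Longrightarrow> V x \<ge> 4 * A\<^sup>2 * x\<^sup>2 - 2 * A + m"
  shows "l \<ge> m"
proof (rule ccontr)
  assume l: "\<not> ?thesis"
  \<comment> \<open>For g = exp (- A x^2) the quotient g'' / g is 4 A^2 x^2 - 2 A, so the hypothesis
    on \<open>V\<close> says - g'' + V g \<ge> m g. If l < m, the Wronskian of v with g is strictly
    decreasing.\<close>
  define W where "W x = v x * (- 2 * A * x * exp (- A * x\<^sup>2)) - v' x * exp (- A * x\<^sup>2)" for x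
  have W': "(W has_real_derivative
      v x * exp (- A * x\<^sup>2) * (4 * A\<^sup>2 * x\<^sup>2 - 2 * A - V x + l)) (at x)" for x
    unfolding W_def
    by (rule derivative_eq_intros v refl)+ (simp add: algebra_simps power2_eq_square)
  have "W 1 < W 0"
  proof (rule DERIV_neg_imp_decreasing_open[where f = W])
    fix x :: real assume x: "0 < x" "x < 1"
    then have "4 * A\<^sup>2 * x\<^sup>2 - 2 * A - V x + l < 0" using V[of x] l by simp
    then show "\<exists>y. (W has_real_derivative y) (at x) \<and> y < 0"
      using pos[of x] x by - (intro exI conjI, rule W', auto simp: mult_less_0_iff)
  next
    show "continuous_on {0..1} W"
      by (rule DERIV_continuous_on) (rule has_field_derivative_at_within[OF W'])
  qed auto
  \<comment> \<open>W 0 = 0 and W 1 = - v'(1) exp (- A). A positive slope at the zero 1 contradicts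
    positivity just before it.\<close>
  then have "v' 1 > 0" by (simp add: W_def v'0 v1 zero_less_mult_iff)
  from DERIV_pos_inc_left[OF v(1) this] obtain d where
    d: "d > 0" "\<And>h. h > 0 \<Longrightarrow> h < d \<Longrightarrow> v (1 - h) < v 1" by blast
  define h where "h = min d 1 / 2"
  have h: "h > 0" "h < d" "h < 1" using d(1) by (auto simp: h_def)
  show False using d(2)[OF h(1,2)] pos[of "1 - h"] h v1 by simp
qed

text \<open>The derivative of v v' is v'^2 + V v^2 \<ge> 0, so v^2 never falls below its initial
  value 1 and v cannot cross zero. It makes the shooting set nonempty: it contains the parameter
  0.\<close>

lemma nonneg_potential_solution_pos:
  fixes v V :: "real \<Rightarrow> real"
  assumes v: "\<And>x. (v has_real_derivative v' x) (at x)"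
      "\<And>x. (v' has_real_derivative V x * v x) (at x)"
    and init: "v 0 = 1" "v' 0 = 0" and V: "\<And>x. V x \<ge> 0" and x: "x \<ge> 0"
  shows "v x > 0"
proof -
  have vv': "v t * v' t \<ge> 0" if "t \<ge> 0" for t
  proof -
    have "v 0 * v' 0 \<le> v t * v' t"
    proof (rule DERIV_nonneg_imp_nondecreasing[OF that])
      fix t
      have "((\<lambda>t. v t * v' t) has_real_derivative (v' t)\<^sup>2 + V t * (v t)\<^sup>2) (at t)"
        by (rule derivative_eq_intros v refl)+ (simp add: power2_eq_square)
      then show "\<exists>y. ((\<lambda>t. v t * v' t) has_real_derivative y) (at t) \<and> 0 \<le> y"
        using V[of t] by (intro exI[of _ "(v' t)\<^sup>2 + V t * (v t)\<^sup>2"]) auto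
    qed
    then show ?thesis by (simp add: init)
  qed
  have v1: "(v t)\<^sup>2 \<ge> 1" if "t \<ge> 0" for t
  proof -
    have "(v 0)\<^sup>2 \<le> (v t)\<^sup>2"
    proof (rule DERIV_nonneg_imp_nondecreasing[OF that])
      fix s assume "0 \<le> s" "s \<le> t"
      then show "\<exists>y. ((\<lambda>t. (v t)\<^sup>2) has_real_derivative y) (at s) \<and> 0 \<le> y"
        using vv'[of s] by (intro exI[of _ "2 * (v s * v' s)"]) (auto intro!: derivative_eq_intros v)
    qed
    then show ?thesis by (simp add: init)
  qed
  show ?thesis
  proof (rule ccontr)
    assume "\<not> ?thesis"
    then have "\<exists>t. 0 \<le> t \<and> t \<le> x \<and> v t = 0"
      using x init DERIV_isCont[OF v(1)] by (intro IVT2) auto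
    then show False using v1 by fastforce
  qed
qed

text \<open>The eigenvalue is the supremum of the spectral parameters whose solution has no zero.\<close>

lemma ground_state_exists:
  fixes V :: "real \<Rightarrow> real"
  assumes V: "continuous_on UNIV V" "\<And>x. 0 \<le> V x" "\<And>x. V x \<le> M" and even: "\<And>x. V (- x) = V x"
  obtains l v v' where "l \<ge> 0" "\<And>x. (v has_real_derivative v' x) (at x)"
    "\<And>x. (v' has_real_derivative (V x - l) * v x) (at x)" "v' 0 = 0" "\<And>x. v (- x) = v x"
    "\<And>x. \<bar>x\<bar> < 1 \<Longrightarrow> 0 < v x" "v 1 = 0"
proof -
  have M0: "M \<ge> 0" using V(2,3)[of 0] by linarith
  have bd: "\<bar>V x - l\<bar> \<le> M + \<bar>l\<bar>" for x l using V(2,3)[of x] by linarith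
  have "\<exists>v v'. v 0 = 1 \<and> v' 0 = 0 \<and> (\<forall>x. (v has_real_derivative v' x) (at x)) \<and>
      (\<forall>x. (v' has_real_derivative (V x - l) * v x) (at x))" for l
  proof -
    have "continuous_on UNIV (\<lambda>x. V x - l)" by (intro continuous_intros V)
    from linear_ode_exists[OF this bd] show ?thesis by metis
  qed
  then obtain v v' where init: "\<And>l. v l 0 = (1::real)" "\<And>l. v' l 0 = (0::real)"
    and v: "\<And>l x. (v l has_real_derivative v' l x) (at x)"
    and v': "\<And>l x. (v' l has_real_derivative (V x - l) * v l x) (at x)"
    by metis
  have cont: "continuous_on X (v l)" for l X
    by (rule DERIV_continuous_on) (rule has_field_derivative_at_within[OF v])
  define S where "S = {l. \<forall>x. 0 \<le> x \<longrightarrow> x \<le> 1 \<longrightarrow> 0 < v l x}"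
  have S0: "0 \<in> S"
    unfolding S_def using nonneg_potential_solution_pos[OF v[of 0], of V] v'[of 0] init V(2) by auto
  have Sle: "l \<le> M + (pi / (2 * 1))\<^sup>2" if "l \<in> S" for l
    by (rule positive_solution_eigenvalue_upper[OF v v'])
      (use that init V(3) in \<open>auto simp: S_def\<close>)
  have bdd: "bdd_above S" using Sle by (meson bdd_above.I)
  define l where "l = Sup S"
  have l0: "l \<ge> 0" unfolding l_def by (rule cSup_upper[OF S0 bdd])
  have "\<exists>B. \<forall>x\<in>{0..1}. \<bar>v l x\<bar> \<le> B"
  proof -
    have "bounded (v l ` {0..1})"
      by (intro compact_imp_bounded compact_continuous_image cont) auto
    then show ?thesis by (auto simp: bounded_iff)
  qed
  then obtain B where "\<forall>x\<in>{0..1}. \<bar>v l x\<bar> \<le> B" ..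
  then have B: "\<bar>v l x\<bar> \<le> B" if "0 \<le> x" "x \<le> 1" for x using that by simp
  have B0: "B \<ge> 0" using B[of 0] by simp
  define R where "R = M + \<bar>l\<bar> + 1"
  define G where "G = B * exp (2 + R)"
  have diff: "\<bar>v l x - v r x\<bar> \<le> \<bar>r - l\<bar> * G" if r: "\<bar>r - l\<bar> \<le> 1" and x: "0 \<le> x" "x \<le> 1" for r x
  proof -
    have "(v l x - v r x)\<^sup>2 \<le> (\<bar>r - l\<bar> * B)\<^sup>2 * x * exp ((2 + R) * x)"
    proof (rule linear_ode_perturbation[OF v v' v v', where b = 1])
      fix t :: real assume t: "0 \<le> t" "t \<le> 1"
      show "\<bar>V t - r\<bar> \<le> R" using bd[of t r] r by (simp add: R_def)
      have "\<bar>(V t - l - (V t - r)) * v l t\<bar> = \<bar>r - l\<bar> * \<bar>v l t\<bar>" by (simp add: abs_mult)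
      also have "\<dots> \<le> \<bar>r - l\<bar> * B" by (intro mult_left_mono B t) auto
      finally show "\<bar>(V t - l - (V t - r)) * v l t\<bar> \<le> \<bar>r - l\<bar> * B" .
    qed (use init x in auto)
    \<comment> \<open>The exponent is rounded up to a multiple of 2 so that the bound becomes the
      square of |r - l| \<open>G\<close>.\<close>
    also have "\<dots> \<le> (\<bar>r - l\<bar> * B)\<^sup>2 * 1 * exp ((2 + R) * 2)"
    proof -
      have "(2 + R) * x \<le> (2 + R) * 2" using x M0 by (intro mult_left_mono) (auto simp: R_def)
      then show ?thesis using x by (intro mult_mono) auto
    qed
    also have "\<dots> = (\<bar>r - l\<bar> * G)\<^sup>2"
      by (simp add: G_def power_mult_distrib flip: exp_double)
    finally show ?thesis using B0 by (simp add: G_def flip: abs_le_square_iff)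
  qed
  \<comment> \<open>Parameters in \<open>S\<close> come arbitrarily close to the supremum; Lipschitz
    dependence passes their positivity to \<open>l\<close> as nonnegativity.\<close>
  have nonneg: "v l x \<ge> 0" if x: "0 \<le> x" "x \<le> 1" for x
  proof (rule ccontr)
    assume neg: "\<not> v l x \<ge> 0"
    define e where "e = min 1 (- v l x / (G + 1))"
    have G0: "G \<ge> 0" using B0 by (simp add: G_def)
    have e: "e > 0" using neg G0 by (auto simp: e_def divide_neg_pos)
    obtain r where r: "r \<in> S" "r > l - e"
      using less_cSup_iff[of S "l - e"] S0 bdd e unfolding l_def by auto
    have "r \<le> l" unfolding l_def by (rule cSup_upper[OF r(1) bdd])
    then have "\<bar>r - l\<bar> < e" using r by simp
    then have "\<bar>v l x - v r x\<bar> \<le> \<bar>r - l\<bar> * G" by (intro diff x) (auto simp: e_def)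
    also have "\<dots> \<le> e * G" using \<open>\<bar>r - l\<bar> < e\<close> G0 by (intro mult_right_mono) auto
    also have "\<dots> \<le> (- v l x / (G + 1)) * G" using G0 by (intro mult_right_mono) (auto simp: e_def)
    also have "\<dots> \<le> - v l x" using neg G0 by (simp add: field_simps)
    finally have "v r x \<le> 0" by linarith
    moreover have "v r x > 0" using r(1) x by (simp add: S_def)
    ultimately show False by simp
  qed
  have pos: "v l x > 0" if x: "0 \<le> x" "x < 1" for x
  proof (rule ccontr)
    assume "\<not> ?thesis"
    then have vx: "v l x = 0" using nonneg[of x] x by simp
    have x0: "x > 0" using vx init(1)[of l] x by (cases "x = 0") auto
    \<comment> \<open>An interior zero of a nonnegative solution is a minimum, hence a double
      zero.\<close>
    have "v' l x = 0"
    proof (rule DERIV_local_min[OF v, of "min x (1 - x)"])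
      show "\<forall>y. \<bar>x - y\<bar> < min x (1 - x) \<longrightarrow> v l x \<le> v l y"
        using nonneg vx by (auto simp: abs_if split: if_splits)
    qed (use x0 x in auto)
    then show False
      using linear_ode_no_double_zero[OF v v' vx, of "M + \<bar>l\<bar>"] bd x init(1)[of l] by simp
  qed
  have v1: "v l 1 = 0"
  proof (rule ccontr)
    assume "v l 1 \<noteq> 0"
    then have posl: "v l x > 0" if "x \<in> {0..1}" for x
      using pos[of x] nonneg[of 1] that by (cases "x = 1") auto
    obtain x0 where x0: "x0 \<in> {0..1}" "\<And>x. x \<in> {0..1} \<Longrightarrow> v l x0 \<le> v l x"
      using continuous_attains_inf[OF _ _ cont[of "{0..1}" l]] by auto
    \<comment> \<open>Without a zero at 1 the solution has a positive minimum on [0, 1]. Raising the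
      parameter by \<open>e\<close> changes the solution by less than that minimum, which puts
      \<open>l + e\<close> into \<open>S\<close>, above its supremum.\<close>
    define e where "e = min 1 (v l x0 / (2 * (G + 1)))"
    have G0: "G \<ge> 0" using B0 by (simp add: G_def)
    have e: "e > 0" using posl[OF x0(1)] G0 by (auto simp: e_def)
    have "l + e \<in> S"
      unfolding S_def
    proof (intro CollectI allI impI)
      fix x :: real assume x: "0 \<le> x" "x \<le> 1"
      have "\<bar>v l x - v (l + e) x\<bar> \<le> \<bar>l + e - l\<bar> * G"
        using e by (intro diff x) (auto simp: e_def)
      also have "\<dots> \<le> (v l x0 / (2 * (G + 1))) * G"
        using G0 e by (intro mult_right_mono) (auto simp: e_def)
      also have "\<dots> = v l x0 * (G / (2 * (G + 1)))" by simp
      also have "\<dots> < v l x0 * 1"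
        using posl[OF x0(1)] G0 by (intro mult_strict_left_mono) auto
      also have "v l x0 * 1 \<le> v l x" using x0(2) x by simp
      finally show "0 < v (l + e) x" by linarith
    qed
    then have "l + e \<le> l" unfolding l_def by (rule cSup_upper[OF _ bdd])
    then show False using e by simp
  qed
  have ev: "v l (- x) = v l x" for x
    by (rule linear_ode_even[OF v v', of l "M + \<bar>l\<bar>"]) (use init even bd in auto)
  show thesis
  proof (rule that[OF l0 v v' init(2) ev _ v1])
    show "0 < v l x" if "\<bar>x\<bar> < 1" for x
      using pos[of "\<bar>x\<bar>"] that ev[of x] by (cases "x \<ge> 0") auto
  qed
qed

text \<open>On [a, 1] the solution is convex and ends at a zero, so v' \<le> 0. Multiplying v''
  \<ge> K^2 v by 2 v' shows that v'^2 - K^2 v^2 is nonincreasing; it is nonnegative at 1, whence v'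
  \<le> - K v throughout.\<close>

lemma solution_exponential_decay:
  fixes v V :: "real \<Rightarrow> real"
  assumes v: "\<And>x. (v has_real_derivative v' x) (at x)"
      "\<And>x. (v' has_real_derivative (V x - l) * v x) (at x)"
    and pos: "\<And>x. a \<le> x \<Longrightarrow> x \<le> 1 \<Longrightarrow> 0 \<le> v x" and v1: "v 1 = 0"
    and K: "K \<ge> 0" "\<And>x. a \<le> x \<Longrightarrow> x \<le> 1 \<Longrightarrow> V x - l \<ge> K\<^sup>2"
    and a: "a < 1" and xy: "a \<le> x" "x \<le> y" "y \<le> 1"
  shows "v y \<le> v x * exp (- K * (y - x))"
proof -
  have conv: "(V t - l) * v t \<ge> K\<^sup>2 * v t" if "a \<le> t" "t \<le> 1" for t
    using K(2)[OF that] pos[OF that] by (intro mult_right_mono) auto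
  have v'1: "v' 1 \<le> 0"
  proof (rule ccontr)
    assume "\<not> ?thesis"
    then have "v' 1 > 0" by simp
    from DERIV_pos_inc_left[OF v(1) this] obtain d where
      d: "d > 0" "\<And>h. h > 0 \<Longrightarrow> h < d \<Longrightarrow> v (1 - h) < v 1" by blast
    define h where "h = min d (1 - a) / 2"
    have h: "h > 0" "h < d" "h < 1 - a" using d(1) a by (auto simp: h_def)
    show False using d(2)[OF h(1,2)] pos[of "1 - h"] h v1 by simp
  qed
  have v'le: "v' t \<le> 0" if t: "a \<le> t" "t \<le> 1" for t
  proof -
    have "v' t \<le> v' 1"
    proof (rule DERIV_nonneg_imp_nondecreasing[OF t(2)])
      fix s assume s: "t \<le> s" "s \<le> 1"
      have "0 \<le> K\<^sup>2 * v s" using pos[of s] s t by simp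
      then have "0 \<le> (V s - l) * v s" using conv[of s] s t by linarith
      then show "\<exists>y. (v' has_real_derivative y) (at s) \<and> 0 \<le> y" using v(2) by blast
    qed
    then show ?thesis using v'1 by simp
  qed
  have v'K: "v' t \<le> - K * v t" if t: "a \<le> t" "t \<le> 1" for t
  proof -
    have "(v' t)\<^sup>2 - K\<^sup>2 * (v t)\<^sup>2 \<ge> (v' 1)\<^sup>2 - K\<^sup>2 * (v 1)\<^sup>2"
    proof (rule DERIV_nonpos_imp_nonincreasing[OF t(2)])
      fix s assume s: "t \<le> s" "s \<le> 1"
      have "((\<lambda>t. (v' t)\<^sup>2 - K\<^sup>2 * (v t)\<^sup>2) has_real_derivative
          2 * v' s * ((V s - l) * v s - K\<^sup>2 * v s)) (at s)"
        by (rule derivative_eq_intros v refl)+ (simp add: algebra_simps)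
      moreover have "2 * v' s * ((V s - l) * v s - K\<^sup>2 * v s) \<le> 0"
        using v'le[of s] conv[of s] s t by - (rule mult_nonpos_nonneg, simp_all)
      ultimately show "\<exists>y. ((\<lambda>t. (v' t)\<^sup>2 - K\<^sup>2 * (v t)\<^sup>2) has_real_derivative y) (at s) \<and> y \<le> 0"
        by blast
    qed
    then have "(K * v t)\<^sup>2 \<le> (- v' t)\<^sup>2" 
      using zero_le_power2[of "v' 1"] unfolding v1 power_mult_distrib power2_minus
      by (simp only: zero_power2 mult_zero_right diff_0_right)
    then have "K * v t \<le> - v' t" by (rule power2_le_imp_le) (use v'le[OF t] in simp)
    then show ?thesis by simp
  qed
  have "v x * exp (K * x) \<ge> v y * exp (K * y)"
  proof (rule DERIV_nonpos_imp_nonincreasing[OF xy(2)])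
    fix s assume s: "x \<le> s" "s \<le> y"
    have "((\<lambda>t. v t * exp (K * t)) has_real_derivative (v' s + K * v s) * exp (K * s)) (at s)"
      by (rule derivative_eq_intros v refl)+ (simp add: algebra_simps)
    moreover have "(v' s + K * v s) * exp (K * s) \<le> 0"
      using v'K[of s] s xy by (intro mult_nonpos_nonneg) auto
    ultimately show "\<exists>y. ((\<lambda>t. v t * exp (K * t)) has_real_derivative y) (at s) \<and> y \<le> 0" by blast
  qed
  then show ?thesis by (simp add: right_diff_distrib exp_diff exp_minus field_simps)
qed

section \<open>The one-dimensional ground state\<close>

text \<open>Cutting the potential off outside \<open>[-1,1]\<close> makes it bounded on \<open>\<real>\<close>.\<close>

definition ground_state ::
  "real \<Rightarrow> real \<Rightarrow> real \<Rightarrow> (real \<Rightarrow> real) \<Rightarrow> (real \<Rightarrow> real) \<Rightarrow> bool"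
  where "ground_state \<gamma> \<mu> l v v' \<longleftrightarrow>
    (\<forall>x. (v has_real_derivative v' x) (at x)) \<and>
    (\<forall>x. (v' has_real_derivative (\<mu>\<^sup>2 * min 1 \<bar>x\<bar> powr (2 * \<gamma>) - l) * v x) (at x)) \<and>
    v' 0 = 0 \<and> (\<forall>x. v (- x) = v x) \<and> (\<forall>x. \<bar>x\<bar> < 1 \<longrightarrow> 0 < v x) \<and> v 1 = 0"

lemma powr_double_square: "x powr (2 * \<gamma>) = (x powr \<gamma>)\<^sup>2" for x \<gamma> :: real
  by (simp add: power2_eq_square flip: powr_add)

lemma ground_state_upper:
  fixes \<gamma> \<mu> :: real
  assumes "\<gamma> > 0" and mu: "\<mu> \<ge> 1"
  obtains l v v' where "ground_state \<gamma> \<mu> l v v'" "0 \<le> l"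
    "l \<le> (1 + (pi / 2)\<^sup>2) * \<mu> powr (2 / (\<gamma> + 1))"
proof -
  define V where "V x = \<mu>\<^sup>2 * min 1 \<bar>x\<bar> powr (2 * \<gamma>)" for x :: real
  have "continuous_on UNIV V"
    unfolding V_def using \<open>\<gamma> > 0\<close> by (intro continuous_intros continuous_on_powr') auto
  moreover have "V x \<ge> 0" for x by (simp add: V_def)
  moreover have "V x \<le> \<mu>\<^sup>2" for x
    using powr_mono2[of "2 * \<gamma>" "min 1 \<bar>x\<bar>" 1] \<open>\<gamma> > 0\<close>
    by (auto simp: V_def intro: mult_left_le)
  moreover have "V (- x) = V x" for x by (simp add: V_def)
  ultimately obtain l v v' where l: "l \<ge> 0" and v: "\<And>x. (v has_real_derivative v' x) (at x)"
    "\<And>x. (v' has_real_derivative (V x - l) * v x) (at x)" and v': "v' 0 = 0"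
    and ev: "\<And>x. v (- x) = v x" and pos: "\<And>x. \<bar>x\<bar> < 1 \<Longrightarrow> 0 < v x" and v1: "v 1 = 0"
    using ground_state_exists[of V "\<mu>\<^sup>2"] by metis
  \<comment> \<open>The width at which \<mu>^2 b^(2 \<gamma>) and b^-2 agree, both being \<mu>^(2 /
    (\<gamma> + 1)); any other power of \<mu> worsens the exponent.\<close>
  define b where "b = \<mu> powr (- 1 / (\<gamma> + 1))"
  have b0: "b > 0" using mu by (simp add: b_def)
  have "b \<le> \<mu> powr 0"
    unfolding b_def using mu \<open>\<gamma> > 0\<close> by (intro powr_mono) auto
  then have b1: "b \<le> 1" using mu by simp
  have V_eq: "\<mu>\<^sup>2 * b powr (2 * \<gamma>) = \<mu> powr (2 / (\<gamma> + 1))"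
  proof -
    have "\<mu>\<^sup>2 = \<mu> powr 2" using mu by simp
    then have "\<mu>\<^sup>2 * b powr (2 * \<gamma>) = \<mu> powr (2 + (- 1 / (\<gamma> + 1)) * (2 * \<gamma>))"
      by (simp only: b_def powr_powr powr_add)
    also have "2 + (- 1 / (\<gamma> + 1)) * (2 * \<gamma>) = 2 / (\<gamma> + 1)"
      using \<open>\<gamma> > 0\<close> by (simp add: field_simps)
    finally show ?thesis .
  qed
  have b_eq: "(pi / (2 * b))\<^sup>2 = (pi / 2)\<^sup>2 * \<mu> powr (2 / (\<gamma> + 1))"
  proof -
    have "(pi / (2 * b))\<^sup>2 = (pi / 2)\<^sup>2 * (1 / b)\<^sup>2" by (simp add: power_divide power_mult_distrib)
    also have "1 / b = \<mu> powr (1 / (\<gamma> + 1))" using mu by (simp add: b_def powr_minus_divide)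
    also have "(\<mu> powr (1 / (\<gamma> + 1)))\<^sup>2 = \<mu> powr (2 / (\<gamma> + 1))"
      using powr_double_square[of \<mu> "1 / (\<gamma> + 1)"] by simp
    finally show ?thesis .
  qed
  have "l \<le> \<mu> powr (2 / (\<gamma> + 1)) + (pi / (2 * b))\<^sup>2"
  proof (rule positive_solution_eigenvalue_upper[OF v v' _ b0])
    show "V x \<le> \<mu> powr (2 / (\<gamma> + 1))" if "0 \<le> x" "x \<le> b" for x
      unfolding V_eq[symmetric] V_def using that b1 \<open>\<gamma> > 0\<close>
      by (intro mult_left_mono powr_mono2) auto
  qed (use pos b1 in auto)
  then have "l \<le> (1 + (pi / 2)\<^sup>2) * \<mu> powr (2 / (\<gamma> + 1))"
    unfolding b_eq by (simp add: algebra_simps)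
  moreover have "ground_state \<gamma> \<mu> l v v'"
    unfolding ground_state_def using v v' ev pos v1 by (auto simp: V_def)
  ultimately show thesis using that l by blast
qed

text \<open>Barta's bound with m = A asks for V \<ge> 4 A^2 x^2 - A. The right-hand side is at most
  0 up to x0 = 1 / (2 sqrt A), and beyond x0 it is below 4 A^2, which the potential exceeds once
  \<mu> x0^\<gamma> \<ge> 2 A.\<close>

lemma ground_state_lower:
  fixes \<gamma> A :: real
  assumes "\<gamma> > 0" "A > 0"
  obtains \<mu>0 where "\<And>\<mu> l v v'. \<mu> \<ge> \<mu>0 \<Longrightarrow> ground_state \<gamma> \<mu> l v v' \<Longrightarrow> A \<le> l"
proof
  define x0 where "x0 = 1 / (2 * sqrt A)"
  have x0: "x0 > 0" "x0\<^sup>2 = 1 / (4 * A)"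
    using \<open>A > 0\<close> by (auto simp: x0_def power_divide power_mult_distrib)
  fix \<mu> l v v' assume mu: "\<mu> \<ge> 2 * A / x0 powr \<gamma>" and g: "ground_state \<gamma> \<mu> l v v'"
  show "A \<le> l"
  proof (rule positive_solution_eigenvalue_lower[where v = v and v' = v' and A = A
        and V = "\<lambda>x. \<mu>\<^sup>2 * min 1 \<bar>x\<bar> powr (2 * \<gamma>)"])
    fix x :: real assume x: "0 \<le> x" "x \<le> 1"
    show "4 * A\<^sup>2 * x\<^sup>2 - 2 * A + A \<le> \<mu>\<^sup>2 * min 1 \<bar>x\<bar> powr (2 * \<gamma>)"
    proof (cases "x \<le> x0")
      case True
      then have "x\<^sup>2 \<le> 1 / (4 * A)" using x0 x power_mono[of x x0 2] by simp
      then have "4 * A\<^sup>2 * x\<^sup>2 \<le> A" using \<open>A > 0\<close> by (simp add: field_simps power2_eq_square)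
      then have "4 * A\<^sup>2 * x\<^sup>2 - 2 * A + A \<le> 0" by simp
      also have "0 \<le> \<mu>\<^sup>2 * min 1 \<bar>x\<bar> powr (2 * \<gamma>)" by simp
      finally show ?thesis .
    next
      case False
      have "4 * A\<^sup>2 * x\<^sup>2 \<le> 4 * A\<^sup>2 * 1" using x by (intro mult_left_mono) (auto simp: power_le_one)
      also have "\<dots> = (2 * A)\<^sup>2" by (simp add: power_mult_distrib)
      also have "\<dots> \<le> (\<mu> * x0 powr \<gamma>)\<^sup>2"
        using mu x0 \<open>A > 0\<close> by (intro power_mono) (auto simp: field_simps)
      also have "\<dots> = \<mu>\<^sup>2 * x0 powr (2 * \<gamma>)" by (simp add: power_mult_distrib powr_double_square)
      also have "\<dots> \<le> \<mu>\<^sup>2 * min 1 \<bar>x\<bar> powr (2 * \<gamma>)"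
        using False x x0 \<open>\<gamma> > 0\<close> by (intro mult_left_mono powr_mono2) auto
      finally show ?thesis using \<open>A > 0\<close> by simp
    qed
  qed (use g in \<open>auto simp: ground_state_def\<close>)
qed

lemma ground_state_decay:
  fixes \<gamma> \<delta> :: real
  assumes "\<gamma> > 0" and \<delta>: "0 < \<delta>" "\<delta> \<le> 1"
  obtains C c \<mu>0 where "C > 0" "c > 0"
    "\<And>\<mu>. \<mu> \<ge> \<mu>0 \<Longrightarrow> \<exists>l v v'. ground_state \<gamma> \<mu> l v v' \<and> 0 \<le> l \<and>
      (\<forall>x. \<delta> \<le> \<bar>x\<bar> \<and> \<bar>x\<bar> \<le> 1 \<longrightarrow>
        (v x)\<^sup>2 \<le> C * exp (- 2 * c * l powr ((\<gamma> + 1) / 2)) * integral {-1..1} (\<lambda>x. (v x)\<^sup>2))"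
proof -
  \<comment> \<open>The mass of v on [a, 2a] controls v(2a), and from 2a to \<delta> = 4a there
    remains a length 2a over which v decays.\<close>
  define a where "a = \<delta> / 4"
  have a: "0 < a" "4 * a \<le> 1" using \<delta> by (auto simp: a_def)
  define C0 where "C0 = 1 + (pi / 2)\<^sup>2"
  have C0: "C0 > 0" by (simp add: C0_def add_pos_nonneg)
  define e where "e = 2 * \<gamma> / (\<gamma> + 1)"
  have e: "e > 0" using \<open>\<gamma> > 0\<close> by (simp add: e_def)
  \<comment> \<open>\<mu>^e \<ge> D, where e = 2 - 2 / (\<gamma> + 1), is the condition that the
    upper bound for l is at most 3/4 of the potential at \<open>a\<close>.\<close>
  define D where "D = 4 * C0 / (3 * a powr (2 * \<gamma>))"
  have D: "D > 0" using a C0 by (simp add: D_def)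
  \<comment> \<open>The decay exponent over the length 2a will be 2 a K = a^(\<gamma> + 1) \<mu>,
    while l^((\<gamma> + 1) / 2) \<le> C0^((\<gamma> + 1) / 2) \<mu>; \<open>c\<close> is the
    quotient of the two coefficients.\<close>
  define c where "c = a powr (\<gamma> + 1) / C0 powr ((\<gamma> + 1) / 2)"
  have c: "c > 0" using a C0 by (simp add: c_def)
  show thesis
  proof (rule that[of "1 / a" c "max 1 (D powr (1 / e))"])
    fix \<mu> assume "\<mu> \<ge> max 1 (D powr (1 / e))"
    then have mu: "\<mu> \<ge> 1" "\<mu> \<ge> D powr (1 / e)" by auto
    obtain l v v' where g: "ground_state \<gamma> \<mu> l v v'" and l: "0 \<le> l"
      "l \<le> C0 * \<mu> powr (2 / (\<gamma> + 1))"
      using ground_state_upper[OF \<open>\<gamma> > 0\<close> mu(1)] unfolding C0_def by blast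
    \<comment> \<open>K^2 is the quarter of the potential at \<open>a\<close> that is left after
      subtracting l.\<close>
    define K where "K = \<mu> * a powr \<gamma> / 2"
    have K0: "K \<ge> 0" using mu by (simp add: K_def)
    have "D = (D powr (1 / e)) powr e" using D e by (simp add: powr_powr)
    also have "\<dots> \<le> \<mu> powr e" using mu D e by (intro powr_mono2) auto
    finally have De: "D \<le> \<mu> powr e" .
    have l2: "l \<le> 3 / 4 * (\<mu>\<^sup>2 * a powr (2 * \<gamma>))"
    proof -
      have "C0 = 3 / 4 * (D * a powr (2 * \<gamma>))" using a by (simp add: D_def)
      also have "\<dots> \<le> 3 / 4 * (\<mu> powr e * a powr (2 * \<gamma>))"
        using De by (intro mult_left_mono mult_right_mono) auto
      finally have "C0 * \<mu> powr (2 / (\<gamma> + 1))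
          \<le> 3 / 4 * (\<mu> powr e * a powr (2 * \<gamma>)) * \<mu> powr (2 / (\<gamma> + 1))"
        by (rule mult_right_mono) simp
      also have "\<dots> = 3 / 4 * (\<mu> powr (e + 2 / (\<gamma> + 1)) * a powr (2 * \<gamma>))"
        by (simp add: powr_add)
      also have "e + 2 / (\<gamma> + 1) = 2" 
        using \<open>\<gamma> > 0\<close> unfolding e_def add_divide_distrib[symmetric] by (simp add: field_simps)
      also have "\<mu> powr 2 = \<mu>\<^sup>2" using mu by simp
      finally show ?thesis using l by linarith
    qed
    have v: "\<And>x. (v has_real_derivative v' x) (at x)"
      "\<And>x. (v' has_real_derivative (\<mu>\<^sup>2 * min 1 \<bar>x\<bar> powr (2 * \<gamma>) - l) * v x) (at x)"
      and ev: "\<And>x. v (- x) = v x" and pos: "\<And>x. \<bar>x\<bar> < 1 \<Longrightarrow> 0 < v x" and v1: "v 1 = 0"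
      using g by (auto simp: ground_state_def)
    have nonneg: "v x \<ge> 0" if "a \<le> x" "x \<le> 1" for x
      using pos[of x] v1 that a by (cases "x = 1") (auto intro: less_imp_le)
    have VK: "\<mu>\<^sup>2 * min 1 \<bar>x\<bar> powr (2 * \<gamma>) - l \<ge> K\<^sup>2" if "a \<le> x" "x \<le> 1" for x
    proof -
      have "\<mu>\<^sup>2 * a powr (2 * \<gamma>) \<le> \<mu>\<^sup>2 * min 1 \<bar>x\<bar> powr (2 * \<gamma>)"
        using that a \<open>\<gamma> > 0\<close> by (intro mult_left_mono powr_mono2) auto
      moreover have "K\<^sup>2 = 1 / 4 * (\<mu>\<^sup>2 * a powr (2 * \<gamma>))"
        by (simp add: K_def power_divide power_mult_distrib powr_double_square)
      ultimately show ?thesis using l2 by linarith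
    qed
    have decay: "v y \<le> v x * exp (- K * (y - x))" if "a \<le> x" "x \<le> y" "y \<le> 1" for x y
      by (rule solution_exponential_decay[OF v nonneg v1 K0 VK _ that]) (use a in auto)
    have contv: "continuous_on X v" for X
      by (rule DERIV_continuous_on) (rule has_field_derivative_at_within[OF v(1)])
    have int: "(\<lambda>x. (v x)\<^sup>2) integrable_on {s..t}" for s t
      by (intro integrable_continuous_real continuous_intros contv)
    define I where "I = integral {-1..1} (\<lambda>x. (v x)\<^sup>2)"
    \<comment> \<open>v decreases on [a, 2a], so its value at 2a is below its mean square
      there.\<close>
    have va: "(v (2 * a))\<^sup>2 \<le> 1 / a * I"
    proof -
      have "a * (v (2 * a))\<^sup>2 = integral {a..2*a} (\<lambda>x. (v (2 * a))\<^sup>2)"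
        using a by simp
      also have "\<dots> \<le> integral {a..2*a} (\<lambda>x. (v x)\<^sup>2)"
      proof (rule integral_le)
        fix x assume x: "x \<in> {a..2*a}"
        have "v (2 * a) \<le> v x * exp (- K * (2 * a - x))" using decay[of x "2 * a"] x a by simp
        also have "\<dots> \<le> v x * 1"
          using nonneg[of x] x a K0 by (intro mult_left_mono) auto
        finally show "(v (2 * a))\<^sup>2 \<le> (v x)\<^sup>2"
          using nonneg[of "2 * a"] a by (intro power_mono) auto
      qed (use int in auto)
      also have "\<dots> \<le> I"
        unfolding I_def using a by (intro integral_subset_le int) auto
      finally show ?thesis using a by (simp add: field_simps)
    qed
    have Kc: "c * l powr ((\<gamma> + 1) / 2) \<le> K * (2 * a)"
    proof -
      have "l powr ((\<gamma> + 1) / 2) \<le> (C0 * \<mu> powr (2 / (\<gamma> + 1))) powr ((\<gamma> + 1) / 2)"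
        using l \<open>\<gamma> > 0\<close> by (intro powr_mono2) auto
      also have "\<dots> = C0 powr ((\<gamma> + 1) / 2) * \<mu>"
      proof -
        have "2 / (\<gamma> + 1) * ((\<gamma> + 1) / 2) = 1" using \<open>\<gamma> > 0\<close> by simp
        then have "(\<mu> powr (2 / (\<gamma> + 1))) powr ((\<gamma> + 1) / 2) = \<mu>"
          using mu by (simp only: powr_powr powr_one)
        then show ?thesis using C0 by (simp only: powr_mult)
      qed
      finally have "c * l powr ((\<gamma> + 1) / 2) \<le> c * (C0 powr ((\<gamma> + 1) / 2) * \<mu>)"
        using c by (intro mult_left_mono) auto
      also have "\<dots> = a powr (\<gamma> + 1) * \<mu>" using C0 by (simp add: c_def)
      also have "\<dots> = K * (2 * a)" using a by (simp add: K_def powr_add)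
      finally show ?thesis .
    qed
    have bound: "(v x)\<^sup>2 \<le> 1 / a * exp (- 2 * c * l powr ((\<gamma> + 1) / 2)) * I"
      if x: "\<delta> \<le> \<bar>x\<bar>" "\<bar>x\<bar> \<le> 1" for x
    proof -
      have "v x = v \<bar>x\<bar>" using ev[of x] by (auto simp: abs_if)
      also have "\<dots> \<le> v (2 * a) * exp (- K * (\<bar>x\<bar> - 2 * a))"
        using x a by (intro decay) (auto simp: a_def)
      also have "\<dots> \<le> v (2 * a) * exp (- c * l powr ((\<gamma> + 1) / 2))"
      proof (intro mult_left_mono)
        have "K * (2 * a) \<le> K * (\<bar>x\<bar> - 2 * a)"
          using x K0 by (intro mult_left_mono) (auto simp: a_def)
        then show "exp (- K * (\<bar>x\<bar> - 2 * a)) \<le> exp (- c * l powr ((\<gamma> + 1) / 2))"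
          using Kc by simp
        show "0 \<le> v (2 * a)" using nonneg[of "2 * a"] a by simp
      qed
      finally have "v x \<le> v (2 * a) * exp (- c * l powr ((\<gamma> + 1) / 2))" .
      moreover have "v x \<ge> 0"
        using nonneg[of "\<bar>x\<bar>"] ev[of x] x by (cases "x \<ge> 0") (auto simp: a_def)
      ultimately have "(v x)\<^sup>2 \<le> (v (2 * a) * exp (- c * l powr ((\<gamma> + 1) / 2)))\<^sup>2"
        by (intro power_mono)
      also have "\<dots> = (v (2 * a))\<^sup>2 * exp (- 2 * c * l powr ((\<gamma> + 1) / 2))"
        by (simp add: power_mult_distrib flip: exp_double)
      also have "\<dots> \<le> (1 / a * I) * exp (- 2 * c * l powr ((\<gamma> + 1) / 2))"
        by (intro mult_right_mono va) auto
      finally show ?thesis by (simp add: mult_ac)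
    qed
    show "\<exists>l v v'. ground_state \<gamma> \<mu> l v v' \<and> 0 \<le> l \<and>
      (\<forall>x. \<delta> \<le> \<bar>x\<bar> \<and> \<bar>x\<bar> \<le> 1 \<longrightarrow>
        (v x)\<^sup>2 \<le> 1 / a * exp (- 2 * c * l powr ((\<gamma> + 1) / 2)) * integral {-1..1} (\<lambda>x. (v x)\<^sup>2))"
      using g l(1) bound unfolding I_def by blast
  qed (use a c in auto)
qed

section \<open>Approximation by smooth functions with compact support\<close>

text \<open>The polynomial factor makes the family closed under differentiation: with s = 1 / t the
  derivative of P(s) exp (- s) in t is s^2 (P - P')(s) exp (- s).\<close>

definition bump :: "real poly \<Rightarrow> real \<Rightarrow> real"
  where "bump P t = (if t > 0 then poly P (1 / t) * exp (- (1 / t)) else 0)"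

lemma poly_mult_exp_tendsto_0: "((\<lambda>s. poly Q s * exp (- s)) \<longlongrightarrow> (0::real)) at_top"
proof -
  have "((\<lambda>s. \<Sum>i\<le>degree Q. coeff Q i * (s ^ i / exp s)) \<longlongrightarrow> (\<Sum>i\<le>degree Q. coeff Q i * 0)) at_top"
    by (intro tendsto_intros tendsto_power_div_exp_0)
  then show ?thesis
    by (simp add: poly_altdef sum_distrib_right exp_minus divide_inverse mult.assoc)
qed

text \<open>Only t = 0 is delicate: from the right the difference quotient is s P(s) exp (- s) with
  s = 1 / h, a polynomial against an exponential.\<close>

lemma bump_has_derivative:
  "(bump P has_real_derivative bump ([:0, 0, 1:] * (P - pderiv P)) t) (at t)"
proof -
  consider "t > 0" | "t < 0" | "t = 0" by linarith
  then show ?thesis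
  proof cases
    case 1
    have "((\<lambda>t. poly P (1 / t) * exp (- (1 / t))) has_real_derivative
        bump ([:0, 0, 1:] * (P - pderiv P)) t) (at t)"
      using 1 by (auto intro!: derivative_eq_intros DERIV_chain2[OF poly_DERIV]
          simp: bump_def field_simps power2_eq_square)
    then show ?thesis
      by (rule has_field_derivative_transform_within_open[where S = "{0<..}"])
        (use 1 in \<open>auto simp: bump_def\<close>)
  next
    case 2
    have "((\<lambda>t. 0) has_real_derivative bump ([:0, 0, 1:] * (P - pderiv P)) t) (at t)"
      using 2 by (simp add: bump_def)
    then show ?thesis
      by (rule has_field_derivative_transform_within_open[where S = "{..<0}"])
        (use 2 in \<open>auto simp: bump_def\<close>)
  next
    case 3
    have "((\<lambda>h. poly (pCons 0 P) (inverse h) * exp (- inverse h)) \<longlongrightarrow> 0) (at_right 0)"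
      by (rule filterlim_compose[OF poly_mult_exp_tendsto_0 filterlim_inverse_at_top_right])
    then have "((\<lambda>h. bump P h / h) \<longlongrightarrow> 0) (at_right 0)"
      by (rule Lim_transform_eventually)
        (auto simp: bump_def eventually_at_filter field_simps)
    moreover have "((\<lambda>h. bump P h / h) \<longlongrightarrow> 0) (at_left 0)"
      by (rule tendsto_eventually) (auto simp: bump_def eventually_at_filter)
    ultimately have "((\<lambda>h. bump P h / h) \<longlongrightarrow> 0) (at 0)"
      by (simp add: filterlim_at_split)
    then show ?thesis using 3 by (simp add: DERIV_def bump_def)
  qed
qed

text \<open>A class of smooth functions tailored to the cutoffs below. Closure under antiderivatives
  covers the polynomials.\<close>

inductive smooth :: "(real \<Rightarrow> real) \<Rightarrow> bool"
  where
    bump: "smooth (\<lambda>x. bump P (a * x + b))"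
  | const: "smooth (\<lambda>x. c)"
  | add: "smooth f \<Longrightarrow> smooth g \<Longrightarrow> smooth (\<lambda>x. f x + g x)"
  | mult: "smooth f \<Longrightarrow> smooth g \<Longrightarrow> smooth (\<lambda>x. f x * g x)"
  | antiderivative: "smooth f \<Longrightarrow> (\<And>x. (F has_real_derivative f x) (at x)) \<Longrightarrow> smooth F"

lemma bump_affine_has_derivative:
  "((\<lambda>x. bump P (a * x + b)) has_real_derivative
    bump ([:0, 0, 1:] * (P - pderiv P)) (a * x + b) * a) (at x)"
proof -
  have "((\<lambda>x. a * x + b) has_real_derivative a) (at x)"
    by (auto intro!: derivative_eq_intros)
  from DERIV_chain2[OF bump_has_derivative this] show ?thesis .
qed

lemma smooth_has_derivative:
  "smooth f \<Longrightarrow> \<exists>f'. smooth f' \<and> (\<forall>x. (f has_real_derivative f' x) (at x))"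
proof (induction rule: smooth.induct)
  case (bump P a b)
  show ?case
    by (intro exI conjI allI, rule smooth.mult[OF smooth.bump smooth.const],
        rule bump_affine_has_derivative)
next
  case (const c)
  show ?case by (intro exI[of _ "\<lambda>x. 0"]) (auto intro: smooth.const)
next
  case (add f g)
  then obtain f' g' where "smooth f'" "\<And>x. (f has_real_derivative f' x) (at x)"
    "smooth g'" "\<And>x. (g has_real_derivative g' x) (at x)" by blast
  then show ?case
    by (intro exI[of _ "\<lambda>x. f' x + g' x"]) (auto intro: smooth.add derivative_intros)
next
  case (mult f g)
  then obtain f' g' where d: "smooth f'" "\<And>x. (f has_real_derivative f' x) (at x)"
    "smooth g'" "\<And>x. (g has_real_derivative g' x) (at x)" by blast
  then show ?case using mult.hyps
    by (intro exI[of _ "\<lambda>x. f' x * g x + g' x * f x"])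
      (auto intro!: smooth.add smooth.mult DERIV_mult)
next
  case (antiderivative f F)
  then show ?case by blast
qed

text \<open>The class supplies one derivative at a time; dependent choice strings them into a
  sequence indexed by the order, the form in which \<open>C_k_tensor\<close> consumes them.\<close>

lemma smooth_derivatives:
  assumes "smooth f"
  obtains A where "A 0 = f" "\<And>n x. (A n has_real_derivative A (Suc n) x) (at x)"
proof -
  have "\<exists>A. (smooth (A 0) \<and> A 0 = f) \<and>
      (\<forall>n. smooth (A n) \<and> (\<forall>x. (A n has_real_derivative A (Suc n) x) (at x)))"
  proof -
    have "\<exists>A. \<forall>n. (smooth (A n) \<and> (n = 0 \<longrightarrow> A n = f)) \<and>
        (\<forall>x. (A n has_real_derivative A (Suc n) x) (at x))"
      by (rule dependent_nat_choice) (use assms smooth_has_derivative in blast)+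
    then show ?thesis by blast
  qed
  then show thesis using that by blast
qed

lemma smooth_polynomial: "real_polynomial_function g \<Longrightarrow> smooth g" for g :: "real \<Rightarrow> real"
proof (induction rule: real_polynomial_function.induct)
  case (linear f)
  have fx: "f x = f 1 * x" for x
    using linear_cmul[OF bounded_linear.linear[OF linear], of x 1] by simp
  have f: "(\<lambda>x. f 1 * x) = f" by (rule ext) (rule fx[symmetric])
  have "((\<lambda>x. f 1 * x) has_real_derivative f 1) (at x)" for x
    by (auto intro!: derivative_eq_intros)
  then have "(f has_real_derivative f 1) (at x)" for x by (simp only: f)
  then show ?case by (rule smooth.antiderivative[OF smooth.const])
qed (auto intro: smooth.intros)

section \<open>Cutoffs and approximation on a bounded interval\<close>

lemma deriv_bound_diff:
  fixes F :: "real \<Rightarrow> real"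
  assumes "x \<le> y" "\<And>t. x \<le> t \<Longrightarrow> t \<le> y \<Longrightarrow> (F has_real_derivative F' t) (at t)"
    and B: "\<And>t. x \<le> t \<Longrightarrow> t \<le> y \<Longrightarrow> \<bar>F' t\<bar> \<le> B"
  shows "\<bar>F y - F x\<bar> \<le> B * (y - x)"
proof (cases "x = y")
  case False
  with \<open>x \<le> y\<close> have "x < y" by simp
  from MVT2[OF this assms(2)] obtain z where z: "x < z" "z < y" "F y - F x = (y - x) * F' z"
    by blast
  then have "\<bar>F y - F x\<bar> = (y - x) * \<bar>F' z\<bar>" using \<open>x < y\<close> by (simp add: abs_mult)
  also have "\<dots> \<le> (y - x) * B" using B[of z] z \<open>x < y\<close> by (intro mult_left_mono) auto
  finally show ?thesis by (simp add: mult.commute)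
qed simp

text \<open>With \<open>bump 1\<close> = exp (- 1 / t) the cutoff never reaches 1; it tends to 1
  pointwise for t > 0 as n grows, which is what dominated convergence asks for.\<close>

definition cutoff :: "nat \<Rightarrow> real \<Rightarrow> real"
  where "cutoff n t = bump 1 (real (Suc n) * t + - 1)"

definition cutoff' :: "nat \<Rightarrow> real \<Rightarrow> real"
  where "cutoff' n t = bump [:0, 0, 1:] (real (Suc n) * t + - 1) * real (Suc n)"

lemma cutoff_has_derivative: "(cutoff n has_real_derivative cutoff' n t) (at t)"
  using bump_affine_has_derivative[of 1 "real (Suc n)" "-1" t]
  by (simp add: cutoff_def[abs_def] cutoff'_def[abs_def] pderiv_1)

lemma cutoff_bounds: "0 \<le> cutoff n t" "cutoff n t \<le> 1"
  by (auto simp: cutoff_def bump_def)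

lemma cutoff_eq_0: "t \<le> 1 / real (Suc n) \<Longrightarrow> cutoff n t = 0"
  by (auto simp: cutoff_def bump_def field_simps)

text \<open>The cutoff rises over a scale comparable with the distance to the boundary, so its
  derivative is compensated by a factor vanishing linearly there.\<close>

lemma cutoff'_bound:
  assumes "t \<ge> 0"
  shows "\<bar>cutoff' n t\<bar> * t \<le> 3"
proof (cases "real (Suc n) * t + - 1 > 0")
  case True
  \<comment> \<open>In terms of r = 1 / s the quantity is (r + r^2) exp (- r), with no n left; the
    constant 3 comes from exp r \<ge> 1 + r + r^2 / 2.\<close>
  define s where "s = real (Suc n) * t + - 1"
  define r where "r = 1 / s"
  have s: "s > 0" and r: "r > 0" using True by (auto simp: s_def r_def)
  have "\<bar>cutoff' n t\<bar> * t = r\<^sup>2 * exp (- r) * (real (Suc n) * t)"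
    using True unfolding cutoff'_def bump_def s_def[symmetric] r_def by (simp add: power2_eq_square)
  also have "real (Suc n) * t = s + 1" by (simp add: s_def)
  also have "r\<^sup>2 * exp (- r) * (s + 1) = (r + r\<^sup>2) * exp (- r)"
    using s by (simp add: r_def field_simps power2_eq_square)
  also have "\<dots> \<le> 3"
  proof -
    have "r + r\<^sup>2 \<le> 3 * (1 + r + r\<^sup>2 / 2)" using r zero_le_power2[of r] by argo
    also have "\<dots> \<le> 3 * exp r" using exp_lower_Taylor_quadratic[of r] r by simp
    finally show ?thesis by (simp add: exp_minus field_simps)
  qed
  finally show ?thesis .
qed (simp add: cutoff'_def bump_def)

lemma cutoff_argument_at_top: "filterlim (\<lambda>n. real (Suc n) * t + - 1) at_top sequentially" if "t > 0"
proof -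
  have "filterlim (\<lambda>n. real (Suc n) * t) at_top sequentially"
    by (rule filterlim_at_top_mult_tendsto_pos[OF tendsto_const that])
      (rule filterlim_compose[OF filterlim_real_sequentially filterlim_Suc])
  then show ?thesis
    using filterlim_tendsto_add_at_top[OF tendsto_const[of "-1"]] by (simp add: add.commute)
qed

lemma cutoff_tendsto: "(\<lambda>n. cutoff n t) \<longlonglongrightarrow> 1" if "t > 0"
proof -
  note s = cutoff_argument_at_top[OF that]
  have "(\<lambda>n. exp (- (1 / (real (Suc n) * t + - 1)))) \<longlonglongrightarrow> exp (- 0)"
    by (intro tendsto_intros tendsto_divide_0[OF tendsto_const] filterlim_at_top_imp_at_infinity s)
  then have "(\<lambda>n. exp (- (1 / (real (Suc n) * t + - 1)))) \<longlonglongrightarrow> 1" by simp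
  then show ?thesis
    by (rule Lim_transform_eventually)
      (use filterlim_at_top_dense[THEN iffD1, OF s, rule_format, of 0] in
        \<open>auto simp: cutoff_def bump_def elim!: eventually_mono\<close>)
qed

lemma cutoff'_tendsto: "(\<lambda>n. cutoff' n t) \<longlonglongrightarrow> 0" if "t > 0"
proof (rule Lim_null_comparison)
  note s = cutoff_argument_at_top[OF that]
  show "\<forall>\<^sub>F n in sequentially.
      norm (cutoff' n t) \<le> (1 + 1 / (real (Suc n) * t + - 1)) / t * (1 / (real (Suc n) * t + - 1))"
    using filterlim_at_top_dense[THEN iffD1, OF s, rule_format, of 0]
  proof eventually_elim
    case (elim n)
    define s where "s = real (Suc n) * t + - 1"
    have "s > 0" using elim by (simp add: s_def)
    \<comment> \<open>Eliminating n shows that for fixed t the derivative is of order 1 / s.\<close>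
    have n: "real (Suc n) = (s + 1) / t" using that by (simp add: s_def field_simps)
    have "norm (cutoff' n t) = exp (- (1 / s)) * ((s + 1) / t / s\<^sup>2)"
      using \<open>s > 0\<close> that
      unfolding cutoff'_def bump_def s_def[symmetric] n by (simp add: power2_eq_square)
    also have "\<dots> \<le> 1 * ((s + 1) / t / s\<^sup>2)"
      using \<open>s > 0\<close> that by (intro mult_right_mono) auto
    also have "\<dots> = (1 + 1 / s) / t * (1 / s)"
      using \<open>s > 0\<close> that by (simp add: field_simps power2_eq_square)
    finally show ?case by (simp add: s_def)
  qed
  have "(\<lambda>n. (1 + 1 / (real (Suc n) * t + - 1)) / t * (1 / (real (Suc n) * t + - 1))) \<longlonglongrightarrow>
      (1 + 0) / t * 0"
    using that
    by (intro tendsto_intros tendsto_divide_0[OF tendsto_const] filterlim_at_top_imp_at_infinity s) auto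
  then show "(\<lambda>n. (1 + 1 / (real (Suc n) * t + - 1)) / t * (1 / (real (Suc n) * t + - 1))) \<longlonglongrightarrow> 0"
    by simp
qed

text \<open>The derivative f' is approximated uniformly by polynomials, their antiderivatives are
  corrected to vanish at both ends, and cutoffs produce compact support. The polynomials P n are
  bounded by a fixed multiple of the distance to either end, which keeps cutoff' times P n bounded
  uniformly in n.\<close>

lemma compactly_supported_approximation:
  fixes f :: "real \<Rightarrow> real"
  assumes ab: "\<alpha> < \<beta>" and f: "\<And>x. (f has_real_derivative f' x) (at x)"
    and f': "continuous_on UNIV f'" and f0: "f \<alpha> = 0" "f \<beta> = 0"
  obtains a a' C where "\<And>n. smooth (a n)" "\<And>n x. (a n has_real_derivative a' n x) (at x)"
    "\<And>n x. x \<notin> {\<alpha> + 1 / Suc n..\<beta> - 1 / Suc n} \<Longrightarrow> a n x = 0"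
    "\<And>x. \<alpha> < x \<Longrightarrow> x < \<beta> \<Longrightarrow> (\<lambda>n. a n x) \<longlonglongrightarrow> f x"
    "\<And>x. \<alpha> < x \<Longrightarrow> x < \<beta> \<Longrightarrow> (\<lambda>n. a' n x) \<longlonglongrightarrow> f' x"
    "\<And>n x. \<alpha> \<le> x \<Longrightarrow> x \<le> \<beta> \<Longrightarrow> \<bar>a n x\<bar> \<le> C"
    "\<And>n x. \<alpha> \<le> x \<Longrightarrow> x \<le> \<beta> \<Longrightarrow> \<bar>a' n x\<bar> \<le> C"
proof -
  have approx: "\<exists>P P'. smooth P \<and> (\<forall>x. (P has_real_derivative P' x) (at x)) \<and> P \<alpha> = 0 \<and> P \<beta> = 0 \<and>
      (\<forall>x. \<alpha> \<le> x \<and> x \<le> \<beta> \<longrightarrow> \<bar>P' x - f' x\<bar> \<le> 2 * e)" if e: "e > 0" for e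
  proof -
    obtain g where g: "real_polynomial_function g" "\<And>x. x \<in> {\<alpha>..\<beta>} \<Longrightarrow> \<bar>f' x - g x\<bar> < e"
      using Stone_Weierstrass_real_polynomial_function[OF compact_Icc
          continuous_on_subset[OF f' subset_UNIV] e, of \<alpha> \<beta>] by blast
    have "continuous_on UNIV g"
      using g(1) by (simp add: continuous_on_polymonial_function real_polynomial_function_eq)
    then obtain G where G: "\<And>x. (G has_real_derivative g x) (at x)"
      using continuous_antiderivative by metis
    \<comment> \<open>The slope of the affine correction. It is at most e because f vanishes at both
      ends, so the error for the derivative doubles to 2 e.\<close>
    define m where "m = (G \<beta> - G \<alpha>) / (\<beta> - \<alpha>)"
    have "\<bar>(G \<beta> - f \<beta>) - (G \<alpha> - f \<alpha>)\<bar> \<le> e * (\<beta> - \<alpha>)"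
      by (rule deriv_bound_diff[where F' = "\<lambda>x. g x - f' x"])
        (use ab g(2) in \<open>auto intro!: derivative_intros G f simp: abs_minus_commute less_imp_le\<close>)
    then have m: "\<bar>m\<bar> \<le> e" using ab f0 by (simp add: m_def field_simps)
    define P where "P x = G x + (- m * x + (m * \<alpha> - G \<alpha>))" for x
    have P: "(P has_real_derivative g x - m) (at x)" for x
      unfolding P_def by (rule derivative_eq_intros G refl)+ simp
    have "smooth (\<lambda>x. - m * x)"
      by (rule smooth.antiderivative[OF smooth.const[of "- m"]]) (auto intro!: derivative_eq_intros)
    moreover have "smooth G"
      by (rule smooth.antiderivative[OF smooth_polynomial[OF g(1)] G])
    ultimately have "smooth P"
      unfolding P_def by (intro smooth.add smooth.const)
    moreover have "P \<alpha> = 0" "P \<beta> = 0"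
    proof -
      have "m * (\<beta> - \<alpha>) = G \<beta> - G \<alpha>" using ab by (simp add: m_def)
      then show "P \<alpha> = 0" "P \<beta> = 0" by (simp_all add: P_def algebra_simps)
    qed
    moreover have "\<bar>g x - m - f' x\<bar> \<le> 2 * e" if "\<alpha> \<le> x" "x \<le> \<beta>" for x
      using g(2)[of x] m that by auto
    ultimately show ?thesis using P by (intro exI[of _ P] exI[of _ "\<lambda>x. g x - m"]) simp
  qed
  have "\<forall>n. \<exists>P P'. smooth P \<and> (\<forall>x. (P has_real_derivative P' x) (at x)) \<and> P \<alpha> = 0 \<and> P \<beta> = 0 \<and>
      (\<forall>x. \<alpha> \<le> x \<and> x \<le> \<beta> \<longrightarrow> \<bar>P' x - f' x\<bar> \<le> 2 * (1 / real (Suc n)))"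
    by (intro allI approx) simp
  then obtain P P' where P: "\<And>n. smooth (P n)" "\<And>n x. (P n has_real_derivative P' n x) (at x)"
    "\<And>n. P n \<alpha> = 0" "\<And>n. P n \<beta> = 0"
    and P': "\<And>n x. \<alpha> \<le> x \<Longrightarrow> x \<le> \<beta> \<Longrightarrow> \<bar>P' n x - f' x\<bar> \<le> 2 * (1 / real (Suc n))"
    by metis
  have "bounded (f' ` {\<alpha>..\<beta>})"
    by (intro compact_imp_bounded compact_continuous_image continuous_on_subset[OF f']) auto
  then obtain B where "\<forall>y\<in>f' ` {\<alpha>..\<beta>}. norm y \<le> B" unfolding bounded_iff ..
  then have B: "\<bar>f' x\<bar> \<le> B" if "\<alpha> \<le> x" "x \<le> \<beta>" for x using that by simp
  have B0: "B \<ge> 0" using B[of \<alpha>] ab by simp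
  have P'b: "\<bar>P' n x\<bar> \<le> B + 2" if "\<alpha> \<le> x" "x \<le> \<beta>" for n x
  proof -
    have "2 * (1 / real (Suc n)) \<le> 2" by (simp add: field_simps)
    then show ?thesis using P'[OF that, of n] B[OF that] by linarith
  qed
  have Pl: "\<bar>P n x\<bar> \<le> (B + 2) * (x - \<alpha>)" if "\<alpha> \<le> x" "x \<le> \<beta>" for n x
  proof -
    have "\<bar>P n x - P n \<alpha>\<bar> \<le> (B + 2) * (x - \<alpha>)"
      by (rule deriv_bound_diff[where F' = "P' n"]) (use that P(2) P'b in auto)
    then show ?thesis by (simp add: P)
  qed
  have Pr: "\<bar>P n x\<bar> \<le> (B + 2) * (\<beta> - x)" if "\<alpha> \<le> x" "x \<le> \<beta>" for n x
  proof -
    have "\<bar>P n \<beta> - P n x\<bar> \<le> (B + 2) * (\<beta> - x)"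
      by (rule deriv_bound_diff[where F' = "P' n"]) (use that P(2) P'b in auto)
    then show ?thesis by (simp add: P)
  qed
  have Pf: "\<bar>P n x - f x\<bar> \<le> 2 * (1 / real (Suc n)) * (x - \<alpha>)" if "\<alpha> \<le> x" "x \<le> \<beta>" for n x
  proof -
    have "\<bar>(P n x - f x) - (P n \<alpha> - f \<alpha>)\<bar> \<le> 2 * (1 / real (Suc n)) * (x - \<alpha>)"
      by (rule deriv_bound_diff[where F' = "\<lambda>x. P' n x - f' x"])
        (use that P' in \<open>auto intro!: derivative_intros P f\<close>)
    then show ?thesis by (simp add: P f0)
  qed
  have lim0: "(\<lambda>n. 2 * (1 / real (Suc n)) * c) \<longlonglongrightarrow> 0" for c
    using tendsto_mult_left_zero[OF tendsto_mult_right_zero[OF LIMSEQ_Suc[OF lim_inverse_n'], of 2], of c]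
    by simp
  have Plim: "(\<lambda>n. P n x) \<longlonglongrightarrow> f x" if "\<alpha> < x" "x < \<beta>" for x
    by (rule LIM_zero_cancel, rule Lim_null_comparison[OF _ lim0[of "x - \<alpha>"]])
      (use Pf that in auto)
  have P'lim: "(\<lambda>n. P' n x) \<longlonglongrightarrow> f' x" if "\<alpha> < x" "x < \<beta>" for x
    by (rule LIM_zero_cancel, rule Lim_null_comparison[OF _ lim0[of 1]])
      (use P' that in auto)
  define a where "a n x = cutoff n (x - \<alpha>) * cutoff n (\<beta> - x) * P n x" for n x
  define a' where "a' n x = cutoff' n (x - \<alpha>) * cutoff n (\<beta> - x) * P n x -
      cutoff n (x - \<alpha>) * cutoff' n (\<beta> - x) * P n x +
      cutoff n (x - \<alpha>) * cutoff n (\<beta> - x) * P' n x" for n x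
  have cl: "((\<lambda>x. cutoff n (x - \<alpha>)) has_real_derivative cutoff' n (x - \<alpha>)) (at x)" for n x
    by (rule DERIV_cong[OF DERIV_chain2[OF cutoff_has_derivative, where g = "\<lambda>x. x - \<alpha>"]])
      (auto intro!: derivative_eq_intros)
  have cr: "((\<lambda>x. cutoff n (\<beta> - x)) has_real_derivative - cutoff' n (\<beta> - x)) (at x)" for n x
    by (rule DERIV_cong[OF DERIV_chain2[OF cutoff_has_derivative, where g = "\<lambda>x. \<beta> - x"]])
      (auto intro!: derivative_eq_intros)
  have sl: "smooth (\<lambda>x. cutoff n (x - \<alpha>))" for n
    using smooth.bump[of 1 "real (Suc n)" "- real (Suc n) * \<alpha> - 1"]
    by (simp add: cutoff_def algebra_simps)
  have sr: "smooth (\<lambda>x. cutoff n (\<beta> - x))" for n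
    using smooth.bump[of 1 "- real (Suc n)" "real (Suc n) * \<beta> - 1"]
    by (simp add: cutoff_def algebra_simps)
  have c1: "\<bar>cutoff n t\<bar> \<le> 1" for n t using cutoff_bounds[of n t] by simp
  have c'P: "\<bar>cutoff' n t * p\<bar> \<le> 3 * (B + 2)" if "t \<ge> 0" "\<bar>p\<bar> \<le> (B + 2) * t" for n t p
  proof -
    have "\<bar>cutoff' n t * p\<bar> \<le> \<bar>cutoff' n t\<bar> * ((B + 2) * t)"
      using that by (simp add: abs_mult mult_left_mono)
    also have "\<dots> = (\<bar>cutoff' n t\<bar> * t) * (B + 2)" by simp
    also have "\<dots> \<le> 3 * (B + 2)" using cutoff'_bound[OF that(1)] B0 by (intro mult_right_mono) auto
    finally show ?thesis .
  qed
  \<comment> \<open>The first summand bounds \<open>a n\<close>; the second bounds the three terms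
    of \<open>a' n\<close> by 3 + 3 + 1 multiples of B + 2.\<close>
  define C where "C = (B + 2) * (\<beta> - \<alpha>) + 7 * (B + 2)"
  show thesis
  proof (rule that[of a a' C])
    show "smooth (a n)" for n
      unfolding a_def by (intro smooth.mult sl sr P)
    show "(a n has_real_derivative a' n x) (at x)" for n x
      unfolding a_def a'_def
      by (rule derivative_eq_intros cl cr P refl)+ (simp add: algebra_simps)
    show "a n x = 0" if "x \<notin> {\<alpha> + 1 / Suc n..\<beta> - 1 / Suc n}" for n x
      using that cutoff_eq_0[of "x - \<alpha>" n] cutoff_eq_0[of "\<beta> - x" n] by (force simp: a_def)
    show "(\<lambda>n. a n x) \<longlonglongrightarrow> f x" if "\<alpha> < x" "x < \<beta>" for x
    proof -
      have "(\<lambda>n. a n x) \<longlonglongrightarrow> 1 * 1 * f x"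
        unfolding a_def by (intro tendsto_intros cutoff_tendsto Plim) (use that in auto)
      then show ?thesis by simp
    qed
    show "(\<lambda>n. a' n x) \<longlonglongrightarrow> f' x" if "\<alpha> < x" "x < \<beta>" for x
    proof -
      have "(\<lambda>n. a' n x) \<longlonglongrightarrow> 0 * 1 * f x - 1 * 0 * f x + 1 * 1 * f' x"
        unfolding a'_def
        by (intro tendsto_intros cutoff_tendsto cutoff'_tendsto Plim P'lim) (use that in auto)
      then show ?thesis by simp
    qed
    fix n x assume x: "\<alpha> \<le> x" "x \<le> \<beta>"
    have cc: "\<bar>cutoff n (x - \<alpha>) * cutoff n (\<beta> - x) * p\<bar> \<le> \<bar>p\<bar>" for p
    proof -
      have "\<bar>cutoff n (x - \<alpha>)\<bar> * \<bar>cutoff n (\<beta> - x)\<bar> * \<bar>p\<bar> \<le> 1 * 1 * \<bar>p\<bar>"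
        by (intro mult_mono c1) auto
      then show ?thesis by (simp add: abs_mult)
    qed
    have "(B + 2) * (x - \<alpha>) \<le> (B + 2) * (\<beta> - \<alpha>)" using x B0 by (intro mult_left_mono) auto
    then have "\<bar>P n x\<bar> \<le> (B + 2) * (\<beta> - \<alpha>)" by (rule order_trans[OF Pl[OF x]])
    also have "\<dots> \<le> C" using B0 by (simp add: C_def)
    finally show "\<bar>a n x\<bar> \<le> C"
      unfolding a_def by (rule order_trans[OF cc])
    have 1: "\<bar>cutoff' n (x - \<alpha>) * cutoff n (\<beta> - x) * P n x\<bar> \<le> 3 * (B + 2)"
    proof -
      have "\<bar>cutoff n (\<beta> - x)\<bar> * \<bar>cutoff' n (x - \<alpha>) * P n x\<bar> \<le> 1 * (3 * (B + 2))"
        using x Pl[OF x, of n] by (intro mult_mono c1 c'P) auto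
      then show ?thesis by (simp add: abs_mult mult_ac)
    qed
    have 2: "\<bar>cutoff n (x - \<alpha>) * cutoff' n (\<beta> - x) * P n x\<bar> \<le> 3 * (B + 2)"
    proof -
      have "\<bar>cutoff n (x - \<alpha>)\<bar> * \<bar>cutoff' n (\<beta> - x) * P n x\<bar> \<le> 1 * (3 * (B + 2))"
        using x Pr[OF x, of n] by (intro mult_mono c1 c'P) auto
      then show ?thesis by (simp add: abs_mult mult_ac)
    qed
    have "\<bar>p - q + r\<bar> \<le> C"
      if "\<bar>p\<bar> \<le> 3 * (B + 2)" "\<bar>q\<bar> \<le> 3 * (B + 2)" "\<bar>r\<bar> \<le> B + 2" for p q r
    proof -
      have "\<bar>p - q + r\<bar> \<le> \<bar>p\<bar> + \<bar>q\<bar> + \<bar>r\<bar>"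
        by (intro order_trans[OF abs_triangle_ineq] add_mono abs_triangle_ineq4 order_refl)
      also have "\<dots> \<le> 3 * (B + 2) + 3 * (B + 2) + (B + 2)"
        by (intro add_mono that)
      also have "\<dots> = 7 * (B + 2)" by simp
      also have "\<dots> \<le> C" using B0 ab by (simp add: C_def)
      finally show ?thesis .
    qed
    from this[OF 1 2 order_trans[OF cc P'b[OF x]]] show "\<bar>a' n x\<bar> \<le> C"
      unfolding a'_def .
  qed
qed

section \<open>Weak eigenfunctions and the Friedrichs extension\<close>

lemma L2_norm_eq: "L2_norm N f = sqrt (\<integral>x. (cmod (f x))\<^sup>2 \<partial>N)"
  unfolding L2_norm_on_def set_lebesgue_integral_def
  by (intro arg_cong[where f = sqrt] Bochner_Integration.integral_cong) auto

lemma L2_integrable: "f \<in> L2 N \<Longrightarrow> integrable N (\<lambda>x. (cmod (f x))\<^sup>2)"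
  by (simp add: L2_def)

lemma cmod_diff_square_le: "(cmod (a - b))\<^sup>2 \<le> 2 * (cmod a)\<^sup>2 + 2 * (cmod b)\<^sup>2"
proof -
  have "(cmod (a - b))\<^sup>2 \<le> (cmod a + cmod b)\<^sup>2"
    by (intro power_mono norm_triangle_ineq4) auto
  also have "\<dots> \<le> 2 * (cmod a)\<^sup>2 + 2 * (cmod b)\<^sup>2"
    using sum_squares_bound[of "cmod a" "cmod b"] by (simp add: power2_sum)
  finally show ?thesis .
qed

lemma L2_diff:
  assumes "f \<in> L2 N" "g \<in> L2 N" shows "(\<lambda>x. f x - g x) \<in> L2 N"
proof -
  have m: "f \<in> borel_measurable N" "g \<in> borel_measurable N"
    using assms by (auto simp: L2_def)
  have "integrable N (\<lambda>x. (cmod (f x - g x))\<^sup>2)"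
  proof (rule Bochner_Integration.integrable_bound)
    show "integrable N (\<lambda>x. 2 * (cmod (f x))\<^sup>2 + 2 * (cmod (g x))\<^sup>2)"
      using assms by (auto simp: L2_def)
  qed (use m cmod_diff_square_le in auto)
  then show ?thesis using m by (auto simp: L2_def)
qed

lemma young_cmod_le:
  assumes "t > 0" shows "cmod (a * cnj b) \<le> (t * (cmod a)\<^sup>2 + (cmod b)\<^sup>2 / t) / 2"
proof -
  have "0 \<le> (t * cmod a - cmod b)\<^sup>2 / t" using assms by simp
  also have "\<dots> = t * (cmod a)\<^sup>2 + (cmod b)\<^sup>2 / t - 2 * (cmod a * cmod b)"
    using assms by (simp add: power2_eq_square field_simps)
  finally show ?thesis by (simp add: norm_mult)
qed

lemma L2_inner_integrable:
  assumes "f \<in> L2 N" "g \<in> L2 N" shows "integrable N (\<lambda>x. f x * cnj (g x))"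
proof (rule Bochner_Integration.integrable_bound)
  have m: "f \<in> borel_measurable N" "g \<in> borel_measurable N"
    using assms by (auto simp: L2_def)
  have "(\<lambda>x. cnj (g x)) \<in> borel_measurable N"
    by (rule measurable_compose[OF m(2)]) (intro borel_measurable_continuous_onI continuous_intros)
  then show "(\<lambda>x. f x * cnj (g x)) \<in> borel_measurable N" using m by simp
  show "integrable N (\<lambda>x. (1 * (cmod (f x))\<^sup>2 + (cmod (g x))\<^sup>2 / 1) / 2)"
    using assms by (auto simp: L2_def)
  show "AE x in N. norm (f x * cnj (g x)) \<le> norm ((1 * (cmod (f x))\<^sup>2 + (cmod (g x))\<^sup>2 / 1) / 2)"
    using young_cmod_le[of 1] by (auto simp del: complex_mod_mult_cnj)
qed

lemma L2_inner_diff_left: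
  assumes "f \<in> L2 N" "g \<in> L2 N" "h \<in> L2 N"
  shows "L2_inner N (\<lambda>x. f x - g x) h = L2_inner N f h - L2_inner N g h"
  unfolding L2_inner_def left_diff_distrib
  by (intro Bochner_Integration.integral_diff L2_inner_integrable assms)

lemma L2_inner_diff_right:
  assumes "f \<in> L2 N" "g \<in> L2 N" "h \<in> L2 N"
  shows "L2_inner N h (\<lambda>x. f x - g x) = L2_inner N h f - L2_inner N h g"
  unfolding L2_inner_def complex_cnj_diff right_diff_distrib
  by (intro Bochner_Integration.integral_diff L2_inner_integrable assms)

text \<open>Optimising t in Young's inequality yields Cauchy-Schwarz; the best t is sqrt B / sqrt A
  when both are positive.\<close>

lemma le_sqrt_mult_sqrt:
  fixes c A B :: real
  assumes A: "A \<ge> 0" and B: "B \<ge> 0" and c: "\<And>t. t > 0 \<Longrightarrow> c \<le> (t * A + B / t) / 2"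
  shows "c \<le> sqrt A * sqrt B"
proof (cases "c \<le> 0")
  case True
  then show ?thesis using A B by (meson mult_nonneg_nonneg order_trans real_sqrt_ge_zero)
next
  case False
  then have c0: "c > 0" by simp
  have "B > 0"
  proof (rule ccontr)
    assume "\<not> B > 0"
    then have "B = 0" using B by simp
    \<comment> \<open>The optimal t degenerates here; any t with t A \<le> c already forces c \<le>
      c / 2. The case A = 0 is similar.\<close>
    define t where "t = c / (A + 1)"
    have "t > 0" "t * A \<le> c" using c0 A by (auto simp: t_def field_simps)
    then show False using c[of t] c0 \<open>B = 0\<close> by simp
  qed
  have "A > 0"
  proof (rule ccontr)
    assume "\<not> A > 0"
    then have "A = 0" using A by simp
    then show False using c[of "B / c"] c0 \<open>B > 0\<close> by simp
  qed
  have "c \<le> (sqrt B / sqrt A * A + B / (sqrt B / sqrt A)) / 2"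
    using \<open>A > 0\<close> \<open>B > 0\<close> by (intro c) simp
  also have "sqrt B / sqrt A * A = sqrt A * sqrt B"
    using \<open>A > 0\<close> by (simp add: field_simps)
  also have "B / (sqrt B / sqrt A) = sqrt A * sqrt B"
    using \<open>B > 0\<close> by (simp add: field_simps)
  finally show ?thesis by simp
qed

lemma L2_inner_le:
  assumes f: "f \<in> L2 N" and g: "g \<in> L2 N"
  shows "cmod (L2_inner N f g) \<le> L2_norm N f * L2_norm N g"
  unfolding L2_norm_eq
proof (rule le_sqrt_mult_sqrt)
  fix t :: real assume t: "t > 0"
  have "cmod (L2_inner N f g) \<le> (\<integral>x. cmod (f x * cnj (g x)) \<partial>N)"
    unfolding L2_inner_def by (rule integral_norm_bound)
  also have "\<dots> \<le> (\<integral>x. (t * (cmod (f x))\<^sup>2 + (cmod (g x))\<^sup>2 / t) / 2 \<partial>N)"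
    using L2_inner_integrable[OF f g] L2_integrable[OF f] L2_integrable[OF g] young_cmod_le[OF t]
    by (intro integral_mono integrable_norm) auto
  also have "\<dots> = (t * (\<integral>x. (cmod (f x))\<^sup>2 \<partial>N) + (\<integral>x. (cmod (g x))\<^sup>2 \<partial>N) / t) / 2"
    using L2_integrable[OF f] L2_integrable[OF g] by simp
  finally show "cmod (L2_inner N f g)
      \<le> (t * (\<integral>x. (cmod (f x))\<^sup>2 \<partial>N) + (\<integral>x. (cmod (g x))\<^sup>2 \<partial>N) / t) / 2" .
qed auto

lemma L2_inner_cnj: "cnj (L2_inner N f g) = L2_inner N g f"
  unfolding L2_inner_def Bochner_Integration.integral_cnj[symmetric] by (simp add: mult.commute)

lemma L2_inner_scale_left: "L2_inner N (\<lambda>x. c * f x) g = c * L2_inner N f g"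
  unfolding L2_inner_def mult.assoc by (rule integral_mult_right_zero)

text \<open>For test functions \<open>w\<close>, the symmetry of \<open>S\<close> identifies \<open>q(us n, w)\<close> with \<open>l \<langle>u, w\<rangle>\<close> up to an
  error that the Cauchy property controls uniformly on sets of bounded energy.\<close>

lemma friedrichs_weak_eigenfunction:
  assumes L2D: "\<And>u. u \<in> D \<Longrightarrow> u \<in> L2 N" and L2S: "\<And>u. u \<in> D \<Longrightarrow> S u \<in> L2 N"
    and minus: "\<And>u w. u \<in> D \<Longrightarrow> w \<in> D \<Longrightarrow> (\<lambda>x. u x - w x) \<in> D"
    and S_minus: "\<And>u w g. u \<in> D \<Longrightarrow> w \<in> D \<Longrightarrow> g \<in> D \<Longrightarrow>
      L2_inner N (S (\<lambda>x. u x - w x)) g = L2_inner N (S u) g - L2_inner N (S w) g"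
    and sym: "\<And>u w. u \<in> D \<Longrightarrow> w \<in> D \<Longrightarrow> L2_inner N (S u) w = L2_inner N u (S w)"
    and young: "\<And>u w t. u \<in> D \<Longrightarrow> w \<in> D \<Longrightarrow> t > 0 \<Longrightarrow>
      cmod (L2_inner N (S u) w)
      \<le> (t * cmod (L2_inner N (S u) u) + cmod (L2_inner N (S w) w) / t) / 2"
    and double: "\<And>u w. u \<in> D \<Longrightarrow> w \<in> D \<Longrightarrow>
      cmod (L2_inner N (S u) u)
      \<le> 2 * cmod (L2_inner N (S (\<lambda>x. u x - w x)) (\<lambda>x. u x - w x)) + 2 * cmod (L2_inner N (S w) w)"
    and weak: "\<And>w. w \<in> D \<Longrightarrow> L2_inner N \<phi> (S w) = of_real l * L2_inner N \<phi> w"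
    and approx: "form_approx N D S us \<phi>"
  shows "friedrichs N D S \<phi> (\<lambda>x. of_real l * \<phi> x)"
proof -
  let ?E = "\<lambda>u. cmod (L2_inner N (S u) u)"
  have phi: "\<phi> \<in> L2 N" and us: "\<And>n. us n \<in> D"
    and us_lim: "(\<lambda>n. L2_norm N (\<lambda>x. us n x - \<phi> x)) \<longlonglongrightarrow> 0"
    and us_Cauchy: "\<And>e. e > 0 \<Longrightarrow> \<exists>K. \<forall>m\<ge>K. \<forall>n\<ge>K. ?E (\<lambda>x. us m x - us n x) < e"
    using approx by (auto simp: form_approx_def)
  have "(\<lambda>n. L2_inner N (S (us n)) (vs n)) \<longlonglongrightarrow> L2_inner N (\<lambda>x. of_real l * \<phi> x) v"
    if "form_approx N D S vs v" for v vs
  proof -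
    have v: "v \<in> L2 N" and vs: "\<And>n. vs n \<in> D"
      and vs_lim: "(\<lambda>n. L2_norm N (\<lambda>x. vs n x - v x)) \<longlonglongrightarrow> 0"
      and vs_Cauchy: "\<And>e. e > 0 \<Longrightarrow> \<exists>K. \<forall>m\<ge>K. \<forall>n\<ge>K. ?E (\<lambda>x. vs m x - vs n x) < e"
      using that by (auto simp: form_approx_def)
    have 1: "(\<lambda>n. L2_inner N \<phi> (vs n)) \<longlonglongrightarrow> L2_inner N \<phi> v"
    proof (rule LIM_zero_cancel, rule Lim_null_comparison)
      have "cmod (L2_inner N \<phi> (vs n) - L2_inner N \<phi> v)
          \<le> L2_norm N \<phi> * L2_norm N (\<lambda>x. vs n x - v x)" for n
        using L2_inner_le[OF phi L2_diff[OF L2D[OF vs] v]]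
        by (simp add: L2_inner_diff_right L2D vs v phi)
      then show "\<forall>\<^sub>F n in sequentially. norm (L2_inner N \<phi> (vs n) - L2_inner N \<phi> v)
          \<le> L2_norm N \<phi> * L2_norm N (\<lambda>x. vs n x - v x)" by simp
      show "(\<lambda>n. L2_norm N \<phi> * L2_norm N (\<lambda>x. vs n x - v x)) \<longlonglongrightarrow> 0"
        by (rule tendsto_mult_right_zero[OF vs_lim])
    qed
    have us_weak: "(\<lambda>m. L2_inner N (us m) (S w)) \<longlonglongrightarrow> of_real l * L2_inner N \<phi> w"
      if w: "w \<in> D" for w
      unfolding weak[OF w, symmetric]
    proof (rule LIM_zero_cancel, rule Lim_null_comparison)
      have "cmod (L2_inner N (us m) (S w) - L2_inner N \<phi> (S w))
          \<le> L2_norm N (\<lambda>x. us m x - \<phi> x) * L2_norm N (S w)" for m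
        using L2_inner_le[OF L2_diff[OF L2D[OF us] phi] L2S[OF w]]
        by (simp add: L2_inner_diff_left L2D L2S us w phi)
      then show "\<forall>\<^sub>F m in sequentially. norm (L2_inner N (us m) (S w) - L2_inner N \<phi> (S w))
          \<le> L2_norm N (\<lambda>x. us m x - \<phi> x) * L2_norm N (S w)" by simp
      show "(\<lambda>m. L2_norm N (\<lambda>x. us m x - \<phi> x) * L2_norm N (S w)) \<longlonglongrightarrow> 0"
        by (rule tendsto_mult_left_zero[OF us_lim])
    qed
    obtain K0 where K0: "\<And>m n. m \<ge> K0 \<Longrightarrow> n \<ge> K0 \<Longrightarrow> ?E (\<lambda>x. vs m x - vs n x) < 1"
      using vs_Cauchy[of 1] by auto
    \<comment> \<open>A form-Cauchy sequence has bounded energy: compare with the single element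
      \<open>vs K0\<close>.\<close>
    define B where "B = 2 + 2 * ?E (vs K0)"
    have B: "?E (vs n) \<le> B" if "n \<ge> K0" for n
      using double[OF vs[of n] vs[of K0]] K0[OF that order_refl] by (simp add: B_def)
    have B0: "B \<ge> 0" by (simp add: B_def)
    have 2: "(\<lambda>n. L2_inner N (S (us n)) (vs n) - of_real l * L2_inner N \<phi> (vs n)) \<longlonglongrightarrow> 0"
    proof (rule LIMSEQ_I)
      fix e :: real assume "0 < e"
      define d where "d = e / 2"
      have d: "d > 0" using \<open>0 < e\<close> by (simp add: d_def)
      \<comment> \<open>Young's inequality with this t needs both t times the energy of us n - us m
        and B / t to be at most d. The threshold \<open>K1\<close> is thereby independent of
        \<open>vs n\<close>.\<close>
      define t where "t = (B + 1) / d"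
      have t: "t > 0" using B0 d by (simp add: t_def)
      obtain K1 where K1: "\<And>m n. m \<ge> K1 \<Longrightarrow> n \<ge> K1 \<Longrightarrow> ?E (\<lambda>x. us m x - us n x) < d / t"
        using us_Cauchy[of "d / t"] d t by auto
      \<comment> \<open>Here n stays fixed while m tends to infinity. Symmetry has moved
        \<open>S\<close> onto \<open>vs n\<close>, so the L^2 convergence of \<open>us m\<close>
        identifies the limit.\<close>
      have "norm (L2_inner N (S (us n)) (vs n) - of_real l * L2_inner N \<phi> (vs n)) \<le> d"
        if n: "n \<ge> max K0 K1" for n
      proof (rule Lim_bounded)
        show "(\<lambda>m. norm (L2_inner N (S (us n)) (vs n) - L2_inner N (us m) (S (vs n)))) \<longlonglongrightarrow>
            norm (L2_inner N (S (us n)) (vs n) - of_real l * L2_inner N \<phi> (vs n))"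
          by (intro tendsto_intros us_weak vs)
        show "\<forall>m\<ge>K1. norm (L2_inner N (S (us n)) (vs n) - L2_inner N (us m) (S (vs n))) \<le> d"
        proof (intro allI impI)
          fix m assume m: "K1 \<le> m"
          let ?w = "\<lambda>x. us n x - us m x"
          have "L2_inner N (S (us n)) (vs n) - L2_inner N (us m) (S (vs n))
              = L2_inner N (S ?w) (vs n)"
            using S_minus[OF us us vs] sym[OF us vs] by simp
          then have "norm (L2_inner N (S (us n)) (vs n) - L2_inner N (us m) (S (vs n)))
              \<le> (t * ?E ?w + ?E (vs n) / t) / 2"
            using young[OF minus[OF us us] vs t] by simp
          also have "\<dots> \<le> (t * (d / t) + B / t) / 2"
            using K1[of n m] m n B[of n] t
            by (intro divide_right_mono add_mono mult_left_mono) auto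
          also have "\<dots> \<le> d"
          proof -
            have "B / t \<le> d" using B0 d by (simp add: t_def field_simps)
            then show ?thesis using t by simp
          qed
          finally show "norm (L2_inner N (S (us n)) (vs n) - L2_inner N (us m) (S (vs n))) \<le> d" .
        qed
      qed
      moreover have "d < e" using \<open>0 < e\<close> by (simp add: d_def)
      ultimately show "\<exists>n0. \<forall>n\<ge>n0.
          norm (L2_inner N (S (us n)) (vs n) - of_real l * L2_inner N \<phi> (vs n) - 0) < e"
        by (intro exI[of _ "max K0 K1"]) fastforce
    qed
    have "(\<lambda>n. L2_inner N (S (us n)) (vs n) - of_real l * L2_inner N \<phi> (vs n)
        + of_real l * L2_inner N \<phi> (vs n)) \<longlonglongrightarrow> 0 + of_real l * L2_inner N \<phi> v"
      by (intro tendsto_intros 1 2)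
    then show ?thesis by (simp add: L2_inner_scale_left)
  qed
  moreover have "(\<lambda>x. of_real l * \<phi> x) \<in> L2 N"
    using phi by (auto simp: L2_def norm_mult power_mult_distrib)
  ultimately show ?thesis
    using approx unfolding friedrichs_def by blast
qed

section \<open>The quadratic form of the Grushin operator\<close>

lemma C_k_diff:
  "C_k p k f \<Longrightarrow> C_k p k g \<Longrightarrow> C_k p k (\<lambda>z. f z - g z)"
proof (induction k arbitrary: f g)
  case 0
  then show ?case by (simp add: continuous_on_diff)
next
  case (Suc k)
  have "partial1 (\<lambda>z. f z - g z) = (\<lambda>z. partial1 f z - partial1 g z)"
    unfolding partial1_def using Suc.prems by (intro ext vector_derivative_diff_at) auto
  moreover have "partial2 p (\<lambda>z. f z - g z) = (\<lambda>z. partial2 p f z - partial2 p g z)"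
    unfolding partial2_def using Suc.prems by (intro ext vector_derivative_diff_at) auto
  ultimately show ?case
    using Suc by (auto intro!: continuous_on_diff)
qed

text \<open>Computations on the second factor are pulled back along \<open>p\<close>: integrals
  become integrals over [-1, 1] x [0, 1], and additivity turns \<open>partial2\<close> into an
  ordinary derivative.\<close>

locale real_homomorphism =
  fixes p :: "real \<Rightarrow> 'b::{topological_space,ab_group_add}"
  assumes p_add: "p (s + t) = p s + p t" and p_cont: "continuous_on UNIV p"
begin

lemma continuous_pullback:
  "continuous_on UNIV f \<Longrightarrow> continuous_on A (\<lambda>z. f (fst z, p (snd z)))"
  by (rule continuous_on_compose2[of UNIV f])
    (auto intro!: continuous_intros continuous_on_compose2[OF p_cont])

lemma vol_measurable: "continuous_on UNIV f \<Longrightarrow> f \<in> borel_measurable (vol p)"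
  for f :: "_ \<Rightarrow> _::topological_space"
  unfolding vol_def by (simp add: borel_measurable_continuous_onI)

lemma vol_integral:
  fixes f :: "real \<times> 'b \<Rightarrow> 'c::euclidean_space"
  assumes f: "continuous_on UNIV f"
  shows "integrable (vol p) f"
    and "(\<lambda>z. f (fst z, p (snd z))) integrable_on cbox (-1, 0) (1, 1)"
    and "integral\<^sup>L (vol p) f = integral (cbox (-1, 0) (1, 1)) (\<lambda>z. f (fst z, p (snd z)))"
proof -
  let ?R = "{-1..1::real} \<times> {0..1::real}"
  have R: "?R = cbox (-1, 0) (1, 1)" by (simp add: cbox_Pair_eq)
  have "continuous_on UNIV (map_prod id p)"
    unfolding map_prod_def case_prod_unfold id_def
    by (intro continuous_on_Pair continuous_on_fst continuous_on_snd continuous_on_id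
        continuous_on_compose2[OF p_cont]) auto
  from borel_measurable_continuous_onI[OF this]
  have mp: "map_prod id p \<in> borel_measurable (restrict_space lborel ?R)"
    by (intro measurable_restrict_space1) simp
  have fm: "f \<in> borel_measurable borel"
    using f by (rule borel_measurable_continuous_onI)
  have eq: "f (map_prod id p z) = f (fst z, p (snd z))" for z by (cases z) simp
  have int: "set_integrable lborel ?R (\<lambda>z. f (fst z, p (snd z)))"
    unfolding set_integrable_def R by (intro borel_integrable_compact continuous_pullback f) auto
  then show "integrable (vol p) f"
    unfolding vol_def set_integrable_def
    by (subst integrable_distr_eq[OF mp fm], subst integrable_restrict_space)
      (auto simp: eq R)
  show "(\<lambda>z. f (fst z, p (snd z))) integrable_on cbox (-1, 0) (1, 1)"
    using set_borel_integral_eq_integral(1)[OF int] unfolding R .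
  show "integral\<^sup>L (vol p) f = integral (cbox (-1, 0) (1, 1)) (\<lambda>z. f (fst z, p (snd z)))"
    using set_borel_integral_eq_integral(2)[OF int]
    unfolding vol_def set_lebesgue_integral_def
    by (subst integral_distr[OF mp fm], subst integral_restrict_space) (auto simp: eq R)
qed

lemma vol_integral_iterated:
  fixes f :: "real \<times> 'b \<Rightarrow> 'c::euclidean_space"
  assumes f: "continuous_on UNIV f"
  shows "integral\<^sup>L (vol p) f = integral {-1..1} (\<lambda>x. integral {0..1} (\<lambda>t. f (x, p t)))"
    and "integral\<^sup>L (vol p) f = integral {0..1} (\<lambda>t. integral {-1..1} (\<lambda>x. f (x, p t)))"
proof -
  have c: "continuous_on (cbox (-1, 0) (1, 1)) (\<lambda>z. f (fst z, p (snd z)))"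
    by (rule continuous_pullback[OF f])
  show 1: "integral\<^sup>L (vol p) f = integral {-1..1} (\<lambda>x. integral {0..1} (\<lambda>t. f (x, p t)))"
    unfolding vol_integral(3)[OF f] integral_prod_continuous[OF c] by (simp add: cbox_interval)
  show "integral\<^sup>L (vol p) f = integral {0..1} (\<lambda>t. integral {-1..1} (\<lambda>x. f (x, p t)))"
    using integral_swap_continuous[of "-1" 0 1 1 "\<lambda>x t. f (x, p t)"] c
    unfolding 1 by (simp add: cbox_interval case_prod_unfold)
qed

lemma continuous_in_L2: "continuous_on UNIV f \<Longrightarrow> f \<in> L2 (vol p)"
  unfolding L2_def by (auto intro!: vol_measurable vol_integral continuous_intros)

text \<open>The boundary of the box is a null set, so bound and limit are asked for in its interior.
  This matters because the derivatives of the approximants vanish at the Dirichlet ends, where those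
  of the limit need not.\<close>

lemma vol_dominated_convergence:
  fixes h :: "nat \<Rightarrow> real \<times> 'b \<Rightarrow> real"
  assumes h: "\<And>n. continuous_on UNIV (h n)"
    and bound: "\<And>n x t. - 1 < x \<Longrightarrow> x < 1 \<Longrightarrow> 0 < t \<Longrightarrow> t < 1 \<Longrightarrow> \<bar>h n (x, p t)\<bar> \<le> C"
    and lim: "\<And>x t. - 1 < x \<Longrightarrow> x < 1 \<Longrightarrow> 0 < t \<Longrightarrow> t < 1 \<Longrightarrow> (\<lambda>n. h n (x, p t)) \<longlonglongrightarrow> 0"
  shows "(\<lambda>n. integral\<^sup>L (vol p) (h n)) \<longlonglongrightarrow> 0"
proof -
  let ?B = "box (-1, 0) (1, 1) :: (real \<times> real) set"
  have B: "?B = {-1<..<1} \<times> {0<..<1}" by (auto simp: box_def Basis_prod_def ball_Un)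
  have "(\<lambda>n. integral ?B (\<lambda>z. h n (fst z, p (snd z)))) \<longlonglongrightarrow> integral ?B (\<lambda>z. 0)"
  proof (rule dominated_convergence(2)[where h = "\<lambda>z. C"])
    show "(\<lambda>z. h n (fst z, p (snd z))) integrable_on ?B" for n
      using vol_integral(2)[OF h] by (simp add: integrable_on_open_interval)
    show "(\<lambda>z. C) integrable_on ?B"
      by (simp add: integrable_on_open_interval integrable_const)
  qed (use bound lim in \<open>auto simp: B\<close>)
  then show ?thesis by (simp add: vol_integral(3)[OF h] integral_open_interval)
qed

lemma C_k_partial1:
  assumes "C_k p (Suc k) f"
  shows "((\<lambda>x. f (x, y)) has_vector_derivative partial1 f (x, y)) (at x)"
  using assms by (auto simp: partial1_def vector_derivative_works)

lemma C_k_partial2: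
  assumes "C_k p (Suc k) f"
  shows "((\<lambda>t. f (x, p t)) has_vector_derivative partial2 p f (x, p t)) (at t)"
proof -
  have "((\<lambda>s. f (x, p t + p s)) has_vector_derivative partial2 p f (x, p t)) (at (t - t))"
    using assms by (auto simp: partial2_def vector_derivative_works)
  then have "((\<lambda>s. f (x, p t + p s)) \<circ> (\<lambda>s. s - t) has_vector_derivative
      1 *\<^sub>R partial2 p f (x, p t)) (at t)"
    by (intro vector_diff_chain_at) (auto intro!: derivative_eq_intros)
  moreover have "(\<lambda>s. f (x, p t + p s)) \<circ> (\<lambda>s. s - t) = (\<lambda>s. f (x, p s))"
    by (simp add: fun_eq_iff flip: p_add)
  ultimately show ?thesis by simp
qed

text \<open>A common class in which Green's formula has no boundary terms. It holds the test
  functions of both domains, since on the rectangle both sides of the periodicity conditions vanish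
  and on the cylinder \<open>p 1 = p 0\<close>, and also the eigenfunction, since its frequency is a
  multiple of 2 pi.\<close>

definition periodic_C2 :: "(real \<times> 'b \<Rightarrow> complex) \<Rightarrow> bool"
  where "periodic_C2 f \<longleftrightarrow> C_k p (Suc (Suc 0)) f \<and> (\<forall>y. f (-1, y) = 0 \<and> f (1, y) = 0) \<and>
    (\<forall>x. f (x, p 1) = f (x, p 0) \<and> partial2 p f (x, p 1) = partial2 p f (x, p 0))"

lemma periodic_C2_continuous:
  assumes "periodic_C2 f"
  shows "continuous_on UNIV f" "continuous_on UNIV (partial1 f)" "continuous_on UNIV (partial2 p f)"
    "continuous_on UNIV (partial1 (partial1 f))" "continuous_on UNIV (partial2 p (partial2 p f))"
  using assms by (auto simp: periodic_C2_def)

lemma periodic_C2_partial_diff: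
  assumes "periodic_C2 f" "periodic_C2 g"
  shows "partial1 (\<lambda>z. f z - g z) = (\<lambda>z. partial1 f z - partial1 g z)"
    and "partial2 p (\<lambda>z. f z - g z) = (\<lambda>z. partial2 p f z - partial2 p g z)"
  unfolding partial1_def partial2_def using assms
  by (auto intro!: ext vector_derivative_diff_at simp: periodic_C2_def)

lemma periodic_C2_diff:
  assumes "periodic_C2 f" "periodic_C2 g" shows "periodic_C2 (\<lambda>z. f z - g z)"
  unfolding periodic_C2_def periodic_C2_partial_diff[OF assms]
  using assms by (auto simp: periodic_C2_def simp del: C_k.simps intro: C_k_diff)

end

section \<open>Green's formula and energy estimates\<close>

text \<open>For \<open>\<gamma> > 0\<close> the weight vanishes continuously at \<open>0\<close>, thanks to \<open>0 powr (2 * \<gamma>) = 0\<close>.\<close>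

abbreviation weight :: "real \<Rightarrow> real \<times> 'b \<Rightarrow> real"
  where "weight \<gamma> z \<equiv> \<bar>fst z\<bar> powr (2 * \<gamma>)"

definition grushin_form ::
  "real \<Rightarrow> (real \<Rightarrow> 'b) \<Rightarrow> (real \<times> 'b \<Rightarrow> complex) \<Rightarrow>
   (real \<times> 'b::{topological_space,ab_group_add} \<Rightarrow> complex) \<Rightarrow> complex"
  where "grushin_form \<gamma> p f g = (\<integral>z. partial1 f z * cnj (partial1 g z)
    + of_real (weight \<gamma> z) * (partial2 p f z * cnj (partial2 p g z)) \<partial>vol p)"

definition grushin_energy ::
  "real \<Rightarrow> (real \<Rightarrow> 'b) \<Rightarrow> (real \<times> 'b::{topological_space,ab_group_add} \<Rightarrow> complex) \<Rightarrow> real"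
  where "grushin_energy \<gamma> p f
    = (\<integral>z. (cmod (partial1 f z))\<^sup>2 + weight \<gamma> z * (cmod (partial2 p f z))\<^sup>2 \<partial>vol p)"

locale grushin_homomorphism = real_homomorphism p
  for p :: "real \<Rightarrow> 'b::{topological_space,ab_group_add}" +
  fixes \<gamma> :: real
  assumes gamma_pos: "\<gamma> > 0"
begin

lemma continuous_weight: "continuous_on UNIV (\<lambda>z :: real \<times> 'b. weight \<gamma> z)"
  using gamma_pos by (intro continuous_intros continuous_on_powr') auto

lemma grushin_expr_continuous:
  assumes "periodic_C2 f" shows "continuous_on UNIV (grushin_expr \<gamma> p f)"
proof -
  have "continuous_on UNIV (\<lambda>z. - (partial1 (partial1 f) z
      + of_real (weight \<gamma> z) * partial2 p (partial2 p f) z))"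
    by (intro continuous_intros continuous_weight periodic_C2_continuous assms)
  then show ?thesis by (simp add: grushin_expr_def[abs_def])
qed

lemma grushin_expr_diff:
  assumes "periodic_C2 f" "periodic_C2 g"
  shows "grushin_expr \<gamma> p (\<lambda>z. f z - g z) = (\<lambda>z. grushin_expr \<gamma> p f z - grushin_expr \<gamma> p g z)"
proof -
  have "partial1 (\<lambda>z. partial1 f z - partial1 g z) = (\<lambda>z. partial1 (partial1 f) z - partial1 (partial1 g) z)"
    unfolding partial1_def[of "\<lambda>z. _ z - _ z"] partial1_def[of "partial1 _"]
    using assms by (intro ext vector_derivative_diff_at) (auto simp: periodic_C2_def)
  moreover have "partial2 p (\<lambda>z. partial2 p f z - partial2 p g z)
      = (\<lambda>z. partial2 p (partial2 p f) z - partial2 p (partial2 p g) z)"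
    unfolding partial2_def[of p "\<lambda>z. _ z - _ z"] partial2_def[of p "partial2 p _"]
    using assms by (intro ext vector_derivative_diff_at) (auto simp: periodic_C2_def)
  ultimately show ?thesis
    by (simp add: grushin_expr_def[abs_def] periodic_C2_partial_diff[OF assms] algebra_simps)
qed

lemma grushin_green:
  assumes f: "periodic_C2 f" and g: "periodic_C2 g"
  shows "L2_inner (vol p) f (grushin_expr \<gamma> p g) = grushin_form \<gamma> p f g"
proof -
  note cont = periodic_C2_continuous[OF f] periodic_C2_continuous[OF g] continuous_weight
  have Cf: "C_k p (Suc (Suc 0)) f" and Cg1: "C_k p (Suc 0) (partial1 g)"
    and Cg2: "C_k p (Suc 0) (partial2 p g)"
    using f g by (auto simp: periodic_C2_def)
  \<comment> \<open>\<open>A\<close> is the x_1-derivative of f cnj (partial1 g), and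
    \<open>B\<close> is the weight times an x_2-derivative. The weight depends on x_1 alone, so each
    integrates to zero when its own variable is integrated first.\<close>
  define A where "A z = f z * cnj (partial1 (partial1 g) z) + partial1 f z * cnj (partial1 g z)" for z
  define B where "B z = of_real (weight \<gamma> z) *
      (f z * cnj (partial2 p (partial2 p g) z) + partial2 p f z * cnj (partial2 p g z))" for z
  have Ac: "continuous_on UNIV A" and Bc: "continuous_on UNIV B"
    unfolding A_def B_def by (intro continuous_intros cont)+
  have cnj_deriv: "((\<lambda>x. cnj (F x)) has_vector_derivative cnj F') (at x)"
    if "(F has_vector_derivative F') (at x)" for F F' and x :: real
    using bounded_linear.has_vector_derivative[OF bounded_linear_cnj that] .
  have "integral {-1..1} (\<lambda>x. A (x, p t)) = 0" for t
  proof -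
    have "((\<lambda>x. A (x, p t)) has_integral
        f (1, p t) * cnj (partial1 g (1, p t)) - f (-1, p t) * cnj (partial1 g (-1, p t))) {-1..1}"
    proof (rule fundamental_theorem_of_calculus)
      show "((\<lambda>x. f (x, p t) * cnj (partial1 g (x, p t))) has_vector_derivative A (x, p t))
          (at x within {-1..1})" for x
        unfolding A_def
        by (rule has_vector_derivative_at_within,
            rule has_vector_derivative_mult[OF C_k_partial1[OF Cf] cnj_deriv[OF C_k_partial1[OF Cg1]]])
    qed simp
    then show ?thesis using f by (simp add: periodic_C2_def integral_unique)
  qed
  then have A0: "integral\<^sup>L (vol p) A = 0" by (simp add: vol_integral_iterated(2)[OF Ac])
  have "integral {0..1} (\<lambda>t. B (x, p t)) = 0" for x
  proof -
    have "((\<lambda>t. f (x, p t) * cnj (partial2 p (partial2 p g) (x, p t))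
          + partial2 p f (x, p t) * cnj (partial2 p g (x, p t))) has_integral
        f (x, p 1) * cnj (partial2 p g (x, p 1)) - f (x, p 0) * cnj (partial2 p g (x, p 0))) {0..1}"
    proof (rule fundamental_theorem_of_calculus)
      show "((\<lambda>t. f (x, p t) * cnj (partial2 p g (x, p t))) has_vector_derivative
          f (x, p t) * cnj (partial2 p (partial2 p g) (x, p t))
          + partial2 p f (x, p t) * cnj (partial2 p g (x, p t))) (at t within {0..1})" for t
        by (rule has_vector_derivative_at_within,
            rule has_vector_derivative_mult[OF C_k_partial2[OF Cf] cnj_deriv[OF C_k_partial2[OF Cg2]]])
    qed simp
    then have "((\<lambda>t. f (x, p t) * cnj (partial2 p (partial2 p g) (x, p t))
          + partial2 p f (x, p t) * cnj (partial2 p g (x, p t))) has_integral 0) {0..1}"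
      using f g by (simp add: periodic_C2_def)
    from integral_unique[OF this] show ?thesis by (simp add: B_def)
  qed
  then have B0: "integral\<^sup>L (vol p) B = 0" by (simp add: vol_integral_iterated(1)[OF Bc])
  let ?q = "\<lambda>z. partial1 f z * cnj (partial1 g z)
    + of_real (weight \<gamma> z) * (partial2 p f z * cnj (partial2 p g z))"
  have qc: "continuous_on UNIV ?q" by (intro continuous_intros cont)
  have "f z * cnj (grushin_expr \<gamma> p g z) = ?q z - A z - B z" for z
    by (simp add: grushin_expr_def A_def B_def algebra_simps)
  then have "L2_inner (vol p) f (grushin_expr \<gamma> p g) = (\<integral>z. ?q z - A z - B z \<partial>vol p)"
    by (simp only: L2_inner_def)
  also have "\<dots> = grushin_form \<gamma> p f g"
    using vol_integral(1)[OF qc] vol_integral(1)[OF Ac] vol_integral(1)[OF Bc]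
    by (simp add: A0 B0 grushin_form_def)
  finally show ?thesis .
qed

lemma grushin_form_cnj: "cnj (grushin_form \<gamma> p f g) = grushin_form \<gamma> p g f"
  unfolding grushin_form_def Bochner_Integration.integral_cnj[symmetric] by (simp add: mult.commute)

lemma grushin_green':
  assumes f: "periodic_C2 f" and g: "periodic_C2 g"
  shows "L2_inner (vol p) (grushin_expr \<gamma> p f) g = grushin_form \<gamma> p f g"
  using grushin_green[OF g f] grushin_form_cnj[of g f] L2_inner_cnj[of "vol p" g] by metis

lemma grushin_energy_integrand_continuous:
  assumes "periodic_C2 f"
  shows "continuous_on UNIV
    (\<lambda>z. (cmod (partial1 f z))\<^sup>2 + weight \<gamma> z * (cmod (partial2 p f z))\<^sup>2)"
  by (intro continuous_intros continuous_weight periodic_C2_continuous assms)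

lemma grushin_energy_nonneg: "grushin_energy \<gamma> p f \<ge> 0"
  unfolding grushin_energy_def by (rule Bochner_Integration.integral_nonneg) auto

lemma grushin_form_self: "grushin_form \<gamma> p f f = of_real (grushin_energy \<gamma> p f)"
  unfolding grushin_form_def grushin_energy_def integral_complex_of_real[symmetric]
  by (simp only: of_real_add of_real_mult complex_norm_square)

lemma cmod_grushin_inner:
  assumes "periodic_C2 f"
  shows "cmod (L2_inner (vol p) (grushin_expr \<gamma> p f) f) = grushin_energy \<gamma> p f"
  unfolding grushin_green'[OF assms assms] grushin_form_self
  using grushin_energy_nonneg by simp

lemma grushin_form_le:
  assumes f: "periodic_C2 f" and g: "periodic_C2 g" and t: "t > 0"
  shows "cmod (grushin_form \<gamma> p f g) \<le> (t * grushin_energy \<gamma> p f + grushin_energy \<gamma> p g / t) / 2"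
proof -
  note cont = periodic_C2_continuous[OF f] periodic_C2_continuous[OF g] continuous_weight
  let ?q = "\<lambda>z. partial1 f z * cnj (partial1 g z)
    + of_real (weight \<gamma> z) * (partial2 p f z * cnj (partial2 p g z))"
  let ?e = "\<lambda>f z. (cmod (partial1 f z))\<^sup>2 + weight \<gamma> z * (cmod (partial2 p f z))\<^sup>2"
  have le: "cmod (?q z) \<le> (t * ?e f z + ?e g z / t) / 2" for z
  proof -
    have "cmod (?q z) \<le> cmod (partial1 f z * cnj (partial1 g z))
        + weight \<gamma> z * cmod (partial2 p f z * cnj (partial2 p g z))"
      by (rule order_trans[OF norm_triangle_ineq]) (simp add: norm_mult)
    also have "\<dots> \<le> (t * (cmod (partial1 f z))\<^sup>2 + (cmod (partial1 g z))\<^sup>2 / t) / 2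
        + weight \<gamma> z * ((t * (cmod (partial2 p f z))\<^sup>2 + (cmod (partial2 p g z))\<^sup>2 / t) / 2)"
      by (intro add_mono mult_left_mono young_cmod_le t) auto
    also have "\<dots> = (t * ?e f z + ?e g z / t) / 2" using t by (simp add: field_simps)
    finally show ?thesis .
  qed
  have ef: "integrable (vol p) (?e f)" and eg: "integrable (vol p) (?e g)"
    by (intro vol_integral(1) grushin_energy_integrand_continuous f g)+
  have "cmod (grushin_form \<gamma> p f g) \<le> (\<integral>z. cmod (?q z) \<partial>vol p)"
    unfolding grushin_form_def by (rule integral_norm_bound)
  also have "\<dots> \<le> (\<integral>z. (t * ?e f z + ?e g z / t) / 2 \<partial>vol p)"
  proof (rule integral_mono[OF _ _ le])
    show "integrable (vol p) (\<lambda>z. cmod (?q z))"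
      by (intro vol_integral(1) continuous_intros cont)
    show "integrable (vol p) (\<lambda>z. (t * ?e f z + ?e g z / t) / 2)"
      by (intro vol_integral(1) continuous_intros cont) (use t in auto)
  qed
  also have "\<dots> = (t * grushin_energy \<gamma> p f + grushin_energy \<gamma> p g / t) / 2"
    using ef eg by (simp add: grushin_energy_def)
  finally show ?thesis .
qed

lemma grushin_energy_double:
  assumes f: "periodic_C2 f" and g: "periodic_C2 g"
  shows "grushin_energy \<gamma> p (\<lambda>z. f z - g z)
    \<le> 2 * grushin_energy \<gamma> p f + 2 * grushin_energy \<gamma> p g"
proof -
  let ?e = "\<lambda>f z. (cmod (partial1 f z))\<^sup>2 + weight \<gamma> z * (cmod (partial2 p f z))\<^sup>2"
  have ef: "integrable (vol p) (?e f)" and eg: "integrable (vol p) (?e g)"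
    and efg: "integrable (vol p) (?e (\<lambda>z. f z - g z))"
    by (intro vol_integral(1) grushin_energy_integrand_continuous periodic_C2_diff f g)+
  have le: "?e (\<lambda>z. f z - g z) z \<le> 2 * ?e f z + 2 * ?e g z" for z
  proof -
    have "?e (\<lambda>z. f z - g z) z \<le> (2 * (cmod (partial1 f z))\<^sup>2 + 2 * (cmod (partial1 g z))\<^sup>2)
        + weight \<gamma> z * (2 * (cmod (partial2 p f z))\<^sup>2 + 2 * (cmod (partial2 p g z))\<^sup>2)"
      unfolding periodic_C2_partial_diff[OF f g]
      by (intro add_mono mult_left_mono cmod_diff_square_le) auto
    then show ?thesis by (simp add: algebra_simps)
  qed
  have "grushin_energy \<gamma> p (\<lambda>z. f z - g z) \<le> (\<integral>z. 2 * ?e f z + 2 * ?e g z \<partial>vol p)"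
    unfolding grushin_energy_def
    by (rule integral_mono[OF efg _ le])
      (intro Bochner_Integration.integrable_add integrable_mult_right ef eg)
  also have "\<dots> = 2 * grushin_energy \<gamma> p f + 2 * grushin_energy \<gamma> p g"
    unfolding grushin_energy_def
    unfolding Bochner_Integration.integral_add[OF integrable_mult_right[OF ef] integrable_mult_right[OF eg]]
      integral_mult_right_zero ..
  finally show ?thesis .
qed

end

section \<open>Separated eigenfunctions\<close>

definition tensor :: "(real \<Rightarrow> real) \<Rightarrow> ('b \<Rightarrow> real) \<Rightarrow> real \<times> 'b \<Rightarrow> complex"
  where "tensor a b z = of_real (a (fst z) * b (snd z))"

lemma continuous_tensor:
  fixes b :: "'b::topological_space \<Rightarrow> real"
  assumes "continuous_on UNIV a" "continuous_on UNIV b"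
  shows "continuous_on UNIV (tensor a b)"
  unfolding tensor_def
  by (intro continuous_intros continuous_on_compose2[OF assms(1)] continuous_on_compose2[OF assms(2)]) auto

lemma tensor_derivative1:
  assumes "(a has_real_derivative a') (at x)"
  shows "((\<lambda>t. tensor a b (t, y)) has_vector_derivative of_real (a' * b y)) (at x)"
  unfolding tensor_def fst_conv snd_conv
  by (intro has_vector_derivative_of_real DERIV_cmult_right assms)

lemma tensor_derivative2:
  assumes "((\<lambda>t. b (y + p t)) has_real_derivative b') (at 0)"
  shows "((\<lambda>t. tensor a b (x, y + p t)) has_vector_derivative of_real (a x * b')) (at 0)"
  unfolding tensor_def fst_conv snd_conv
  by (intro has_vector_derivative_of_real DERIV_cmult assms)

lemma partial1_tensor:
  assumes "\<And>x. (a has_real_derivative a' x) (at x)"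
  shows "partial1 (tensor a b) = tensor a' b"
proof
  fix z :: "real \<times> 'a"
  show "partial1 (tensor a b) z = tensor a' b z"
    unfolding partial1_def using vector_derivative_at[OF tensor_derivative1[OF assms]]
    by (simp add: tensor_def)
qed

lemma partial2_tensor:
  assumes "\<And>y. ((\<lambda>t. b (y + p t)) has_real_derivative b' y) (at 0)"
  shows "partial2 p (tensor a b) = tensor a b'"
proof
  fix z :: "real \<times> 'a"
  show "partial2 p (tensor a b) z = tensor a b' z"
    unfolding partial2_def using vector_derivative_at[OF tensor_derivative2[OF assms]]
    by (simp add: tensor_def)
qed

text \<open>The cap n lets the lemma serve both the eigenfunction, with n = 2, and the test
  functions, with every n.\<close>

lemma C_k_tensor:
  fixes b :: "nat \<Rightarrow> 'b::{topological_space,ab_group_add} \<Rightarrow> real"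
  assumes a: "\<And>i. i \<le> n \<Longrightarrow> continuous_on UNIV (a i)"
      "\<And>i x. i < n \<Longrightarrow> (a i has_real_derivative a (Suc i) x) (at x)"
    and b: "\<And>j. j \<le> n \<Longrightarrow> continuous_on UNIV (b j)"
      "\<And>j y. j < n \<Longrightarrow> ((\<lambda>t. b j (y + p t)) has_real_derivative b (Suc j) y) (at 0)"
  shows "i + k \<le> n \<Longrightarrow> j + k \<le> n \<Longrightarrow> C_k p k (tensor (a i) (b j))"
proof (induction k arbitrary: i j)
  case 0
  then show ?case using a b by (simp add: continuous_tensor)
next
  case (Suc k)
  have "partial1 (tensor (a i) (b j)) = tensor (a (Suc i)) (b j)"
    by (rule partial1_tensor) (use a Suc.prems in auto)
  moreover have "partial2 p (tensor (a i) (b j)) = tensor (a i) (b (Suc j))"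
    by (rule partial2_tensor) (use b Suc.prems in auto)
  moreover have "(\<lambda>t. tensor (a i) (b j) (t, y)) differentiable (at x)" for x y
    by (rule differentiableI_vector[OF tensor_derivative1[OF a(2)]]) (use Suc.prems in simp)
  moreover have "(\<lambda>t. tensor (a i) (b j) (x, y + p t)) differentiable (at 0)" for x y
    by (rule differentiableI_vector[OF tensor_derivative2[OF b(2)]]) (use Suc.prems in simp)
  ultimately show ?case
    using Suc a b by (auto simp: continuous_tensor)
qed

lemma cmod_tensor_diff: "cmod (tensor a b z - tensor a' b' z)
    = \<bar>a (fst z) * b (snd z) - a' (fst z) * b' (snd z)\<bar>"
  unfolding tensor_def of_real_diff[symmetric] norm_of_real ..

lemma test_functions_diff:
  assumes "f \<in> test_functions p M" "g \<in> test_functions p M"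
  shows "(\<lambda>z. f z - g z) \<in> test_functions p M"
proof -
  have sub: "closure {z. f z - g z \<noteq> 0} \<subseteq> closure {z. f z \<noteq> 0} \<union> closure {z. g z \<noteq> 0}"
    unfolding closure_Un[symmetric] by (rule closure_mono) auto
  \<comment> \<open>Compactness is obtained as closed meets compact, which is valid without a
    separation axiom on \<open>'b\<close>.\<close>
  have "compact (closure {z. f z - g z \<noteq> 0} \<inter> (closure {z. f z \<noteq> 0} \<union> closure {z. g z \<noteq> 0}))"
    using assms by (intro closed_Int_compact compact_Un) (auto simp: test_functions_def)
  then have "compact (closure {z. f z - g z \<noteq> 0})" using sub by (simp add: Int_absorb2)
  then show ?thesis using sub assms by (auto simp: test_functions_def intro!: C_k_diff)
qed

context real_homomorphism
begin

lemma vol_integral_tensor_square: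
  assumes "continuous_on UNIV a" "continuous_on UNIV b"
  shows "(\<integral>z. (cmod (tensor a b z))\<^sup>2 \<partial>vol p)
    = integral {-1..1} (\<lambda>x. (a x)\<^sup>2) * integral {0..1} (\<lambda>t. (b (p t))\<^sup>2)"
proof -
  have "continuous_on UNIV (\<lambda>z. (cmod (tensor a b z))\<^sup>2)"
    by (intro continuous_intros continuous_tensor assms)
  from vol_integral_iterated(1)[OF this] show ?thesis
    by (simp add: tensor_def norm_mult power_mult_distrib)
qed

text \<open>The factor \<open>w\<close> covers the three limits of the approximation: w = 1 for the
  L^2 norm and the x_1-derivative, the Grushin weight for the x_2-derivative.\<close>

lemma tensor_dominated_convergence:
  fixes a :: "nat \<Rightarrow> real \<Rightarrow> real" and b :: "nat \<Rightarrow> 'b \<Rightarrow> real"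
  assumes cont: "\<And>n. continuous_on UNIV (a n)" "\<And>n. continuous_on UNIV (b n)"
      "continuous_on UNIV a'" "continuous_on UNIV b'"
    and a: "\<And>x. -1 < x \<Longrightarrow> x < 1 \<Longrightarrow> (\<lambda>n. a n x) \<longlonglongrightarrow> a' x"
      "\<And>n x. -1 < x \<Longrightarrow> x < 1 \<Longrightarrow> \<bar>a n x\<bar> \<le> C"
    and b: "\<And>t. 0 < t \<Longrightarrow> t < 1 \<Longrightarrow> (\<lambda>n. b n (p t)) \<longlonglongrightarrow> b' (p t)"
      "\<And>n t. 0 < t \<Longrightarrow> t < 1 \<Longrightarrow> \<bar>b n (p t)\<bar> \<le> C'"
    and w: "continuous_on UNIV w" "\<And>x y. -1 < x \<Longrightarrow> x < 1 \<Longrightarrow> \<bar>w (x, y)\<bar> \<le> 1"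
  shows "(\<lambda>n. \<integral>z. w z * (cmod (tensor (a n) (b n) z - tensor a' b' z))\<^sup>2 \<partial>vol p) \<longlonglongrightarrow> 0"
proof (rule vol_dominated_convergence)
  show "continuous_on UNIV (\<lambda>z. w z * (cmod (tensor (a n) (b n) z - tensor a' b' z))\<^sup>2)" for n
    by (intro continuous_intros continuous_tensor cont w)
  fix x t :: real assume x: "- 1 < x" "x < 1" and t: "0 < t" "t < 1"
  have "(\<lambda>n. w (x, p t) * (cmod (tensor (a n) (b n) (x, p t) - tensor a' b' (x, p t)))\<^sup>2) \<longlonglongrightarrow>
      w (x, p t) * \<bar>a' x * b' (p t) - a' x * b' (p t)\<bar>\<^sup>2"
    unfolding cmod_tensor_diff fst_conv snd_conv by (intro tendsto_intros a(1) b(1) x t)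
  then show "(\<lambda>n. w (x, p t) * (cmod (tensor (a n) (b n) (x, p t) - tensor a' b' (x, p t)))\<^sup>2) \<longlonglongrightarrow> 0"
    by simp
  fix n
  have "\<bar>a' x\<bar> \<le> C"
    by (rule Lim_bounded[OF tendsto_rabs[OF a(1)[OF x]]]) (use a(2)[OF x] in auto)
  moreover have "\<bar>b' (p t)\<bar> \<le> C'"
    by (rule Lim_bounded[OF tendsto_rabs[OF b(1)[OF t]]]) (use b(2)[OF t] in auto)
  ultimately have "\<bar>a n x\<bar> * \<bar>b n (p t)\<bar> + \<bar>a' x\<bar> * \<bar>b' (p t)\<bar> \<le> C * C' + C * C'"
    using a(2)[OF x, of n] b(2)[OF t, of n] by (intro add_mono mult_mono) auto
  then have "\<bar>a n x * b n (p t) - a' x * b' (p t)\<bar> \<le> 2 * (C * C')"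
    using abs_triangle_ineq4[of "a n x * b n (p t)" "a' x * b' (p t)"] by (simp add: abs_mult)
  then have "\<bar>a n x * b n (p t) - a' x * b' (p t)\<bar>\<^sup>2 \<le> (2 * (C * C'))\<^sup>2"
    by (intro power_mono) auto
  then have "\<bar>w (x, p t)\<bar> * \<bar>a n x * b n (p t) - a' x * b' (p t)\<bar>\<^sup>2 \<le> 1 * (2 * (C * C'))\<^sup>2"
    by (intro mult_mono w x) auto
  then show "\<bar>w (x, p t) * (cmod (tensor (a n) (b n) (x, p t) - tensor a' b' (x, p t)))\<^sup>2\<bar>
      \<le> (2 * (C * C'))\<^sup>2"
    unfolding cmod_tensor_diff fst_conv snd_conv by (simp add: abs_mult)
qed

end

section \<open>Domains treated uniformly and their eigenpairs\<close>

text \<open>\<open>B i\<close> is the \<open>i\<close>-th derivative of \<open>t \<mapsto> sin (\<kappa> t)\<close>, transported along \<open>p\<close>.\<close>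

definition sine_lift ::
  "(real \<Rightarrow> 'b::{topological_space,ab_group_add}) \<Rightarrow> real \<Rightarrow> (nat \<Rightarrow> 'b \<Rightarrow> real) \<Rightarrow> bool"
  where "sine_lift p \<kappa> B \<longleftrightarrow>
    (\<forall>i. continuous_on UNIV (B i)) \<and>
    (\<forall>i y. ((\<lambda>t. B i (y + p t)) has_real_derivative B (Suc i) y) (at 0)) \<and>
    (\<forall>t. B 0 (p t) = sin (\<kappa> * t)) \<and> (\<forall>t. B (Suc 0) (p t) = \<kappa> * cos (\<kappa> * t)) \<and>
    (\<forall>y. B (Suc (Suc 0)) y = - \<kappa>\<^sup>2 * B 0 y)"

text \<open>The x_2-factors of the approximating test functions. Convergence is required for i < 2,
  the orders that enter the form. Closedness of \<open>K\<close> stands beside compactness because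
  \<open>'b\<close> carries no separation axiom.\<close>

definition test_approximation ::
  "(real \<Rightarrow> 'b::{topological_space,ab_group_add}) \<Rightarrow> (real \<times> 'b) set \<Rightarrow> (nat \<Rightarrow> 'b \<Rightarrow> real) \<Rightarrow>
   (nat \<Rightarrow> nat \<Rightarrow> 'b \<Rightarrow> real) \<Rightarrow> bool"
  where "test_approximation p M B b \<longleftrightarrow>
    (\<forall>n i. continuous_on UNIV (b n i)) \<and>
    (\<forall>n i y. ((\<lambda>t. b n i (y + p t)) has_real_derivative b n (Suc i) y) (at 0)) \<and>
    (\<forall>n. \<exists>K. compact K \<and> closed K \<and> (\<forall>y. y \<notin> K \<longrightarrow> b n 0 y = 0) \<and> {-1<..<1} \<times> K \<subseteq> interior M) \<and>
    (\<forall>i<2. \<forall>t. 0 < t \<and> t < 1 \<longrightarrow> (\<lambda>n. b n i (p t)) \<longlonglongrightarrow> B i (p t)) \<and>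
    (\<exists>C. \<forall>i<2. \<forall>n t. 0 < t \<and> t < 1 \<longrightarrow> \<bar>b n i (p t)\<bar> \<le> C)"

text \<open>The first two assumptions isolate what must be proved separately for rectangle and
  cylinder: test functions produce no boundary terms, and the sine is a limit of admissible
  factors.\<close>

locale grushin_domain = grushin_homomorphism p \<gamma>
  for p :: "real \<Rightarrow> 'b::{topological_space,ab_group_add}" and \<gamma> :: real +
  fixes M :: "(real \<times> 'b) set"
  assumes test_periodic: "f \<in> test_functions p M \<Longrightarrow> periodic_C2 f"
    and sine_approximable: "sin \<kappa> = 0 \<Longrightarrow> cos \<kappa> = 1 \<Longrightarrow>
      \<exists>B b. sine_lift p \<kappa> B \<and> test_approximation p M B b"
    and compact_M: "compact M" and closed_M: "closed M"
    and M_bounds: "z \<in> M \<Longrightarrow> \<bar>fst z\<bar> \<le> 1"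
begin

text \<open>The pointwise equation is asked for |x| \<le> 1 only, where \<open>vol p\<close> lives;
  outside, the cut-off potential of the ground state differs from the Grushin weight.\<close>

lemma grushin_weak_eigenfunction:
  assumes \<phi>: "periodic_C2 \<phi>"
    and eigen: "\<And>x t. \<bar>x\<bar> \<le> 1 \<Longrightarrow> grushin_expr \<gamma> p \<phi> (x, p t) = of_real l * \<phi> (x, p t)"
    and us: "\<And>n. us n \<in> test_functions p M"
    and lim: "(\<lambda>n. L2_norm (vol p) (\<lambda>z. us n z - \<phi> z)) \<longlonglongrightarrow> 0"
    and energy: "(\<lambda>n. grushin_energy \<gamma> p (\<lambda>z. us n z - \<phi> z)) \<longlonglongrightarrow> 0"
  shows "grushin \<gamma> p M \<phi> (\<lambda>z. of_real l * \<phi> z)"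
  unfolding grushin_def
proof (rule friedrichs_weak_eigenfunction)
  let ?D = "test_functions p M" and ?S = "grushin_expr \<gamma> p"
  note per = test_periodic
  show "u \<in> L2 (vol p)" if "u \<in> ?D" for u
    by (intro continuous_in_L2 periodic_C2_continuous per that)
  then have D_L2: "u \<in> L2 (vol p)" if "u \<in> ?D" for u using that .
  show S_L2: "?S u \<in> L2 (vol p)" if "u \<in> ?D" for u
    by (intro continuous_in_L2 grushin_expr_continuous per that)
  show "(\<lambda>x. u x - w x) \<in> ?D" if "u \<in> ?D" "w \<in> ?D" for u w
    using that by (rule test_functions_diff)
  show "L2_inner (vol p) (?S (\<lambda>x. u x - w x)) g = L2_inner (vol p) (?S u) g - L2_inner (vol p) (?S w) g"
    if "u \<in> ?D" "w \<in> ?D" "g \<in> ?D" for u w g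
    unfolding grushin_expr_diff[OF per[OF that(1)] per[OF that(2)]]
    by (intro L2_inner_diff_left S_L2 D_L2 that)
  show "L2_inner (vol p) (?S u) w = L2_inner (vol p) u (?S w)" if "u \<in> ?D" "w \<in> ?D" for u w
    using that by (simp add: grushin_green grushin_green' per)
  show "cmod (L2_inner (vol p) (?S u) w)
      \<le> (t * cmod (L2_inner (vol p) (?S u) u) + cmod (L2_inner (vol p) (?S w) w) / t) / 2"
    if "u \<in> ?D" "w \<in> ?D" "t > 0" for u w and t :: real
    using grushin_form_le[OF per[OF that(1)] per[OF that(2)] that(3)] that
    by (simp add: cmod_grushin_inner per grushin_green'[of u w])
  show "cmod (L2_inner (vol p) (?S u) u)
      \<le> 2 * cmod (L2_inner (vol p) (?S (\<lambda>x. u x - w x)) (\<lambda>x. u x - w x))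
        + 2 * cmod (L2_inner (vol p) (?S w) w)" if u: "u \<in> ?D" and w: "w \<in> ?D" for u w
  proof -
    \<comment> \<open>The energy inequality is available for differences, so u is written as (u - w)
      - (0 - w); this calls for the zero function in the class.\<close>
    have "periodic_C2 (\<lambda>z. w z - w z)" by (intro periodic_C2_diff per w)
    then have zero: "periodic_C2 (\<lambda>z. 0)" by simp
    have "grushin_energy \<gamma> p (\<lambda>z. (u z - w z) - (0 - w z))
        \<le> 2 * grushin_energy \<gamma> p (\<lambda>z. u z - w z) + 2 * grushin_energy \<gamma> p (\<lambda>z. 0 - w z)"
      by (intro grushin_energy_double periodic_C2_diff per u w zero)
    moreover have "grushin_energy \<gamma> p (\<lambda>z. 0 - w z) = grushin_energy \<gamma> p w"
    proof -
      have "partial1 (\<lambda>z :: real \<times> 'b. 0) = (\<lambda>z. 0)" "partial2 p (\<lambda>z :: real \<times> 'b. 0) = (\<lambda>z. 0)"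
        by (auto simp: partial1_def partial2_def)
      then show ?thesis
        unfolding grushin_energy_def periodic_C2_partial_diff[OF zero per[OF w]] by simp
    qed
    ultimately show ?thesis
      by (simp add: cmod_grushin_inner per u w periodic_C2_diff)
  qed
  show "L2_inner (vol p) \<phi> (?S w) = of_real l * L2_inner (vol p) \<phi> w" if w: "w \<in> ?D" for w
  proof -
    have cw: "continuous_on UNIV w" by (intro periodic_C2_continuous per w)
    have c\<phi>: "continuous_on UNIV \<phi>" by (intro periodic_C2_continuous \<phi>)
    have "L2_inner (vol p) \<phi> (?S w) = L2_inner (vol p) (?S \<phi>) w"
      using w by (simp add: grushin_green grushin_green' per \<phi>)
    also have "\<dots> = integral {-1..1} (\<lambda>x. integral {0..1} (\<lambda>t. ?S \<phi> (x, p t) * cnj (w (x, p t))))"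
      unfolding L2_inner_def
      by (intro vol_integral_iterated continuous_intros grushin_expr_continuous \<phi> cw)
    also have "\<dots> = integral {-1..1}
        (\<lambda>x. integral {0..1} (\<lambda>t. of_real l * \<phi> (x, p t) * cnj (w (x, p t))))"
      by (intro Henstock_Kurzweil_Integration.integral_cong, subst eigen) auto
    also have "\<dots> = (\<integral>z. of_real l * \<phi> z * cnj (w z) \<partial>vol p)"
      by (intro vol_integral_iterated[symmetric] continuous_intros c\<phi> cw)
    also have "\<dots> = of_real l * L2_inner (vol p) \<phi> w"
      using L2_inner_scale_left[of "vol p" "of_real l" \<phi> w] by (simp add: L2_inner_def)
    finally show ?thesis .
  qed
  show "form_approx (vol p) ?D ?S us \<phi>"
    unfolding form_approx_def
  proof (intro conjI allI impI us lim)
    show "\<phi> \<in> L2 (vol p)" by (intro continuous_in_L2 periodic_C2_continuous \<phi>)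
    fix e :: real assume e: "e > 0"
    have "\<forall>\<^sub>F n in sequentially. grushin_energy \<gamma> p (\<lambda>z. us n z - \<phi> z) < e / 4"
      by (rule order_tendstoD[OF energy]) (use e in simp)
    then obtain K where K: "\<And>n. n \<ge> K \<Longrightarrow> grushin_energy \<gamma> p (\<lambda>z. us n z - \<phi> z) < e / 4"
      by (auto simp: eventually_sequentially)
    have "cmod (L2_inner (vol p) (?S (\<lambda>x. us m x - us n x)) (\<lambda>x. us m x - us n x)) < e"
      if "m \<ge> K" "n \<ge> K" for m n
    proof -
      have "cmod (L2_inner (vol p) (?S (\<lambda>x. us m x - us n x)) (\<lambda>x. us m x - us n x))
          = grushin_energy \<gamma> p (\<lambda>x. (us m x - \<phi> x) - (us n x - \<phi> x))"
        by (simp add: cmod_grushin_inner periodic_C2_diff per us)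
      also have "\<dots> \<le> 2 * grushin_energy \<gamma> p (\<lambda>x. us m x - \<phi> x)
          + 2 * grushin_energy \<gamma> p (\<lambda>x. us n x - \<phi> x)"
        by (intro grushin_energy_double periodic_C2_diff per us \<phi>)
      also have "\<dots> < e" using K[OF that(1)] K[OF that(2)] by simp
      finally show ?thesis .
    qed
    then show "\<exists>K. \<forall>m\<ge>K. \<forall>n\<ge>K.
        cmod (L2_inner (vol p) (?S (\<lambda>x. us m x - us n x)) (\<lambda>x. us m x - us n x)) < e"
      by blast
  qed
qed

lemma tensor_test_function:
  assumes a: "\<And>i x. (a i has_real_derivative a (Suc i) x) (at x)"
    and b: "\<And>j. continuous_on UNIV (b j)"
      "\<And>j y. ((\<lambda>t. b j (y + p t)) has_real_derivative b (Suc j) y) (at 0)"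
    and a0: "\<And>x. x \<notin> {-1 + e..1 - e} \<Longrightarrow> a 0 x = 0" and e: "e > 0"
    and K: "compact K" "closed K" "\<And>y. y \<notin> K \<Longrightarrow> b 0 y = 0" "{-1<..<1} \<times> K \<subseteq> interior M"
  shows "tensor (a 0) (b 0) \<in> test_functions p M"
proof -
  have ac: "continuous_on UNIV (a i)" for i
    by (rule DERIV_continuous_on) (rule has_field_derivative_at_within[OF a])
  have "C_k p k (tensor (a 0) (b 0))" for k
    by (rule C_k_tensor[where n = k]) (use a b ac in auto)
  moreover have "{z. tensor (a 0) (b 0) z \<noteq> 0} \<subseteq> {-1 + e..1 - e} \<times> K"
  proof
    fix z assume "z \<in> {z. tensor (a 0) (b 0) z \<noteq> 0}"
    then have "a 0 (fst z) \<noteq> 0" "b 0 (snd z) \<noteq> 0" by (auto simp: tensor_def)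
    then show "z \<in> {-1 + e..1 - e} \<times> K" unfolding mem_Times_iff using a0 K(3) by blast
  qed
  then have sub: "closure {z. tensor (a 0) (b 0) z \<noteq> 0} \<subseteq> {-1 + e..1 - e} \<times> K"
    by (rule closure_minimal) (intro closed_Times K closed_atLeastAtMost)
  moreover have "compact (closure {z. tensor (a 0) (b 0) z \<noteq> 0} \<inter> ({-1 + e..1 - e} \<times> K))"
    by (intro closed_Int_compact compact_Times K compact_Icc closed_closure)
  moreover have "{-1 + e..1 - e} \<times> K \<subseteq> {-1<..<1} \<times> K" using e by auto
  ultimately show ?thesis
    using K(4) by (auto simp: test_functions_def Int_absorb2)
qed

lemma ground_state_eigenpair:
  assumes g: "ground_state \<gamma> \<kappa> l v v'" and \<kappa>: "sin \<kappa> = 0" "cos \<kappa> = 1" "\<kappa> \<noteq> 0"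
    and B: "sine_lift p \<kappa> B" and b: "test_approximation p M B b"
  shows "eigenpair (vol p) (grushin \<gamma> p M) l (tensor v (B 0))"
proof -
  define q where "q x = \<kappa>\<^sup>2 * min 1 \<bar>x\<bar> powr (2 * \<gamma>) - l" for x :: real
  have v: "\<And>x. (v has_real_derivative v' x) (at x)" "\<And>x. (v' has_real_derivative q x * v x) (at x)"
    and ev: "\<And>x. v (- x) = v x" and pos: "\<And>x. \<bar>x\<bar> < 1 \<Longrightarrow> 0 < v x" and v1: "v 1 = 0"
    using g by (auto simp: ground_state_def q_def)
  have vc: "continuous_on X v" "continuous_on X v'" for X
    by (rule DERIV_continuous_on, rule has_field_derivative_at_within[OF v(1)])
      (rule DERIV_continuous_on, rule has_field_derivative_at_within[OF v(2)])
  have qc: "continuous_on UNIV q"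
    unfolding q_def using gamma_pos by (intro continuous_intros continuous_on_powr') auto
  have Bc: "\<And>i. continuous_on UNIV (B i)"
    and Bd: "\<And>i y. ((\<lambda>t. B i (y + p t)) has_real_derivative B (Suc i) y) (at 0)"
    and B0: "\<And>t. B 0 (p t) = sin (\<kappa> * t)" and B1: "\<And>t. B (Suc 0) (p t) = \<kappa> * cos (\<kappa> * t)"
    and B2: "\<And>y. B (Suc (Suc 0)) y = - \<kappa>\<^sup>2 * B 0 y"
    using B unfolding sine_lift_def by blast+
  have bc: "\<And>n i. continuous_on UNIV (b n i)"
    and bd: "\<And>n i y. ((\<lambda>t. b n i (y + p t)) has_real_derivative b n (Suc i) y) (at 0)"
    and bK: "\<And>n. \<exists>K. compact K \<and> closed K \<and> (\<forall>y. y \<notin> K \<longrightarrow> b n 0 y = 0) \<and>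
      {-1<..<1} \<times> K \<subseteq> interior M"
    and blim: "\<And>i t. i < 2 \<Longrightarrow> 0 < t \<Longrightarrow> t < 1 \<Longrightarrow> (\<lambda>n. b n i (p t)) \<longlonglongrightarrow> B i (p t)"
    and "\<exists>C. \<forall>i<2. \<forall>n t. 0 < t \<and> t < 1 \<longrightarrow> \<bar>b n i (p t)\<bar> \<le> C"
    using b unfolding test_approximation_def by blast+
  then obtain Cb where Cb: "\<And>i n t. i < 2 \<Longrightarrow> 0 < t \<Longrightarrow> t < 1 \<Longrightarrow> \<bar>b n i (p t)\<bar> \<le> Cb"
    by blast
  let ?\<phi> = "tensor v (B 0)"
  have p1: "partial1 ?\<phi> = tensor v' (B 0)" "partial1 (tensor v' (B 0)) = tensor (\<lambda>x. q x * v x) (B 0)"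
    by (intro partial1_tensor v)+
  have p2: "partial2 p (tensor a (B i)) = tensor a (B (Suc i))" for a i
    by (intro partial2_tensor Bd)
  \<comment> \<open>The sequence v, v', q v is continued constantly; the derivative relation holds
    for i < 2.\<close>
  define F where "F i = (if i = 0 then v else if i = Suc 0 then v' else (\<lambda>x. q x * v x))" for i :: nat
  have Fc: "continuous_on UNIV (F i)" for i
    using vc qc by (auto simp: F_def intro!: continuous_intros)
  have Fd: "(F i has_real_derivative F (Suc i) x) (at x)" if "i < 2" for i x
    using v that by (auto simp: F_def less_2_cases_iff)
  have "C_k p (Suc (Suc 0)) (tensor (F 0) (B 0))"
    by (rule C_k_tensor[where n = 2]) (use Fc Fd Bc Bd in auto)
  then have "C_k p (Suc (Suc 0)) ?\<phi>" by (simp add: F_def del: C_k.simps)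
  then have \<phi>: "periodic_C2 ?\<phi>"
    unfolding periodic_C2_def p2 using v1 ev[of 1] \<kappa>(1,2) B0[of 0] B0[of 1] B1[of 0] B1[of 1]
    by (auto simp: tensor_def simp del: C_k.simps)
  have eigen: "grushin_expr \<gamma> p ?\<phi> (x, p t) = of_real l * ?\<phi> (x, p t)" if "\<bar>x\<bar> \<le> 1" for x t
    unfolding grushin_expr_def p1 p2 using that
    by (simp add: tensor_def q_def B2 algebra_simps)
  obtain a a' C where a: "\<And>n. smooth (a n)" "\<And>n x. (a n has_real_derivative a' n x) (at x)"
    "\<And>n x. x \<notin> {-1 + 1 / Suc n..1 - 1 / Suc n} \<Longrightarrow> a n x = 0"
    "\<And>x. -1 < x \<Longrightarrow> x < 1 \<Longrightarrow> (\<lambda>n. a n x) \<longlonglongrightarrow> v x"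
    "\<And>x. -1 < x \<Longrightarrow> x < 1 \<Longrightarrow> (\<lambda>n. a' n x) \<longlonglongrightarrow> v' x"
    "\<And>n x. -1 \<le> x \<Longrightarrow> x \<le> 1 \<Longrightarrow> \<bar>a n x\<bar> \<le> C"
    "\<And>n x. -1 \<le> x \<Longrightarrow> x \<le> 1 \<Longrightarrow> \<bar>a' n x\<bar> \<le> C"
    using compactly_supported_approximation[of "-1" 1 v v'] v(1) vc(2) v1 ev[of 1] by auto
  have "\<exists>A. A 0 = a n \<and> (\<forall>i x. (A i has_real_derivative A (Suc i) x) (at x))" for n
    using smooth_derivatives[OF a(1)] by metis
  then obtain A where A: "\<And>n. A n 0 = a n" "\<And>n i x. (A n i has_real_derivative A n (Suc i) x) (at x)"
    by metis
  \<comment> \<open>Identifying \<open>a' n\<close> with a term of the derivative sequence supplies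
    its continuity.\<close>
  have a'_eq: "a' n = A n (Suc 0)" for n
    using DERIV_unique[OF a(2)] A(2)[of n 0] unfolding A(1) by blast
  have Ac: "continuous_on UNIV (A n i)" for n i
    by (rule DERIV_continuous_on) (rule has_field_derivative_at_within[OF A(2)])
  have ac: "continuous_on UNIV (a n)" "continuous_on UNIV (a' n)" for n
    using Ac[of n 0] Ac[of n 1] by (auto simp: A a'_eq)
  define us where "us n = tensor (a n) (b n 0)" for n
  have us: "us n \<in> test_functions p M" for n
  proof -
    obtain K where K: "compact K" "closed K" "\<And>y. y \<notin> K \<Longrightarrow> b n 0 y = 0" "{-1<..<1} \<times> K \<subseteq> interior M"
      using bK by blast
    show ?thesis
      unfolding us_def A(1)[symmetric]
      by (rule tensor_test_function[where e = "1 / Suc n" and K = K])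
        (use A a(3) bc bd K in auto)
  qed
  have us1: "partial1 (us n) = tensor (a' n) (b n 0)" for n
    unfolding us_def by (intro partial1_tensor a)
  have us2: "partial2 p (us n) = tensor (a n) (b n (Suc 0))" for n
    unfolding us_def by (intro partial2_tensor bd)
  have "grushin \<gamma> p M ?\<phi> (\<lambda>z. of_real l * ?\<phi> z)"
  proof (rule grushin_weak_eigenfunction[OF \<phi> eigen us])
    have "(\<lambda>n. \<integral>z. 1 * (cmod (us n z - ?\<phi> z))\<^sup>2 \<partial>vol p) \<longlonglongrightarrow> 0"
      unfolding us_def
      by (rule tensor_dominated_convergence[where C = C and C' = Cb])
        (use ac bc vc Bc a(4,6) blim Cb in auto)
    from tendsto_real_sqrt[OF this]
    show "(\<lambda>n. L2_norm (vol p) (\<lambda>z. us n z - ?\<phi> z)) \<longlonglongrightarrow> 0"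
      unfolding L2_norm_eq by simp
    have 1: "(\<lambda>n. \<integral>z. 1 * (cmod (tensor (a' n) (b n 0) z - tensor v' (B 0) z))\<^sup>2 \<partial>vol p) \<longlonglongrightarrow> 0"
      by (rule tensor_dominated_convergence[where C = C and C' = Cb])
        (use ac bc vc Bc a(5,7) blim Cb in auto)
    have 2: "(\<lambda>n. \<integral>z. weight \<gamma> z * (cmod (tensor (a n) (b n (Suc 0)) z - tensor v (B (Suc 0)) z))\<^sup>2
        \<partial>vol p) \<longlonglongrightarrow> 0"
    proof (rule tensor_dominated_convergence[where C = C and C' = Cb])
      show "\<bar>weight \<gamma> (x, y)\<bar> \<le> 1" if "-1 < x" "x < 1" for x and y :: 'b
        using that gamma_pos powr_mono2[of "2 * \<gamma>" "\<bar>x\<bar>" 1] by simp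
    qed (use ac bc vc Bc a(4,6) blim Cb continuous_weight in auto)
    have "grushin_energy \<gamma> p (\<lambda>z. us n z - ?\<phi> z)
        = (\<integral>z. 1 * (cmod (tensor (a' n) (b n 0) z - tensor v' (B 0) z))\<^sup>2 \<partial>vol p)
        + (\<integral>z. weight \<gamma> z * (cmod (tensor (a n) (b n (Suc 0)) z - tensor v (B (Suc 0)) z))\<^sup>2 \<partial>vol p)" for n
      unfolding grushin_energy_def periodic_C2_partial_diff[OF test_periodic[OF us] \<phi>] us1 us2 p1 p2 mult_1
      by (intro Bochner_Integration.integral_add vol_integral continuous_intros continuous_tensor
          continuous_weight ac bc vc Bc)
    with tendsto_add[OF 1 2] show "(\<lambda>n. grushin_energy \<gamma> p (\<lambda>z. us n z - ?\<phi> z)) \<longlonglongrightarrow> 0"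
      by simp
  qed auto
  moreover have "?\<phi> \<in> L2 (vol p)" by (intro continuous_in_L2 periodic_C2_continuous \<phi>)
  moreover have "L2_norm (vol p) ?\<phi> \<noteq> 0"
  proof -
    have "integral {-1..1} (\<lambda>x. (v x)\<^sup>2) \<noteq> 0"
      using integral_eq_0_iff[of "-1" 1 "\<lambda>x. (v x)\<^sup>2"] pos[of 0] vc
      by (force intro!: continuous_intros)
    moreover have "integral {0..1} (\<lambda>t. (B 0 (p t))\<^sup>2) \<noteq> 0"
    proof -
      \<comment> \<open>A point with 0 < |\<kappa> t| < 1 < pi, where the sine is nonzero.\<close>
      define t where "t = 1 / (2 * \<bar>\<kappa>\<bar> + 2)"
      have t: "0 < t" "t \<le> 1" "\<bar>\<kappa> * t\<bar> < 1"
        by (auto simp: t_def abs_mult field_simps)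
      have "sin \<bar>\<kappa> * t\<bar> > 0" using t \<kappa>(3) pi_gt3 by (intro sin_gt_zero) auto
      then have "sin (\<kappa> * t) \<noteq> 0" by (cases "\<kappa> * t \<ge> 0") auto
      then show ?thesis
        unfolding B0 using integral_eq_0_iff[of 0 1 "\<lambda>t. (sin (\<kappa> * t))\<^sup>2"] t
        by (force intro!: continuous_intros)
    qed
    ultimately show ?thesis
      unfolding L2_norm_eq vol_integral_tensor_square[OF vc(1) Bc] by simp
  qed
  ultimately show ?thesis unfolding eigenpair_def by blast
qed

theorem grushin_concentration:
  assumes \<omega>: "openin (top_of_set M) \<omega>" and disj: "closure \<omega> \<inter> {z. fst z = 0} = {}"
  shows "\<exists>C>0. \<exists>c0>0. \<exists>(l :: nat \<Rightarrow> real) \<phi>.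
    (\<forall>j. eigenpair (vol p) (grushin \<gamma> p M) (l j) (\<phi> j)) \<and>
    filterlim l at_top sequentially \<and>
    (\<forall>j. L2_norm_on (vol p) \<omega> (\<phi> j)
      \<le> C * exp (- c0 * l j powr ((\<gamma> + 1) / 2)) * L2_norm (vol p) (\<phi> j))"
proof -
  have \<omega>M: "\<omega> \<subseteq> M" using openin_imp_subset[OF \<omega>] .
  have "closure \<omega> \<subseteq> M" by (rule closure_minimal[OF \<omega>M closed_M])
  then have "compact (closure \<omega>)"
    using closed_Int_compact[OF closed_closure compact_M, of \<omega>] by (simp add: Int_absorb2)
  then have "compact (fst ` closure \<omega>)"
    by (intro compact_continuous_image continuous_on_fst continuous_on_id)
  then have closed: "closed (fst ` closure \<omega>)" by (rule compact_imp_closed)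
  have "0 \<notin> fst ` closure \<omega>" using disj by auto
  from separate_point_closed[OF closed this]
  obtain d where d: "d > 0" "\<And>x. x \<in> fst ` closure \<omega> \<Longrightarrow> d \<le> dist 0 x"
    by blast
  define \<delta> where "\<delta> = min d 1"
  have \<delta>: "0 < \<delta>" "\<delta> \<le> 1" using d(1) by (auto simp: \<delta>_def)
  have far: "\<delta> \<le> \<bar>fst z\<bar>" if "z \<in> \<omega>" for z
    using d(2)[of "fst z"] that closure_subset[of \<omega>] by (auto simp: \<delta>_def min_le_iff_disj)
  obtain C c \<mu>0 where Cc: "C > 0" "c > 0" and decay:
    "\<And>\<mu>. \<mu> \<ge> \<mu>0 \<Longrightarrow> \<exists>l v v'. ground_state \<gamma> \<mu> l v v' \<and> 0 \<le> l \<and>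
      (\<forall>x. \<delta> \<le> \<bar>x\<bar> \<and> \<bar>x\<bar> \<le> 1 \<longrightarrow>
        (v x)\<^sup>2 \<le> C * exp (- 2 * c * l powr ((\<gamma> + 1) / 2)) * integral {-1..1} (\<lambda>x. (v x)\<^sup>2))"
    using ground_state_decay[OF gamma_pos \<delta>] by blast
  obtain N :: nat where N: "\<mu>0 \<le> real N" using real_arch_simple by blast
  \<comment> \<open>The shift by N puts every frequency above the threshold \<mu>0, so the decay
    bound holds from j = 0 on.\<close>
  define \<kappa> where "\<kappa> j = 2 * pi * real (j + N + 1)" for j :: nat
  have \<kappa>_ge: "\<kappa> j \<ge> real (j + N + 1)" for j
  proof -
    have "1 * real (j + N + 1) \<le> 2 * pi * real (j + N + 1)"
      using pi_gt3 by (intro mult_right_mono) auto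
    then show ?thesis by (simp add: \<kappa>_def)
  qed
  have \<kappa>: "sin (\<kappa> j) = 0" "cos (\<kappa> j) = 1" "\<kappa> j \<noteq> 0" for j
    using sin_2npi[of "j + N + 1"] cos_2npi[of "j + N + 1"] \<kappa>_ge[of j] by (auto simp: \<kappa>_def mult_ac)
  have "\<kappa> j \<ge> \<mu>0" for j using \<kappa>_ge[of j] N by simp
  then have "\<forall>j. \<exists>l v v'. ground_state \<gamma> (\<kappa> j) l v v' \<and> 0 \<le> l \<and>
      (\<forall>x. \<delta> \<le> \<bar>x\<bar> \<and> \<bar>x\<bar> \<le> 1 \<longrightarrow>
        (v x)\<^sup>2 \<le> C * exp (- 2 * c * l powr ((\<gamma> + 1) / 2)) * integral {-1..1} (\<lambda>x. (v x)\<^sup>2))"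
    using decay by blast
  then obtain l v v' where g: "\<And>j. ground_state \<gamma> (\<kappa> j) (l j) (v j) (v' j)"
    and v_le: "\<And>j x. \<delta> \<le> \<bar>x\<bar> \<Longrightarrow> \<bar>x\<bar> \<le> 1 \<Longrightarrow> (v j x)\<^sup>2
      \<le> C * exp (- 2 * c * l j powr ((\<gamma> + 1) / 2)) * integral {-1..1} (\<lambda>x. (v j x)\<^sup>2)"
    by metis
  have "\<forall>j. \<exists>B b. sine_lift p (\<kappa> j) B \<and> test_approximation p M B b"
    using sine_approximable \<kappa> by blast
  then obtain B b where B: "\<And>j. sine_lift p (\<kappa> j) (B j)" "\<And>j. test_approximation p M (B j) (b j)"
    by metis
  define \<phi> where "\<phi> j = tensor (v j) (B j 0)" for j
  have eig: "eigenpair (vol p) (grushin \<gamma> p M) (l j) (\<phi> j)" for j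
    unfolding \<phi>_def by (rule ground_state_eigenpair[OF g \<kappa> B])
  have lim: "filterlim l at_top sequentially"
    unfolding filterlim_at_top
  proof
    fix Z :: real
    have "max Z 1 > 0" by simp
    then obtain \<mu>1 where \<mu>1: "\<And>\<mu> l v v'. \<mu> \<ge> \<mu>1 \<Longrightarrow> ground_state \<gamma> \<mu> l v v' \<Longrightarrow> max Z 1 \<le> l"
      using ground_state_lower[OF gamma_pos] by blast
    obtain j0 :: nat where j0: "\<mu>1 \<le> real j0" using real_arch_simple by blast
    have "Z \<le> l j" if "j \<ge> j0" for j
    proof -
      have "\<mu>1 \<le> \<kappa> j" using \<kappa>_ge[of j] j0 that by simp
      from \<mu>1[OF this g] show ?thesis by simp
    qed
    then show "\<forall>\<^sub>F j in sequentially. Z \<le> l j" by (auto simp: eventually_sequentially)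
  qed
  have bound: "L2_norm_on (vol p) \<omega> (\<phi> j)
      \<le> sqrt (2 * C) * exp (- c * l j powr ((\<gamma> + 1) / 2)) * L2_norm (vol p) (\<phi> j)" for j
  proof -
    define L where "L = l j powr ((\<gamma> + 1) / 2)"
    define I where "I = integral {-1..1} (\<lambda>x. (v j x)\<^sup>2)"
    define J where "J = integral {0..1} (\<lambda>t. (B j 0 (p t))\<^sup>2)"
    define D where "D = C * exp (- 2 * c * L) * I"
    have vc: "continuous_on UNIV (v j)"
      using g[of j] unfolding ground_state_def
      by (metis DERIV_continuous_on has_field_derivative_at_within)
    have Bc: "continuous_on UNIV (B j 0)" using B(1)[of j] by (simp add: sine_lift_def)
    have I0: "I \<ge> 0" unfolding I_def
      by (intro Henstock_Kurzweil_Integration.integral_nonneg integrable_continuous_real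
          continuous_intros continuous_on_subset[OF vc]) auto
    have D0: "D \<ge> 0" using I0 Cc by (simp add: D_def)
    have norm: "L2_norm (vol p) (\<phi> j) = sqrt (I * J)"
      unfolding L2_norm_eq \<phi>_def vol_integral_tensor_square[OF vc Bc] I_def J_def ..
    \<comment> \<open>On \<open>\<omega>\<close> the factor v^2 is replaced by the constant
      \<open>D\<close>, and the integral is then enlarged to all of M; the length 2 of [-1, 1] is
      the 2 in sqrt (2 C). In the comparison a nonintegrable left-hand side would have integral 0,
      so an integrable nonnegative majorant settles it.\<close>
    have const: "(\<integral>z. (cmod (tensor (\<lambda>x. 1) (B j 0) z))\<^sup>2 \<partial>vol p) = 2 * J"
      by (subst vol_integral_tensor_square) (auto simp: J_def Bc)
    have "(\<integral>z. indicator \<omega> z *\<^sub>R (cmod (\<phi> j z))\<^sup>2 \<partial>vol p)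
        \<le> (\<integral>z. D * (cmod (tensor (\<lambda>x. 1) (B j 0) z))\<^sup>2 \<partial>vol p)"
    proof (rule integral_mono')
      show "integrable (vol p) (\<lambda>z. D * (cmod (tensor (\<lambda>x. 1) (B j 0) z))\<^sup>2)"
        by (intro vol_integral continuous_intros continuous_tensor Bc)
      fix z
      show "0 \<le> D * (cmod (tensor (\<lambda>x. 1) (B j 0) z))\<^sup>2" using D0 by simp
      show "indicator \<omega> z *\<^sub>R (cmod (\<phi> j z))\<^sup>2 \<le> D * (cmod (tensor (\<lambda>x. 1) (B j 0) z))\<^sup>2"
      proof (cases "z \<in> \<omega>")
        case True
        then have "(v j (fst z))\<^sup>2 \<le> D"
          using v_le[of "fst z" j] far[OF True] M_bounds[of z] \<omega>M by (auto simp: D_def L_def I_def)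
        then have "(v j (fst z))\<^sup>2 * (B j 0 (snd z))\<^sup>2 \<le> D * (B j 0 (snd z))\<^sup>2"
          by (rule mult_right_mono) simp
        then show ?thesis using True by (simp add: \<phi>_def tensor_def norm_mult power_mult_distrib)
      qed (use D0 in simp)
    qed
    also have "\<dots> = 2 * C * (exp (- c * L))\<^sup>2 * (I * J)"
      by (simp add: const D_def flip: exp_double)
    finally have "L2_norm_on (vol p) \<omega> (\<phi> j) \<le> sqrt (2 * C * (exp (- c * L))\<^sup>2 * (I * J))"
      unfolding L2_norm_on_def set_lebesgue_integral_def by (rule real_sqrt_le_mono)
    also have "\<dots> = sqrt (2 * C) * exp (- c * L) * L2_norm (vol p) (\<phi> j)"
      by (simp add: norm real_sqrt_mult)
    finally show ?thesis unfolding L_def .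
  qed
  show ?thesis
    by (rule exI[of _ "sqrt (2 * C)"], rule conjI, use Cc in simp, rule exI[of _ c], rule conjI,
        rule Cc, intro exI[of _ l] exI[of _ \<phi>] conjI allI eig lim bound)
qed

end

section \<open>The rectangle and the cylinder\<close>

lemma DERIV_shift_0:
  "(f has_real_derivative D) (at y) \<Longrightarrow> ((\<lambda>t. f (y + t)) has_real_derivative D) (at 0)"
  using DERIV_shift[of f D 0 y] by (simp add: add.commute)

text \<open>One phase shift by pi / 2 per derivative gives a single formula for all orders.\<close>

definition sine_derivative :: "real \<Rightarrow> nat \<Rightarrow> real \<Rightarrow> real"
  where "sine_derivative \<kappa> i t = \<kappa> ^ i * sin (\<kappa> * t + real i * (pi / 2))"

lemma sine_derivative_has_derivative:
  "(sine_derivative \<kappa> i has_real_derivative sine_derivative \<kappa> (Suc i) t) (at t)"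
proof -
  have "sin (\<kappa> * t + real (Suc i) * (pi / 2)) = sin (\<kappa> * t + real i * (pi / 2) + pi / 2)"
    by (simp add: algebra_simps add_divide_distrib)
  also have "\<dots> = cos (\<kappa> * t + real i * (pi / 2))" unfolding sin_add by simp
  finally have "sin (\<kappa> * t + real (Suc i) * (pi / 2)) = cos (\<kappa> * t + real i * (pi / 2))" .
  then show ?thesis unfolding sine_derivative_def[abs_def]
    by (auto intro!: derivative_eq_intros)
qed

lemma sine_derivative_simps:
  "sine_derivative \<kappa> 0 t = sin (\<kappa> * t)" "sine_derivative \<kappa> (Suc 0) t = \<kappa> * cos (\<kappa> * t)"
  "sine_derivative \<kappa> (Suc (Suc 0)) t = - \<kappa>\<^sup>2 * sine_derivative \<kappa> 0 t"
  by (simp_all add: sine_derivative_def sin_add power2_eq_square)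

lemma sine_derivative_continuous: "continuous_on X (sine_derivative \<kappa> i)"
  by (rule DERIV_continuous_on) (rule has_field_derivative_at_within[OF sine_derivative_has_derivative])

lemma test_function_eq_0: "f \<in> test_functions p M \<Longrightarrow> z \<notin> interior M \<Longrightarrow> f z = 0"
  unfolding test_functions_def using closure_subset[of "{z. f z \<noteq> 0}"] by blast

text \<open>The support is closed and inside the interior, so f vanishes near every point outside
  it. On the horizontal sides this yields the derivative condition of
  \<open>periodic_C2\<close>.\<close>

lemma test_function_partial2_id_eq_0:
  fixes M :: "(real \<times> real) set"
  assumes f: "f \<in> test_functions id M" and z: "(x, y) \<notin> interior M"
  shows "partial2 id f (x, y) = 0"
proof -
  let ?N = "- closure {z. f z \<noteq> 0}"
  have "((\<lambda>t. f (x, y + t)) has_vector_derivative 0) (at 0)"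
  proof (rule has_vector_derivative_transform_within_open[where S = "(\<lambda>t. (x, y + t)) -` ?N"])
    show "((\<lambda>t. 0) has_vector_derivative 0) (at 0)" by simp
    show "open ((\<lambda>t. (x, y + t)) -` ?N)"
      by (intro open_vimage continuous_intros) auto
    show "0 \<in> (\<lambda>t. (x, y + t)) -` ?N" using f z by (auto simp: test_functions_def)
    show "0 = f (x, y + t)" if "t \<in> (\<lambda>t. (x, y + t)) -` ?N" for t
      using that closure_subset[of "{z. f z \<noteq> 0}"] by auto
  qed
  then show ?thesis by (simp add: partial2_def vector_derivative_at)
qed

text \<open>The sine vanishes at 0 and 1, so the one-dimensional approximation is used a second
  time, now in x_2, to meet the Dirichlet condition on the horizontal sides.\<close>

lemma grushin_domain_rectangle:
  assumes "\<gamma> > 0" shows "grushin_domain id \<gamma> rectangle"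
proof -
  interpret grushin_homomorphism "id :: real \<Rightarrow> real" \<gamma>
    by unfold_locales (use assms in \<open>auto simp: id_def\<close>)
  have int: "interior rectangle = {-1<..<1} \<times> {0<..<1}"
    by (simp add: interior_Times)
  show ?thesis
  proof
    fix f assume f: "f \<in> test_functions id rectangle"
    show "periodic_C2 f"
      unfolding periodic_C2_def
      using f test_function_eq_0[OF f] test_function_partial2_id_eq_0[OF f]
      by (auto simp: int test_functions_def simp del: C_k.simps)
  next
    fix \<kappa> :: real assume \<kappa>: "sin \<kappa> = 0" "cos \<kappa> = 1"
    have s0: "sine_derivative \<kappa> 0 0 = 0" "sine_derivative \<kappa> 0 1 = 0"
      using \<kappa> by (simp_all add: sine_derivative_simps)
    obtain a a' C where a: "\<And>n. smooth (a n)" "\<And>n x. (a n has_real_derivative a' n x) (at x)"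
      "\<And>n x. x \<notin> {0 + 1 / Suc n..1 - 1 / Suc n} \<Longrightarrow> a n x = 0"
      "\<And>x. 0 < x \<Longrightarrow> x < 1 \<Longrightarrow> (\<lambda>n. a n x) \<longlonglongrightarrow> sine_derivative \<kappa> 0 x"
      "\<And>x. 0 < x \<Longrightarrow> x < 1 \<Longrightarrow> (\<lambda>n. a' n x) \<longlonglongrightarrow> sine_derivative \<kappa> (Suc 0) x"
      "\<And>n x. 0 \<le> x \<Longrightarrow> x \<le> 1 \<Longrightarrow> \<bar>a n x\<bar> \<le> C"
      "\<And>n x. 0 \<le> x \<Longrightarrow> x \<le> 1 \<Longrightarrow> \<bar>a' n x\<bar> \<le> C"
      by (rule compactly_supported_approximation[OF zero_less_one sine_derivative_has_derivative
            sine_derivative_continuous s0]) (rule that; assumption)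
    have "\<exists>A. A 0 = a n \<and> (\<forall>i x. (A i has_real_derivative A (Suc i) x) (at x))" for n
      using smooth_derivatives[OF a(1)] by metis
    then obtain b where b: "\<And>n. b n 0 = a n"
      "\<And>n i x. (b n i has_real_derivative b n (Suc i) x) (at x)"
      by metis
    have b1: "b n (Suc 0) = a' n" for n
      using DERIV_unique[OF b(2)[of n 0, unfolded b(1)] a(2)] by blast
    have "sine_lift id \<kappa> (sine_derivative \<kappa>)"
      unfolding sine_lift_def
      by (intro conjI allI sine_derivative_continuous sine_derivative_simps
          DERIV_shift_0[OF sine_derivative_has_derivative, folded id_def] | simp add: sine_derivative_simps
          DERIV_shift_0[OF sine_derivative_has_derivative])+
    moreover have "test_approximation id rectangle (sine_derivative \<kappa>) b"
      unfolding test_approximation_def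
    proof (intro conjI allI)
      show "continuous_on UNIV (b n i)" for n i
        by (rule DERIV_continuous_on) (rule has_field_derivative_at_within[OF b(2)])
      show "((\<lambda>t. b n i (y + id t)) has_real_derivative b n (Suc i) y) (at 0)" for n i y
        using DERIV_shift_0[OF b(2)] by simp
      show "\<exists>K. compact K \<and> closed K \<and> (\<forall>y. y \<notin> K \<longrightarrow> b n 0 y = 0) \<and>
          {-1<..<1} \<times> K \<subseteq> interior rectangle" for n
      proof (intro exI conjI allI impI)
        show "compact {0 + 1 / Suc n..1 - 1 / Suc n}" "closed {0 + 1 / Suc n..1 - 1 / Suc n}" by auto
        show "b n 0 y = 0" if "y \<notin> {0 + 1 / Suc n..1 - 1 / Suc n}" for y
          unfolding b(1) by (rule a(3)[OF that])
        have "{0 + e..1 - e} \<subseteq> {0<..<1}" if "e > 0" for e :: real using that by auto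
        then have "{0 + 1 / Suc n..1 - 1 / Suc n} \<subseteq> {0<..<1::real}" by simp
        then show "{-1<..<1} \<times> {0 + 1 / Suc n..1 - 1 / Suc n} \<subseteq> interior rectangle"
          unfolding int by (intro Sigma_mono subset_refl)
      qed
      show "i < 2 \<longrightarrow> (\<forall>t. 0 < t \<and> t < 1 \<longrightarrow>
          (\<lambda>n. b n i (id t)) \<longlonglongrightarrow> sine_derivative \<kappa> i (id t))" for i
        using a(4,5) by (auto simp: less_2_cases_iff b b1)
      show "\<exists>C. \<forall>i<2. \<forall>n t. 0 < t \<and> t < 1 \<longrightarrow> \<bar>b n i (id t)\<bar> \<le> C"
        using a(6,7) by (intro exI[of _ C]) (auto simp: less_2_cases_iff b b1)
    qed
    ultimately show "\<exists>B b. sine_lift id \<kappa> B \<and> test_approximation id rectangle B b" by blast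
  qed (auto intro!: compact_Times closed_Times)
qed

lemma continuous_on_circle_iff:
  "continuous_on UNIV (\<lambda>t. f (to_circle t)) \<longleftrightarrow> continuous_on UNIV f"
  for f :: "circle \<Rightarrow> 'a::topological_space"
  by (simp add: continuous_on_open_vimage open_circle_def vimage_def)

lemma continuous_to_circle: "continuous_on UNIV to_circle"
  using continuous_on_circle_iff[of "\<lambda>c. c"] by (simp add: continuous_on_id)

lemma to_circle_add: "to_circle (s + t) = to_circle s + to_circle t"
  by (simp add: plus_circle.abs_eq)

lemma to_circle_eq_iff: "to_circle s = to_circle t \<longleftrightarrow> s - t \<in> \<int>"
  by (rule circle.abs_eq_iff)

lemma compact_circle: "compact (UNIV :: circle set)"
proof -
  have "c \<in> to_circle ` {0..1}" for c
  proof (induction c rule: circle.abs_induct)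
    case (1 t)
    have "to_circle t = to_circle (frac t)" by (simp add: to_circle_eq_iff frac_def)
    then show ?case by (metis atLeastAtMost_iff frac_ge_0 frac_lt_1 image_eqI less_imp_le)
  qed
  then have "UNIV = to_circle ` {0..1}" by blast
  then show ?thesis
    by (metis compact_Icc compact_continuous_image continuous_on_subset continuous_to_circle subset_UNIV)
qed

lemma sine_derivative_periodic:
  assumes "cos \<kappa> = 1" "s - t \<in> \<int>"
  shows "sine_derivative \<kappa> i s = sine_derivative \<kappa> i t"
proof -
  obtain m n :: int where "\<kappa> = of_int m * 2 * pi" "s = t + of_int n"
    using assms by (auto simp: cos_one_2pi_int Ints_def algebra_simps)
  then have s: "\<kappa> * s + c = \<kappa> * t + c + 2 * pi * of_int (m * n)" for c
    by (simp add: algebra_simps)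
  show ?thesis
    unfolding sine_derivative_def s by (simp add: sin_add cos_add sin_int_2pin cos_int_2pin del: of_int_mult)
qed

text \<open>The circle is compact without boundary, so the sine itself is an admissible factor: the
  approximating sequence is constant and K is the whole circle.\<close>

lemma grushin_domain_cylinder:
  assumes "\<gamma> > 0" shows "grushin_domain to_circle \<gamma> cylinder"
proof -
  interpret grushin_homomorphism to_circle \<gamma>
    by unfold_locales (use assms in \<open>auto simp: to_circle_add continuous_to_circle\<close>)
  have int: "interior cylinder = {-1<..<1} \<times> UNIV"
    by (simp add: interior_Times)
  have period: "to_circle 1 = to_circle 0" by (simp add: to_circle_eq_iff)
  show ?thesis
  proof
    fix f assume f: "f \<in> test_functions to_circle cylinder"
    show "periodic_C2 f"
      unfolding periodic_C2_def using f test_function_eq_0[OF f]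
      by (auto simp: int period test_functions_def simp del: C_k.simps)
  next
    fix \<kappa> :: real assume \<kappa>: "sin \<kappa> = 0" "cos \<kappa> = 1"
    \<comment> \<open>The choice of representative is harmless because \<kappa> is a multiple of 2
      pi; the equation \<open>B\<close> below expresses this independence.\<close>
    define B where "B i c = sine_derivative \<kappa> i (rep_circle c)" for i c
    have B: "B i (to_circle t) = sine_derivative \<kappa> i t" for i t
    proof -
      have "to_circle (rep_circle (to_circle t)) = to_circle t"
        by (rule Quotient3_abs_rep[OF Quotient3_circle])
      then show ?thesis
        unfolding B_def to_circle_eq_iff by (rule sine_derivative_periodic[OF \<kappa>(2)])
    qed
    have Bc: "continuous_on UNIV (B i)" for i
      unfolding continuous_on_circle_iff[symmetric] B by (rule sine_derivative_continuous)
    have Bd: "((\<lambda>t. B i (y + to_circle t)) has_real_derivative B (Suc i) y) (at 0)" for i y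
    proof (induction y rule: circle.abs_induct)
      case (1 s)
      show ?case
        unfolding to_circle_add[symmetric] B by (rule DERIV_shift_0[OF sine_derivative_has_derivative])
    qed
    have B2: "B (Suc (Suc 0)) y = - \<kappa>\<^sup>2 * B 0 y" for y
      unfolding B_def by (rule sine_derivative_simps)
    have lift: "sine_lift to_circle \<kappa> B"
      unfolding sine_lift_def using Bc Bd B2 by (simp add: B sine_derivative_simps)
    have "\<bar>B i (to_circle t)\<bar> \<le> 1 + \<bar>\<kappa>\<bar>" if "i < 2" for i t
    proof -
      have "\<bar>\<kappa> ^ i\<bar> * \<bar>sin (\<kappa> * t + real i * (pi / 2))\<bar> \<le> (1 + \<bar>\<kappa>\<bar>) * 1"
        using that by (intro mult_mono) (auto simp: less_2_cases_iff)
      then show ?thesis by (simp add: B sine_derivative_def abs_mult)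
    qed
    then have "test_approximation to_circle cylinder B (\<lambda>n. B)"
      unfolding test_approximation_def using Bc Bd compact_circle
      by (auto simp: int intro!: exI[of _ "UNIV :: circle set"])
    then show "\<exists>B b. sine_lift to_circle \<kappa> B \<and> test_approximation to_circle cylinder B b"
      using lift by blast
  qed (auto intro!: compact_Times closed_Times compact_circle)
qed

theorem proposition1p12:
  fixes \<gamma> :: real
  assumes "\<gamma> > 0"
  shows
    "(\<forall>\<omega>. openin (top_of_set rectangle) \<omega> \<and> closure \<omega> \<inter> {z. fst z = 0} = {} \<longrightarrow>
       (\<exists>C>0. \<exists>c0>0. \<exists>(l :: nat \<Rightarrow> real) \<phi>.
          (\<forall>j. eigenpair (vol id) (grushin \<gamma> id rectangle) (l j) (\<phi> j)) \<and>
          filterlim l at_top sequentially \<and>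
          (\<forall>j. L2_norm_on (vol id) \<omega> (\<phi> j)
               \<le> C * exp (- c0 * l j powr ((\<gamma> + 1) / 2)) * L2_norm (vol id) (\<phi> j))))
     \<and>
     (\<forall>\<omega>. openin (top_of_set cylinder) \<omega> \<and> closure \<omega> \<inter> {z. fst z = 0} = {} \<longrightarrow>
       (\<exists>C>0. \<exists>c0>0. \<exists>(l :: nat \<Rightarrow> real) \<phi>.
          (\<forall>j. eigenpair (vol to_circle) (grushin \<gamma> to_circle cylinder) (l j) (\<phi> j)) \<and>
          filterlim l at_top sequentially \<and>
          (\<forall>j. L2_norm_on (vol to_circle) \<omega> (\<phi> j)
               \<le> C * exp (- c0 * l j powr ((\<gamma> + 1) / 2)) * L2_norm (vol to_circle) (\<phi> j))))"
  by (intro conjI allI impI; elim conjE)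
    (rule grushin_domain.grushin_concentration[OF grushin_domain_rectangle[OF assms]], assumption+,
     rule grushin_domain.grushin_concentration[OF grushin_domain_cylinder[OF assms]], assumption+)

end
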